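(* Let $s\in\mathbb{Z}_+$, $K$ be an $s$-order standard kernel, and $T$ an $s$-order Calderón–Zygmund singular integral operator with kernel $K$. Let $\widetilde K(x,y):=K(y,x)$, let $B_0:=B(x_0,r_0)\subset\mathbb{R}^n$ be a given ball with $x_0\in\mathbb{R}^n$ and $r_0\in(0,\infty)$, and, for any $\nu\in\mathbb{Z}_+^n$ with $|\nu|\le s$, let $$\widetilde T_{B_0}(y^\nu)(\cdot):=\lim_{\eta\to0^+}\int_{\mathbb{R}^n\setminus B(\cdot,\eta)}\Big[\widetilde K(\cdot,y)-\sum_{\{\gamma\in\mathbb{Z}_+^n:\,|\gamma|\le s\}}\frac{\partial_{(1)}^\gamma\widetilde K(x_0,y)}{\gamma!}(\cdot-x_0)^\gamma\mathbf 1_{\mathbb{R}^n\setminus B_0}(y)\Big]y^\nu\,dy.$$ Then $T^*(x^\gamma)=0$ for all $\gamma\in\mathbb{Z}_+^n$ with $|\gamma|\le s$ [that is, for any $a\in L^2(\mathbb{R}^n)$ having compact support and satisfying $\int_{\mathbb{R}^n}a(x)x^\gamma\,dx=0$ for all $|\gamma|\le s$, one has $\int_{\mathbb{R}^n}T(a)(x)x^\gamma\,dx=0$ for all $|\gamma|\le s$] if and only if, for any $\nu\in\mathbb{Z}_+^n$ with $|\nu|\le s$, $\widetilde T_{B_0}(y^\nu)\in\mathcal{P}_s(\mathbb{R}^n)$ after changing values on a set of measure zero.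
   Context: Notation: $\mathbb{Z}_+=\{0,1,2,\ldots\}$; for $\gamma\in\mathbb{Z}_+^n$, $|\gamma|=\gamma_1+\cdots+\gamma_n$, $\gamma!=\gamma_1!\cdots\gamma_n!$, $x^\gamma=x_1^{\gamma_1}\cdots x_n^{\gamma_n}$; $\partial_{(1)}^\gamma F(x,y)$ and $\partial_{(2)}^\gamma F(x,y)$ are the $\gamma$-order partial derivatives in $x$ and in $y$. $\mathcal{P}_s(\mathbb{R}^n)$ is the set of polynomials of degree at most $s$. $\eta\to0^+$ means $\eta\in(0,\infty)$ and $\eta\to0$. $s$-order standard kernel: a measurable $K$ on $\mathbb{R}^n\times\mathbb{R}^n\setminus\{(x,x)\}$ such that there exist $C>0$ and $\delta\in(0,1]$ such that for all $|\gamma|\le s$: (i) $|\partial_{(2)}^\gamma K(x,y)|\le C|x-y|^{-n-|\gamma|}$ for $x\ne y$; (ii) the same for $\partial_{(1)}^\gamma K$; (iii) $|\partial_{(2)}^\gamma K(x,y)-\partial_{(2)}^\gamma K(x,z)|\le C\frac{|y-z|^\delta}{|x-y|^{n+|\gamma|+\delta}}$ whenever $x\neq y$, $|x-y|\ge2|y-z|$; (iv) the analogue of (iii) in the first variable. $s$-order Calderón–Zygmund singular integral operator with kernel $K$: a linear operator $T$ bounded on $L^2(\mathbb{R}^n)$ such that for every $f\in L^2(\mathbb{R}^n)$ and almost every $x$, $T(f)(x)=\lim_{\eta\to0^+}\int_{\mathbb{R}^n\setminus B(x,\eta)}K(x,y)f(y)\,dy$.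
   Formalization: The limit defining the modified operator applied to y^ν is assumed to exist for almost every x, for all |ν| ≤ s; for some standard kernels with T^*(1)=0 this limit diverges almost everywhere, so the object would otherwise be undefined. *)

theory Defs
  imports "HOL-Analysis.Analysis"
begin

text \<open>
  Scalars range over a type of sort \<open>{real_normed_field, euclidean_space}\<close>, which has
  \<open>real\<close> and \<open>complex\<close> as instances; both the real and the complex reading are thus covered.
  Multi-indices are vectors of type \<open>nat ^ 'n\<close>.
\<close>

definition mi_order :: "nat ^ 'n \<Rightarrow> nat" where
  "mi_order \<gamma> = (\<Sum>i\<in>UNIV. \<gamma> $ i)"

definition mi_fact :: "nat ^ 'n \<Rightarrow> nat" where
  "mi_fact \<gamma> = (\<Prod>i\<in>UNIV. fact (\<gamma> $ i))"

definition mi_power :: "real ^ 'n \<Rightarrow> nat ^ 'n \<Rightarrow> real" where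
  "mi_power x \<gamma> = (\<Prod>i\<in>UNIV. (x $ i) ^ (\<gamma> $ i))"

lemma finite_mi_order_le: "finite {\<gamma> :: nat ^ 'n. mi_order \<gamma> \<le> s}"
proof (rule finite_subset)
  have "\<gamma> $ i \<le> mi_order \<gamma>" for \<gamma> :: "nat ^ 'n" and i
    unfolding mi_order_def by (rule member_le_sum) auto
  then show "{\<gamma> :: nat ^ 'n. mi_order \<gamma> \<le> s} \<subseteq> vec_lambda ` (UNIV \<rightarrow>\<^sub>E {..s})"
    by (auto intro!: image_eqI[of _ _ "vec_nth _"] intro: order_trans)
  show "finite (vec_lambda ` (UNIV \<rightarrow>\<^sub>E {..s}) :: (nat ^ 'n) set)"
    by (intro finite_imageI finite_PiE) auto
qed

definition poly_fun :: "nat \<Rightarrow> (real ^ 'n \<Rightarrow> 'a :: real_normed_field) set" where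
  "poly_fun s =
     {P. \<exists>c. P = (\<lambda>x. \<Sum>\<gamma> | mi_order \<gamma> \<le> s. c \<gamma> * of_real (mi_power x \<gamma>))}"

definition partial_deriv ::
    "'n :: finite \<Rightarrow> (real ^ 'n \<Rightarrow> 'a :: real_normed_vector) \<Rightarrow> real ^ 'n \<Rightarrow> 'a" where
  "partial_deriv i F x = vector_derivative (\<lambda>t. F (x + t *\<^sub>R axis i 1)) (at 0)"

text \<open>
  The coordinates are differentiated in a fixed but arbitrary order; \<open>has_partials_upto\<close>
  below makes the choice irrelevant.
\<close>

definition coords :: "'n :: finite list" where
  "coords = (SOME xs. set xs = UNIV \<and> distinct xs)"

definition mi_deriv ::
    "nat ^ 'n \<Rightarrow> (real ^ 'n \<Rightarrow> 'a :: real_normed_vector) \<Rightarrow> real ^ 'n \<Rightarrow> 'a" where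
  "mi_deriv \<gamma> F = foldr (\<lambda>i. partial_deriv i ^^ (\<gamma> $ i)) coords F"

text \<open>
  All partial derivatives of order at most \<open>s\<close> exist at the points of \<open>S\<close> and depend on the
  multi-index only, not on the order of differentiation.
\<close>

definition has_partials_upto ::
    "nat \<Rightarrow> (real ^ 'n) set \<Rightarrow> (real ^ 'n \<Rightarrow> 'a :: real_normed_vector) \<Rightarrow> bool" where
  "has_partials_upto s S F \<longleftrightarrow>
     (\<forall>\<gamma> i. \<forall>x\<in>S. mi_order \<gamma> < s \<longrightarrow>
        ((\<lambda>t. mi_deriv \<gamma> F (x + t *\<^sub>R axis i 1))
           has_vector_derivative mi_deriv (\<gamma> + axis i 1) F x) (at 0))"

text \<open>
  A kernel is a curried function whose values on the diagonal are irrelevant.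
\<close>

definition mi_deriv1 :: "nat ^ 'n \<Rightarrow> (real ^ 'n \<Rightarrow> real ^ 'n \<Rightarrow> 'a :: real_normed_vector)
    \<Rightarrow> real ^ 'n \<Rightarrow> real ^ 'n \<Rightarrow> 'a" where
  "mi_deriv1 \<gamma> K x y = mi_deriv \<gamma> (\<lambda>u. K u y) x"

definition mi_deriv2 :: "nat ^ 'n \<Rightarrow> (real ^ 'n \<Rightarrow> real ^ 'n \<Rightarrow> 'a :: real_normed_vector)
    \<Rightarrow> real ^ 'n \<Rightarrow> real ^ 'n \<Rightarrow> 'a" where
  "mi_deriv2 \<gamma> K x y = mi_deriv \<gamma> (\<lambda>v. K x v) y"

definition standard_kernel ::
    "nat \<Rightarrow> (real ^ 'n \<Rightarrow> real ^ 'n \<Rightarrow> 'a :: {real_normed_field, euclidean_space}) \<Rightarrow> bool" where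
  "standard_kernel s K \<longleftrightarrow>
     (\<lambda>(x, y). K x y) \<in> borel_measurable (lebesgue_on {(x, y). x \<noteq> y}) \<and>
     (\<forall>x. has_partials_upto s (- {x}) (\<lambda>y. K x y)) \<and>
     (\<forall>y. has_partials_upto s (- {y}) (\<lambda>x. K x y)) \<and>
     (\<exists>C > 0. \<exists>\<delta>. 0 < \<delta> \<and> \<delta> \<le> 1 \<and> (\<forall>\<gamma>. mi_order \<gamma> \<le> s \<longrightarrow>
        (\<forall>x y. x \<noteq> y \<longrightarrow>
           norm (mi_deriv2 \<gamma> K x y) \<le> C / norm (x - y) ^ (CARD('n) + mi_order \<gamma>)) \<and>
        (\<forall>x y. x \<noteq> y \<longrightarrow>
           norm (mi_deriv1 \<gamma> K x y) \<le> C / norm (x - y) ^ (CARD('n) + mi_order \<gamma>)) \<and>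
        (\<forall>x y z. x \<noteq> y \<and> norm (x - y) \<ge> 2 * norm (y - z) \<longrightarrow>
           norm (mi_deriv2 \<gamma> K x y - mi_deriv2 \<gamma> K x z)
             \<le> C * (norm (y - z) powr \<delta>
                     / norm (x - y) powr (real CARD('n) + real (mi_order \<gamma>) + \<delta>))) \<and>
        (\<forall>x y z. x \<noteq> y \<and> norm (x - y) \<ge> 2 * norm (y - z) \<longrightarrow>
           norm (mi_deriv1 \<gamma> K y x - mi_deriv1 \<gamma> K z x)
             \<le> C * (norm (y - z) powr \<delta>
                     / norm (x - y) powr (real CARD('n) + real (mi_order \<gamma>) + \<delta>)))))"

definition L2 :: "(real ^ 'n \<Rightarrow> 'a :: {real_normed_field, euclidean_space}) set" where
  "L2 = {f \<in> borel_measurable lebesgue. integrable lebesgue (\<lambda>x. (norm (f x))\<^sup>2)}"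

definition L2_norm :: "(real ^ 'n \<Rightarrow> 'a :: {real_normed_field, euclidean_space}) \<Rightarrow> real" where
  "L2_norm f = sqrt (LINT x|lebesgue. (norm (f x))\<^sup>2)"

text \<open>
  Operators act on representatives and the identities hold almost everywhere. Additivity and
  the norm bound imply that almost everywhere equal arguments have almost everywhere equal
  images, so this is the same as a bounded linear operator on equivalence classes.
\<close>

definition bounded_linear_L2 :: "((real ^ 'n \<Rightarrow> 'a :: {real_normed_field, euclidean_space})
    \<Rightarrow> real ^ 'n \<Rightarrow> 'a) \<Rightarrow> bool" where
  "bounded_linear_L2 T \<longleftrightarrow>
     (\<forall>f\<in>L2. T f \<in> L2) \<and>
     (\<forall>f\<in>L2. \<forall>g\<in>L2. AE x in lebesgue. T (\<lambda>x. f x + g x) x = T f x + T g x) \<and>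
     (\<forall>f\<in>L2. \<forall>c. AE x in lebesgue. T (\<lambda>x. c * f x) x = c * T f x) \<and>
     (\<exists>C. \<forall>f\<in>L2. L2_norm (T f) \<le> C * L2_norm f)"

definition cz_operator :: "(real ^ 'n \<Rightarrow> real ^ 'n \<Rightarrow> 'a :: {real_normed_field, euclidean_space})
    \<Rightarrow> ((real ^ 'n \<Rightarrow> 'a) \<Rightarrow> real ^ 'n \<Rightarrow> 'a) \<Rightarrow> bool" where
  "cz_operator K T \<longleftrightarrow>
     bounded_linear_L2 T \<and>
     (\<forall>f\<in>L2. AE x in lebesgue.
        ((\<lambda>\<eta>. LINT y : - ball x \<eta> | lebesgue. K x y * f y) \<longlongrightarrow> T f x) (at_right 0))"

text \<open>The condition that \<open>T\<^sup>*(x\<^sup>\<gamma>) = 0\<close> for all multi-indices of order at most \<open>s\<close>.\<close>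

definition adjoint_vanishes_on_polys :: "nat \<Rightarrow> ((real ^ 'n
    \<Rightarrow> 'a :: {real_normed_field, euclidean_space}) \<Rightarrow> real ^ 'n \<Rightarrow> 'a) \<Rightarrow> bool" where
  "adjoint_vanishes_on_polys s T \<longleftrightarrow>
     (\<forall>a\<in>L2. compact (closure {x. a x \<noteq> 0}) \<and>
        (\<forall>\<gamma>. mi_order \<gamma> \<le> s \<longrightarrow> (LINT x|lebesgue. a x * of_real (mi_power x \<gamma>)) = 0) \<longrightarrow>
        (\<forall>\<gamma>. mi_order \<gamma> \<le> s \<longrightarrow> (LINT x|lebesgue. T a x * of_real (mi_power x \<gamma>)) = 0))"

definition transpose_kernel :: "('b \<Rightarrow> 'b \<Rightarrow> 'a) \<Rightarrow> 'b \<Rightarrow> 'b \<Rightarrow> 'a" where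
  "transpose_kernel K x y = K y x"

text \<open>
  The next two functions take the kernel that is integrated, so they are to be applied to
  the transposed kernel of the operator.
\<close>

definition truncated_modified_cz :: "nat
    \<Rightarrow> (real ^ 'n \<Rightarrow> real ^ 'n \<Rightarrow> 'a :: {real_normed_field, euclidean_space})
    \<Rightarrow> real ^ 'n \<Rightarrow> real \<Rightarrow> (real ^ 'n \<Rightarrow> 'a) \<Rightarrow> real \<Rightarrow> real ^ 'n \<Rightarrow> 'a" where
  "truncated_modified_cz s K x\<^sub>0 r\<^sub>0 f \<eta> x =
     (LINT y : - ball x \<eta> | lebesgue.
        (K x y - (\<Sum>\<gamma> | mi_order \<gamma> \<le> s.
           mi_deriv1 \<gamma> K x\<^sub>0 y / of_nat (mi_fact \<gamma>) * of_real (mi_power (x - x\<^sub>0) \<gamma>)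
             * indicator (- ball x\<^sub>0 r\<^sub>0) y)) * f y)"

text \<open>
  \<^const>\<open>Lim\<close> is meaningful only where the limit exists. For the transposed kernel this is not
  a consequence of the almost everywhere convergence of the truncations of the operator itself:
  in dimension one, let \<open>K y x = (\<Sum>j\<in>\<int>. 2^j * \<phi> (2^j * (x - y)) * a (2^j * y))\<close> with \<open>\<phi>\<close> odd, smooth,
  supported in \<open>1/2 \<le> \<bar>w\<bar> \<le> 1\<close> and \<open>a t = \<alpha> * sin t + \<beta> * sin (2 * t)\<close>, where \<open>\<alpha>\<close> and \<open>\<beta>\<close> are such
  that the j-th summand integrates in \<open>y\<close> to \<open>cos (2^j * x) - cos (2^(j+1) * x)\<close>. So the
  almost everywhere existence of the limit has to be required where \<open>modified_cz\<close> is used.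
\<close>

definition modified_cz :: "nat
    \<Rightarrow> (real ^ 'n \<Rightarrow> real ^ 'n \<Rightarrow> 'a :: {real_normed_field, euclidean_space})
    \<Rightarrow> real ^ 'n \<Rightarrow> real \<Rightarrow> (real ^ 'n \<Rightarrow> 'a) \<Rightarrow> real ^ 'n \<Rightarrow> 'a" where
  "modified_cz s K x\<^sub>0 r\<^sub>0 f x =
     Lim (at_right 0) (\<lambda>\<eta>. truncated_modified_cz s K x\<^sub>0 r\<^sub>0 f \<eta> x)"

end

theory Submission
  imports Defs
begin

text \<open>
  The pairing identity behind the equivalence is
  \<open>\<integral> T(a) x\<^sup>\<nu> dx = \<integral> a(y) G\<^sub>\<nu>(y) dy\<close> for every \<open>a\<close> in \<open>L\<^sup>2\<close> of bounded support whose moments up to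
  order \<open>s\<close> vanish, where \<open>G\<^sub>\<nu>\<close> is the modified transposed operator applied to \<open>y\<^sup>\<nu>\<close>
  (\<open>adjoint_identity\<close>). If \<open>G\<^sub>\<nu>\<close> is a polynomial of degree at most \<open>s\<close>, the right-hand side is a
  combination of moments of \<open>a\<close> and vanishes. If conversely the left-hand side always vanishes, the
  functional \<open>a \<mapsto> \<integral> a G\<^sub>\<nu>\<close> is zero on the common kernel of the finitely many moment functionals, so
  linear algebra makes it a combination of them (\<open>functional_in_span_if_kernels_le\<close>): there is a
  polynomial \<open>P\<close> of degree at most \<open>s\<close> with \<open>\<integral> a (G\<^sub>\<nu> - P) = 0\<close> for all \<open>a\<close> of bounded support, and
  testing with the conjugate phase of \<open>G\<^sub>\<nu> - P\<close> on balls gives \<open>G\<^sub>\<nu> = P\<close> almost everywhere. The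
  functional lives on all functions of bounded support at once, so one \<open>P\<close> serves every ball.

  For the identity, split \<open>x\<^sup>\<nu>\<close> at a ball \<open>B\<close> about \<open>x\<^sub>0\<close> much larger than the support of \<open>a\<close>. Far from
  \<open>x\<^sub>0\<close> the vanishing moments allow one to subtract from \<open>K(x, y)\<close> its Taylor polynomial in \<open>y\<close> at \<open>x\<^sub>0\<close>;
  the remainder decays like \<open>\<bar>x - x\<^sub>0\<bar>\<close> to the power \<open>-n - s - \<delta>\<close> (\<open>kernel_taylor_remainder\<close>), so that the
  product with \<open>x\<^sup>\<nu>\<close> is integrable and Fubini applies. On \<open>B\<close> the Taylor polynomial contributes to
  \<open>G\<^sub>\<nu>\<close> only a polynomial in \<open>y\<close>, which \<open>a\<close> annihilates, and it remains to pass to the limit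
  \<open>\<eta> \<rightarrow> 0\<close> in the duality of the truncated operator and its transpose.

  That limit is the analytic core. Both truncations converge almost everywhere, by the definition of
  \<open>T\<close> and by the hypothesis on \<open>G\<^sub>\<nu>\<close>; almost everywhere convergence together with a uniform \<open>L\<^sup>2\<close> bound
  gives weak convergence (\<open>weak_limit_of_AE_limit\<close>). The truncations at one fixed level are bounded on
  \<open>L\<^sup>2\<close> uniformly in the level (\<open>op_trunc_uniform_bound\<close>): compare the truncated integral at \<open>x\<close> with
  \<open>T\<close> applied to the part of the function away from \<open>x\<close>, evaluated at points \<open>z\<close> near \<open>x\<close>, and average
  over \<open>z\<close>. This is Cotlar's argument, but since no supremum over the levels is taken, averages replace
  maximal functions and Tonelli's theorem suffices. The transposed bound follows by duality
  (\<open>op_trunc_transpose_bound\<close>).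
\<close>

section \<open>Square integrability and weak limits\<close>

lemma lebesgue_measurable_borel_version:
  fixes f :: "'b::euclidean_space \<Rightarrow> 'c::euclidean_space"
  assumes "f \<in> borel_measurable lebesgue"
  obtains g where "g \<in> borel_measurable borel" "AE x in lborel. f x = g x"
proof -
  have "\<exists>g\<in>borel_measurable borel. AE x in lborel. f x \<bullet> b = (g x :: real)" for b
    using completion_ex_borel_measurable_real[of "\<lambda>x. f x \<bullet> b" lborel] assms by auto
  then obtain g where g: "\<And>b. g b \<in> borel_measurable borel"
    "\<And>b. AE x in lborel. f x \<bullet> b = (g b x :: real)"
    by metis
  have "AE x in lborel. \<forall>b\<in>Basis. f x \<bullet> b = g b x"
    using g(2) by (intro AE_ball_countable') (auto intro: countable_finite)
  then have "AE x in lborel. f x = (\<Sum>b\<in>Basis. g b x *\<^sub>R b)"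
  proof eventually_elim
    case (elim x)
    then show ?case
      by (metis (mono_tags, lifting) euclidean_representation sum.cong)
  qed
  moreover have "(\<lambda>x. \<Sum>b\<in>Basis. g b x *\<^sub>R b) \<in> borel_measurable borel"
    using g(1) by measurable
  ultimately show thesis
    using that by blast
qed

lemma integrable_mult_L2:
  fixes f g :: "'b \<Rightarrow> 'c::{real_normed_field, second_countable_topology, banach}"
  assumes [measurable]: "f \<in> borel_measurable M" "g \<in> borel_measurable M"
    and "integrable M (\<lambda>x. (norm (f x))\<^sup>2)" "integrable M (\<lambda>x. (norm (g x))\<^sup>2)"
  shows "integrable M (\<lambda>x. f x * g x)"
proof (rule Bochner_Integration.integrable_bound)
  show "integrable M (\<lambda>x. (norm (f x))\<^sup>2 + (norm (g x))\<^sup>2)"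
    using assms by auto
  have "norm (f x * g x) \<le> (norm (f x))\<^sup>2 + (norm (g x))\<^sup>2" for x
    using sum_squares_bound[of "norm (f x)" "norm (g x)"]
      mult_nonneg_nonneg[OF norm_ge_zero[of "f x"] norm_ge_zero[of "g x"]]
    by (simp only: norm_mult)
  then show "AE x in M. norm (f x * g x) \<le> norm ((norm (f x))\<^sup>2 + (norm (g x))\<^sup>2)"
    by (auto intro: order_trans[OF _ abs_ge_self])
qed measurable

text \<open>
  With \<open>h = \<bar>f\<^sub>k - F\<bar>\<close>, the pointwise inequality \<open>h \<bar>g\<bar> \<le> min h (m \<bar>g\<bar>) \<bar>g\<bar> + h\<^sup>2 / m\<close> separates the two
  hypotheses: the first summand is dominated by \<open>m \<bar>g\<bar>\<^sup>2\<close> and tends to zero, the second has integral at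
  most a constant over \<open>m\<close>, for any \<open>m > 0\<close>.
\<close>

lemma weak_limit_of_AE_limit:
  fixes f :: "nat \<Rightarrow> 'b \<Rightarrow> 'c::{real_normed_field, second_countable_topology, banach}"
  assumes f[measurable]: "\<And>k. f k \<in> borel_measurable M"
    and F[measurable]: "F \<in> borel_measurable M"
    and g[measurable]: "g \<in> borel_measurable M"
    and g2: "integrable M (\<lambda>x. (norm (g x))\<^sup>2)"
    and lim: "AE x in M. (\<lambda>k. f k x) \<longlonglongrightarrow> F x"
    and bd: "\<And>k. (\<integral>\<^sup>+x. ennreal ((norm (f k x))\<^sup>2) \<partial>M) \<le> ennreal B"
  shows "integrable M (\<lambda>x. (norm (F x))\<^sup>2)"
    and "(\<lambda>k. LINT x|M. f k x * g x) \<longlonglongrightarrow> (LINT x|M. F x * g x)"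
proof -
  have f2: "integrable M (\<lambda>x. (norm (f k x))\<^sup>2)" for k
    using order.strict_trans1[OF bd[of k] ennreal_less_top] by (intro integrableI_nonneg) auto
  have "(\<integral>\<^sup>+x. ennreal ((norm (F x))\<^sup>2) \<partial>M)
      = (\<integral>\<^sup>+x. liminf (\<lambda>k. ennreal ((norm (f k x))\<^sup>2)) \<partial>M)"
  proof (intro nn_integral_cong_AE)
    show "AE x in M. ennreal ((norm (F x))\<^sup>2) = liminf (\<lambda>k. ennreal ((norm (f k x))\<^sup>2))"
      using lim
    proof eventually_elim
      case (elim x)
      then have "(\<lambda>k. ennreal ((norm (f k x))\<^sup>2)) \<longlonglongrightarrow> ennreal ((norm (F x))\<^sup>2)"
        by (intro tendsto_ennrealI tendsto_intros)
      from lim_imp_Liminf[OF _ this] show ?case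
        by simp
    qed
  qed
  also have "\<dots> \<le> liminf (\<lambda>k. \<integral>\<^sup>+x. ennreal ((norm (f k x))\<^sup>2) \<partial>M)"
    by (intro nn_integral_liminf) measurable
  also have "\<dots> \<le> liminf (\<lambda>k::nat. ennreal B)"
    by (intro Liminf_mono always_eventually allI bd)
  also have "\<dots> = ennreal B"
    by (simp add: Liminf_const)
  finally have FB: "(\<integral>\<^sup>+x. ennreal ((norm (F x))\<^sup>2) \<partial>M) \<le> ennreal B" .
  show F2: "integrable M (\<lambda>x. (norm (F x))\<^sup>2)"
    using order.strict_trans1[OF FB ennreal_less_top] by (intro integrableI_nonneg) auto
  define B' where "B' = max 0 B"
  have intle: "(LINT x|M. (norm (h x))\<^sup>2) \<le> B'"
    if "(\<integral>\<^sup>+x. ennreal ((norm (h x))\<^sup>2) \<partial>M) \<le> ennreal B" "h \<in> borel_measurable M"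
    for h :: "'b \<Rightarrow> 'c"
    using that(2) order_trans[OF that(1), of "ennreal B'"]
    by (subst integral_eq_nn_integral) (auto simp: B'_def intro!: enn2real_leI ennreal_leI)
  define h where "h k x = norm (f k x - F x)" for k x
  have hm[measurable]: "h k \<in> borel_measurable M" for k
    unfolding h_def by measurable
  have hle: "(h k x)\<^sup>2 \<le> 2 * (norm (f k x))\<^sup>2 + 2 * (norm (F x))\<^sup>2" for k x
  proof -
    have "(h k x)\<^sup>2 \<le> (norm (f k x) + norm (F x))\<^sup>2"
      unfolding h_def by (intro power_mono norm_triangle_ineq4) auto
    also have "\<dots> \<le> 2 * (norm (f k x))\<^sup>2 + 2 * (norm (F x))\<^sup>2"
      using sum_squares_bound[of "norm (f k x)" "norm (F x)"] by (simp add: power2_sum)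
    finally show ?thesis .
  qed
  have h2: "integrable M (\<lambda>x. (h k x)\<^sup>2)" for k
    by (rule Bochner_Integration.integrable_bound[of _ "\<lambda>x. 2 * (norm (f k x))\<^sup>2 + 2 * (norm (F x))\<^sup>2"])
      (use f2 F2 hle in \<open>auto intro: order_trans[OF _ abs_ge_self]\<close>)
  have h2le: "(LINT x|M. (h k x)\<^sup>2) \<le> 4 * B'" for k
  proof -
    have "(LINT x|M. (h k x)\<^sup>2) \<le> (LINT x|M. 2 * (norm (f k x))\<^sup>2 + 2 * (norm (F x))\<^sup>2)"
      by (intro integral_mono h2 hle) (use f2 F2 in auto)
    also have "\<dots> = 2 * (LINT x|M. (norm (f k x))\<^sup>2) + 2 * (LINT x|M. (norm (F x))\<^sup>2)"
      using f2 F2 by simp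
    also have "\<dots> \<le> 4 * B'"
      using intle[OF bd f, of k] intle[OF FB F] by simp
    finally show ?thesis .
  qed
  have hg: "integrable M (\<lambda>x. h k x * norm (g x))" for k
    by (rule integrable_mult_L2) (use h2 g2 in \<open>auto simp: h_def\<close>)
  have "(\<lambda>k. LINT x|M. h k x * norm (g x)) \<longlonglongrightarrow> 0"
  proof (rule LIMSEQ_I)
    fix r :: real assume r: "r > 0"
    \<comment> \<open>The error term is at most \<open>4 B' / m\<close>, so this \<open>m\<close> keeps it below \<open>r / 2\<close>.\<close>
    define m where "m = 8 * (B' + 1) / r"
    have m: "m > 0" unfolding m_def using r by (auto simp: B'_def intro!: divide_pos_pos)
    have "(\<lambda>k. LINT x|M. min (h k x) (m * norm (g x)) * norm (g x)) \<longlonglongrightarrow> (LINT x|M. 0)"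
    proof (rule integral_dominated_convergence[where w = "\<lambda>x. m * (norm (g x))\<^sup>2"])
      show "AE x in M. (\<lambda>k. min (h k x) (m * norm (g x)) * norm (g x)) \<longlonglongrightarrow> 0"
        using lim
      proof eventually_elim
        case (elim x)
        have "(\<lambda>k. h k x) \<longlonglongrightarrow> 0"
          unfolding h_def using elim by (intro tendsto_norm_zero) (simp add: LIM_zero)
        then have "(\<lambda>k. min (h k x) (m * norm (g x)) * norm (g x)) \<longlonglongrightarrow> min 0 (m * norm (g x)) * norm (g x)"
          by (intro tendsto_intros)
        then show ?case using m by (simp add: min_def)
      qed
      show "AE x in M. norm (min (h k x) (m * norm (g x)) * norm (g x)) \<le> m * (norm (g x))\<^sup>2" for k
      proof (intro AE_I2)
        fix x
        have "0 \<le> min (h k x) (m * norm (g x))" using m by (auto simp: h_def)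
        then show "norm (min (h k x) (m * norm (g x)) * norm (g x)) \<le> m * (norm (g x))\<^sup>2"
          by (auto simp: power2_eq_square abs_mult mult.assoc[symmetric] intro!: mult_right_mono)
      qed
    qed (use g2 in auto)
    then have "(\<lambda>k. LINT x|M. min (h k x) (m * norm (g x)) * norm (g x)) \<longlonglongrightarrow> 0" by simp
    from LIMSEQ_D[OF this half_gt_zero[OF r]] obtain N where
      N: "\<And>k. k \<ge> N \<Longrightarrow> \<bar>LINT x|M. min (h k x) (m * norm (g x)) * norm (g x)\<bar> < r / 2"
      by auto
    show "\<exists>no. \<forall>k\<ge>no. norm ((LINT x|M. h k x * norm (g x)) - 0) < r"
    proof (intro exI allI impI)
      fix k assume "k \<ge> N"
      have pt: "h k x * norm (g x) \<le> min (h k x) (m * norm (g x)) * norm (g x) + (h k x)\<^sup>2 / m" for x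
      proof (cases "h k x \<le> m * norm (g x)")
        case False
        then have "norm (g x) \<le> h k x / m" using m by (simp add: field_simps)
        then have "h k x * norm (g x) \<le> h k x * (h k x / m)"
          by (intro mult_left_mono) (auto simp: h_def)
        moreover have "0 \<le> min (h k x) (m * norm (g x)) * norm (g x)"
          using m by (auto simp: h_def)
        ultimately show ?thesis by (simp add: power2_eq_square)
      qed (use m in \<open>simp add: min_def\<close>)
      have imin: "integrable M (\<lambda>x. min (h k x) (m * norm (g x)) * norm (g x))"
      proof (rule Bochner_Integration.integrable_bound[OF hg[of k]])
        have "norm (min (h k x) (m * norm (g x)) * norm (g x)) \<le> norm (h k x * norm (g x))" for x
        proof -
          have "0 \<le> min (h k x) (m * norm (g x))" using m by (auto simp: h_def)
          then show ?thesis
            by (auto simp: abs_mult intro!: mult_right_mono)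
        qed
        then show "AE x in M. norm (min (h k x) (m * norm (g x)) * norm (g x)) \<le> norm (h k x * norm (g x))"
          by simp
      qed measurable
      have "(LINT x|M. h k x * norm (g x))
          \<le> (LINT x|M. min (h k x) (m * norm (g x)) * norm (g x) + (h k x)\<^sup>2 / m)"
        using imin h2[of k] by (intro integral_mono hg pt) auto
      also have "\<dots> = (LINT x|M. min (h k x) (m * norm (g x)) * norm (g x)) + (LINT x|M. (h k x)\<^sup>2) / m"
        using imin h2[of k] by simp
      also have "\<dots> < r / 2 + r / 2"
      proof (rule add_less_le_mono)
        show "(LINT x|M. min (h k x) (m * norm (g x)) * norm (g x)) < r / 2"
          using N[OF \<open>k \<ge> N\<close>] by simp
        have "(LINT x|M. (h k x)\<^sup>2) / m \<le> 4 * B' / m"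
          using h2le[of k] m by (simp add: divide_right_mono)
        also have "\<dots> \<le> r / 2"
          using r by (simp add: m_def B'_def field_simps)
        finally show "(LINT x|M. (h k x)\<^sup>2) / m \<le> r / 2" .
      qed
      finally have "(LINT x|M. h k x * norm (g x)) < r" by simp
      moreover have "0 \<le> (LINT x|M. h k x * norm (g x))"
        by (intro integral_nonneg_AE) (auto simp: h_def)
      ultimately show "norm ((LINT x|M. h k x * norm (g x)) - 0) < r" by simp
    qed
  qed
  then have "(\<lambda>k. (LINT x|M. f k x * g x) - (LINT x|M. F x * g x)) \<longlonglongrightarrow> 0"
  proof (rule Lim_null_comparison[rotated], intro always_eventually allI)
    fix k
    have i: "integrable M (\<lambda>x. f k x * g x)" "integrable M (\<lambda>x. F x * g x)"
      using f2 F2 g2 by (auto intro!: integrable_mult_L2)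
    have "norm ((LINT x|M. f k x * g x) - (LINT x|M. F x * g x))
        = norm (LINT x|M. f k x * g x - F x * g x)"
      using i by simp
    also have "\<dots> \<le> (LINT x|M. norm (f k x * g x - F x * g x))"
      by (rule integral_norm_bound)
    also have "\<dots> = (LINT x|M. h k x * norm (g x))"
      by (simp add: h_def norm_mult flip: left_diff_distrib)
    finally show "norm ((LINT x|M. f k x * g x) - (LINT x|M. F x * g x)) \<le> (LINT x|M. h k x * norm (g x))" .
  qed
  then show "(\<lambda>k. LINT x|M. f k x * g x) \<longlonglongrightarrow> (LINT x|M. F x * g x)"
    by (simp add: LIM_zero_iff)
qed

section \<open>Linear functionals\<close>

text \<open>
  By induction on the number of functionals: either the new functional already vanishes on the common
  kernel of the others, or some \<open>b\<close> in that kernel is not annihilated by it, and subtracting the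
  multiple of the new functional that agrees with \<open>G\<close> at \<open>b\<close> reduces to the others.
\<close>

lemma functional_in_span_if_kernels_le:
  fixes L :: "'i \<Rightarrow> ('b \<Rightarrow> 'c::field) \<Rightarrow> 'c" and G :: "('b \<Rightarrow> 'c) \<Rightarrow> 'c"
  assumes "finite I"
    and W: "\<And>u v c. u \<in> W \<Longrightarrow> v \<in> W \<Longrightarrow> (\<lambda>x. u x + c * v x) \<in> W"
    and L: "\<And>i u v c. i \<in> I \<Longrightarrow> u \<in> W \<Longrightarrow> v \<in> W \<Longrightarrow> L i (\<lambda>x. u x + c * v x) = L i u + c * L i v"
    and G: "\<And>u v c. u \<in> W \<Longrightarrow> v \<in> W \<Longrightarrow> G (\<lambda>x. u x + c * v x) = G u + c * G v"
    and ker: "\<And>u. u \<in> W \<Longrightarrow> (\<And>i. i \<in> I \<Longrightarrow> L i u = 0) \<Longrightarrow> G u = 0"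
  shows "\<exists>c. \<forall>u\<in>W. G u = (\<Sum>i\<in>I. c i * L i u)"
  using assms(1) L G ker
proof (induction I arbitrary: G rule: finite_induct)
  case empty
  then show ?case by auto
next
  case (insert j I)
  show ?case
  proof (cases "\<exists>b\<in>W. (\<forall>i\<in>I. L i b = 0) \<and> L j b \<noteq> 0")
    case False
    have "\<exists>c. \<forall>u\<in>W. G u = (\<Sum>i\<in>I. c i * L i u)"
    proof (rule insert.IH)
      fix u assume "u \<in> W" "\<And>i. i \<in> I \<Longrightarrow> L i u = 0"
      with False show "G u = 0"
        by (intro insert.prems(3)) auto
    qed (use insert.prems in auto)
    then obtain c where c: "\<forall>u\<in>W. G u = (\<Sum>i\<in>I. c i * L i u)" by blast
    have "(\<Sum>i\<in>I. (c(j := 0)) i * L i u) = (\<Sum>i\<in>I. c i * L i u)" for u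
      using insert.hyps by (intro sum.cong) auto
    then show ?thesis
      using insert.hyps c by (intro exI[of _ "c(j := 0)"]) auto
  next
    case True
    then obtain b where b: "b \<in> W" "\<forall>i\<in>I. L i b = 0" "L j b \<noteq> 0" by blast
    define q where "q = G b / L j b"
    have "\<exists>c. \<forall>u\<in>W. G u - q * L j u = (\<Sum>i\<in>I. c i * L i u)"
    proof (rule insert.IH)
      fix u assume u: "u \<in> W" "\<And>i. i \<in> I \<Longrightarrow> L i u = 0"
      define v where "v = (\<lambda>x. u x + (- L j u / L j b) * b x)"
      have "v \<in> W" unfolding v_def by (intro W u b)
      moreover have "L i v = 0" if "i \<in> insert j I" for i
        using that u b unfolding v_def by (subst insert.prems(1)) auto
      ultimately have "G v = 0" using insert.prems(3) by blast
      then show "G u - q * L j u = 0"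
        unfolding v_def using u b by (subst (asm) insert.prems(2)) (auto simp: q_def field_simps)
    qed (use insert.prems in \<open>auto simp: algebra_simps\<close>)
    then obtain c where c: "\<forall>u\<in>W. G u - q * L j u = (\<Sum>i\<in>I. c i * L i u)" by blast
    have "(\<Sum>i\<in>I. (c(j := q)) i * L i u) = (\<Sum>i\<in>I. c i * L i u)" for u
      using insert.hyps by (intro sum.cong) auto
    then show ?thesis
      using insert.hyps c by (intro exI[of _ "c(j := q)"]) (auto simp: algebra_simps)
  qed
qed

section \<open>Power tails and convolutions\<close>

text \<open>
  Dyadic shells: where \<open>2\<^sup>k \<eta> \<le> \<bar>u\<bar> < 2\<^sup>k\<^sup>+\<^sup>1 \<eta>\<close> the integrand is at most its value at the inner radius,
  and the resulting bounds form a geometric series of ratio \<open>2\<close> to the power \<open>-\<delta>\<close>. That the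
  constant is independent of \<open>\<eta>\<close> is what makes the operator bound below uniform.
\<close>

lemma nn_integral_power_tail:
  fixes \<delta> :: real
  assumes "\<delta> > 0"
  obtains A where "A > 0"
    "\<And>\<eta>. \<eta> > 0 \<Longrightarrow> (\<integral>\<^sup>+(u::'b::euclidean_space). ennreal (if norm u \<ge> \<eta> then 1 / norm u powr (real DIM('b) + \<delta>) else 0) \<partial>lborel)
        \<le> ennreal (A * \<eta> powr (-\<delta>))"
proof -
  let ?d = "real DIM('b)"
  define V where "V = measure lborel (ball (0::'b) 1)"
  have V: "V > 0" unfolding V_def using content_ball_pos[of 1 "0::'b"] by simp
  define q where "q = (1/2) powr \<delta>"
  have q: "0 < q" "q < 1"
    unfolding q_def using assms powr_less_mono'[of "1/2" 0 \<delta>] by auto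
  define A where "A = V * 2 ^ DIM('b) / (1 - q)"
  have A: "A > 0" unfolding A_def using V q by auto
  have "(\<integral>\<^sup>+(u::'b). ennreal (if norm u \<ge> \<eta> then 1 / norm u powr (?d + \<delta>) else 0) \<partial>lborel)
        \<le> ennreal (A * \<eta> powr (-\<delta>))" if \<eta>: "\<eta> > 0" for \<eta>
  proof -
    define c where "c k = 1 / (2 ^ k * \<eta>) powr (?d + \<delta>)" for k :: nat
    have c0: "c k \<ge> 0" for k unfolding c_def by simp
    have pt: "ennreal (if norm u \<ge> \<eta> then 1 / norm u powr (?d + \<delta>) else 0)
        \<le> (\<Sum>k. ennreal (c k) * indicator (ball 0 (2 ^ Suc k * \<eta>)) u)" for u :: 'b
    proof (cases "norm u \<ge> \<eta>")
      case True
      obtain N where N: "norm u / \<eta> < 2 ^ N"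
        using real_arch_pow[of 2 "norm u / \<eta>"] by auto
      define m where "m = (LEAST m. norm u < 2 ^ m * \<eta>)"
      have ex: "norm u < 2 ^ N * \<eta>" using N \<eta> by (simp add: field_simps)
      have m: "norm u < 2 ^ m * \<eta>" unfolding m_def using ex by (rule LeastI)
      then obtain k where k: "m = Suc k" using True by (cases m) auto
      have "\<not> norm u < 2 ^ k * \<eta>"
        using not_less_Least[of k "\<lambda>m. norm u < 2 ^ m * \<eta>"] k by (simp add: m_def)
      then have "1 / norm u powr (?d + \<delta>) \<le> c k"
        unfolding c_def using \<eta> assms by (intro divide_left_mono powr_mono2 mult_pos_pos) auto
      then have "ennreal (1 / norm u powr (?d + \<delta>)) \<le> ennreal (c k) * indicator (ball 0 (2 ^ Suc k * \<eta>)) u"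
        using m k by (auto simp: indicator_def intro!: ennreal_leI)
      also have "\<dots> \<le> (\<Sum>k. ennreal (c k) * indicator (ball 0 (2 ^ Suc k * \<eta>)) u)"
      proof -
        define e where "e k = ennreal (c k) * indicator (ball 0 (2 ^ Suc k * \<eta>)) u" for k
        have "sum e {k} \<le> suminf e" by (rule sum_le_suminf) auto
        then show ?thesis by (simp only: sum.insert finite.emptyI empty_iff not_False_eq_True sum.empty add_0_right e_def[abs_def])
      qed
      finally show ?thesis using True by simp
    qed simp
    have ck: "c k * (V * (2 ^ Suc k * \<eta>) ^ DIM('b)) = (V * 2 ^ DIM('b) * \<eta> powr (-\<delta>)) * q ^ k" for k
    proof -
      have "(2 ^ k * \<eta>) powr (?d + \<delta>) = (2 ^ k * \<eta>) ^ DIM('b) * (2 ^ k * \<eta>) powr \<delta>"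
        using \<eta> by (simp add: powr_add powr_realpow)
      moreover have "(2 ^ k * \<eta>) powr \<delta> = \<eta> powr \<delta> / q ^ k"
        using \<eta> by (simp add: powr_mult q_def powr_divide power_divide powr_power flip: powr_realpow)
          (simp add: powr_powr mult.commute)
      moreover have "(2 ^ Suc k * \<eta>) ^ DIM('b) = 2 ^ DIM('b) * (2 ^ k * \<eta>) ^ DIM('b)"
        by (simp add: power_mult_distrib)
      ultimately show ?thesis
        using \<eta> q by (simp add: c_def powr_minus field_simps)
    qed
    have "(\<integral>\<^sup>+(u::'b). ennreal (if norm u \<ge> \<eta> then 1 / norm u powr (?d + \<delta>) else 0) \<partial>lborel)
        \<le> (\<integral>\<^sup>+(u::'b). (\<Sum>k. ennreal (c k) * indicator (ball 0 (2 ^ Suc k * \<eta>)) u) \<partial>lborel)"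
      by (intro nn_integral_mono pt)
    also have "\<dots> = (\<Sum>k. ennreal (c k) * emeasure lborel (ball (0::'b) (2 ^ Suc k * \<eta>)))"
    proof -
      have "(\<lambda>u. ennreal (c k) * indicator (ball 0 (2 ^ Suc k * \<eta>)) (u::'b)) \<in> borel_measurable lborel" for k
        by (intro borel_measurable_times_ennreal borel_measurable_indicator) auto
      then show ?thesis
        by (subst nn_integral_suminf) (auto intro!: suminf_cong nn_integral_cmult_indicator)
    qed
    also have "\<dots> = (\<Sum>k. ennreal ((V * 2 ^ DIM('b) * \<eta> powr (-\<delta>)) * q ^ k))"
    proof (intro suminf_cong)
      fix k
      have "emeasure lborel (ball (0::'b) (2 ^ Suc k * \<eta>)) = ennreal (V * (2 ^ Suc k * \<eta>) ^ DIM('b))"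
        using content_ball_conv_unit_ball[of "2 ^ Suc k * \<eta>" "0::'b"] \<eta>
        by (subst emeasure_eq_ennreal_measure) (use emeasure_lborel_ball_finite in \<open>auto simp: V_def mult.commute top.not_eq_extremum\<close>)
      then show "ennreal (c k) * emeasure lborel (ball (0::'b) (2 ^ Suc k * \<eta>)) = ennreal ((V * 2 ^ DIM('b) * \<eta> powr (-\<delta>)) * q ^ k)"
        using c0[of k] by (simp only: ck flip: ennreal_mult')
    qed
    also have "\<dots> = ennreal (\<Sum>k. (V * 2 ^ DIM('b) * \<eta> powr (-\<delta>)) * q ^ k)"
      using V q by (intro suminf_ennreal2) (auto intro!: summable_mult summable_geometric)
    also have "(\<Sum>k. (V * 2 ^ DIM('b) * \<eta> powr (-\<delta>)) * q ^ k) = A * \<eta> powr (-\<delta>)"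
      using q by (simp add: suminf_mult suminf_geometric summable_geometric A_def)
    finally show ?thesis .
  qed
  then show thesis using that A by blast
qed

lemma nn_integral_lborel_reflect:
  fixes g :: "'b::euclidean_space \<Rightarrow> ennreal"
  assumes [measurable]: "g \<in> borel_measurable borel"
  shows "(\<integral>\<^sup>+y. g (x - y) \<partial>lborel) = (\<integral>\<^sup>+u. g u \<partial>lborel)"
  by (subst (2) lborel_affine[of "-1" x]) (simp_all add: nn_integral_density nn_integral_distr)

lemma nn_integral_lborel_shift:
  fixes g :: "'b::euclidean_space \<Rightarrow> ennreal"
  assumes [measurable]: "g \<in> borel_measurable borel"
  shows "(\<integral>\<^sup>+x. g (x - y) \<partial>lborel) = (\<integral>\<^sup>+u. g u \<partial>lborel)"
  by (subst (2) lborel_affine[of "1" "-y"]) (simp_all add: nn_integral_density nn_integral_distr)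

lemma nn_integral_convolution_eq:
  fixes k g :: "'b::euclidean_space \<Rightarrow> ennreal"
  assumes [measurable]: "k \<in> borel_measurable borel" "g \<in> borel_measurable borel"
  shows "(\<integral>\<^sup>+x. (\<integral>\<^sup>+y. k (x - y) * g y \<partial>lborel) \<partial>lborel) = (\<integral>\<^sup>+u. k u \<partial>lborel) * (\<integral>\<^sup>+y. g y \<partial>lborel)"
proof -
  have "(\<integral>\<^sup>+x. (\<integral>\<^sup>+y. k (x - y) * g y \<partial>lborel) \<partial>lborel) = (\<integral>\<^sup>+y. (\<integral>\<^sup>+x. k (x - y) * g y \<partial>lborel) \<partial>lborel)"
    by (rule lborel_pair.Fubini'[symmetric]) measurable
  also have "\<dots> = (\<integral>\<^sup>+y. (\<integral>\<^sup>+u. k u \<partial>lborel) * g y \<partial>lborel)"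
    by (simp add: nn_integral_multc nn_integral_lborel_shift)
  finally show ?thesis by (simp add: nn_integral_cmult)
qed

text \<open>
  Young's inequality for an \<open>L\<^sup>1\<close> kernel, from Cauchy--Schwarz with \<open>k\<close> split as \<open>sqrt k * sqrt k\<close>.
\<close>

lemma nn_integral_convolution_square_le:
  fixes k g :: "'b::euclidean_space \<Rightarrow> real"
  assumes [measurable]: "k \<in> borel_measurable borel" "g \<in> borel_measurable borel"
    and k: "\<And>u. k u \<ge> 0" and g: "\<And>u. g u \<ge> 0"
  shows "(\<integral>\<^sup>+x. (\<integral>\<^sup>+y. ennreal (k (x - y) * g y) \<partial>lborel)\<^sup>2 \<partial>lborel)
    \<le> (\<integral>\<^sup>+u. ennreal (k u) \<partial>lborel)\<^sup>2 * (\<integral>\<^sup>+y. ennreal ((g y)\<^sup>2) \<partial>lborel)"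
proof -
  let ?I = "\<integral>\<^sup>+u. ennreal (k u) \<partial>lborel"
  have "(\<integral>\<^sup>+y. ennreal (k (x - y) * g y) \<partial>lborel)\<^sup>2 \<le> ?I * (\<integral>\<^sup>+y. ennreal (k (x - y)) * ennreal ((g y)\<^sup>2) \<partial>lborel)" for x
  proof -
    have "(\<integral>\<^sup>+y. ennreal (k (x - y) * g y) \<partial>lborel)\<^sup>2
      = (\<integral>\<^sup>+y. ennreal (sqrt (k (x - y))) * ennreal (sqrt (k (x - y)) * g y) \<partial>lborel)\<^sup>2"
      using k g by (intro arg_cong[where f="\<lambda>z. z\<^sup>2"] nn_integral_cong) (simp add: mult.assoc[symmetric] flip: ennreal_mult)
    also have "\<dots> \<le> (\<integral>\<^sup>+y. (ennreal (sqrt (k (x - y))))\<^sup>2 \<partial>lborel) * (\<integral>\<^sup>+y. (ennreal (sqrt (k (x - y)) * g y))\<^sup>2 \<partial>lborel)"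
      by (rule Cauchy_Schwarz_nn_integral) measurable
    also have "\<dots> = (\<integral>\<^sup>+y. ennreal (k (x - y)) \<partial>lborel) * (\<integral>\<^sup>+y. ennreal (k (x - y)) * ennreal ((g y)\<^sup>2) \<partial>lborel)"
      using k g by (intro arg_cong2[where f="(*)"] nn_integral_cong) (simp_all add: power_mult_distrib ennreal_power flip: ennreal_mult)
    also have "(\<integral>\<^sup>+y. ennreal (k (x - y)) \<partial>lborel) = ?I"
      by (rule nn_integral_lborel_reflect[of "\<lambda>u. ennreal (k u)"]) measurable
    finally show ?thesis .
  qed
  then have "(\<integral>\<^sup>+x. (\<integral>\<^sup>+y. ennreal (k (x - y) * g y) \<partial>lborel)\<^sup>2 \<partial>lborel)
      \<le> (\<integral>\<^sup>+x. ?I * (\<integral>\<^sup>+y. ennreal (k (x - y)) * ennreal ((g y)\<^sup>2) \<partial>lborel) \<partial>lborel)"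
    by (intro nn_integral_mono)
  also have "\<dots> = ?I * (\<integral>\<^sup>+x. (\<integral>\<^sup>+y. ennreal (k (x - y)) * ennreal ((g y)\<^sup>2) \<partial>lborel) \<partial>lborel)"
    by (rule nn_integral_cmult) measurable
  also have "\<dots> = ?I * (?I * (\<integral>\<^sup>+y. ennreal ((g y)\<^sup>2) \<partial>lborel))"
    by (subst nn_integral_convolution_eq[of "\<lambda>u. ennreal (k u)" "\<lambda>u. ennreal ((g u)\<^sup>2)"]) auto
  finally show ?thesis by (simp add: power2_eq_square mult.assoc)
qed

section \<open>Multi-indices and Taylor polynomials\<close>

lemma mi_order_axis: "mi_order (\<gamma> + axis i 1) = Suc (mi_order \<gamma>)"
  by (simp add: mi_order_def sum.distrib axis_def)

lemma mi_order_eq_0_iff: "mi_order \<gamma> = 0 \<longleftrightarrow> \<gamma> = 0"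
  by (auto simp: mi_order_def vec_eq_iff)

lemma mi_order_SucE:
  assumes "mi_order (\<gamma> :: nat ^ 'n) = Suc m"
  obtains \<beta> i where "\<gamma> = \<beta> + axis i 1" "mi_order \<beta> = m"
proof -
  have "\<exists>i. \<gamma> $ i \<noteq> 0"
    using assms mi_order_eq_0_iff[of \<gamma>] by (auto simp: vec_eq_iff)
  then obtain i where i: "\<gamma> $ i \<noteq> 0" by blast
  define \<beta> where "\<beta> = (\<chi> j. if j = i then \<gamma> $ j - 1 else \<gamma> $ j)"
  have "\<gamma> = \<beta> + axis i 1"
    using i by (auto simp: vec_eq_iff \<beta>_def axis_def)
  then show thesis
    using that[of \<beta> i] assms mi_order_axis[of \<beta> i] by simp
qed

lemma mi_power_axis: "mi_power x (\<gamma> + axis i 1) = x $ i * mi_power x \<gamma>"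
proof -
  have "mi_power x (\<gamma> + axis i 1) = (\<Prod>j\<in>UNIV. (x $ j) ^ (\<gamma> $ j) * (if j = i then x $ i else 1))"
    unfolding mi_power_def by (intro prod.cong) (auto simp: axis_def)
  also have "\<dots> = mi_power x \<gamma> * (\<Prod>j\<in>UNIV. if j = i then x $ i else 1)"
    by (simp add: prod.distrib mi_power_def)
  finally show ?thesis by simp
qed

lemma mi_fact_axis: "mi_fact (\<gamma> + axis i 1) = Suc (\<gamma> $ i) * mi_fact \<gamma>"
proof -
  have "mi_fact (\<gamma> + axis i 1) = (\<Prod>j\<in>UNIV. fact (\<gamma> $ j) * (if j = i then Suc (\<gamma> $ i) else 1))"
    unfolding mi_fact_def by (intro prod.cong) (auto simp: axis_def)
  also have "\<dots> = mi_fact \<gamma> * (\<Prod>j\<in>UNIV. if j = i then Suc (\<gamma> $ i) else 1)"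
    by (simp add: prod.distrib mi_fact_def)
  finally show ?thesis by simp
qed

lemma mi_power_0 [simp]: "mi_power x 0 = 1"
  by (simp add: mi_power_def)

lemma mi_fact_0 [simp]: "mi_fact 0 = 1"
  by (simp add: mi_fact_def)

lemma mi_order_0 [simp]: "mi_order 0 = 0"
  by (simp add: mi_order_def)

lemma mi_fact_nonzero [simp]: "mi_fact \<gamma> \<noteq> 0"
  by (simp add: mi_fact_def)

lemma abs_mi_power_le: "\<bar>mi_power x \<gamma>\<bar> \<le> norm x ^ mi_order \<gamma>"
proof -
  have "\<bar>mi_power x \<gamma>\<bar> = (\<Prod>i\<in>UNIV. \<bar>x $ i\<bar> ^ (\<gamma> $ i))"
    by (simp add: mi_power_def abs_prod power_abs)
  also have "\<dots> \<le> (\<Prod>i\<in>UNIV. norm x ^ (\<gamma> $ i))"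
    by (intro prod_mono conjI power_mono) (auto simp: component_le_norm_cart)
  finally show ?thesis by (simp add: power_sum mi_order_def)
qed

lemma mi_power_measurable [measurable]: "(\<lambda>x. mi_power x \<gamma>) \<in> borel_measurable borel"
  unfolding mi_power_def
  by (intro borel_measurable_continuous_onI continuous_intros)

definition mi_taylor :: "nat \<Rightarrow> (nat ^ 'n \<Rightarrow> 'a :: real_normed_field) \<Rightarrow> real ^ 'n \<Rightarrow> 'a" where
  "mi_taylor s d h = (\<Sum>\<gamma> | mi_order \<gamma> \<le> s. d \<gamma> / of_nat (mi_fact \<gamma>) * of_real (mi_power h \<gamma>))"

lemma mi_power_has_derivative_axis:
  "((\<lambda>t. mi_power (h + t *\<^sub>R axis i 1) \<gamma>) has_real_derivative
     (if \<gamma> $ i = 0 then 0 else real (\<gamma> $ i) * mi_power h (\<gamma> - axis i 1))) (at 0)"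
proof -
  let ?r = "\<Prod>j\<in>UNIV - {i}. (h $ j) ^ (\<gamma> $ j)"
  have eq: "mi_power (h + t *\<^sub>R axis i 1) \<gamma> = (h $ i + t) ^ (\<gamma> $ i) * ?r" for t
    unfolding mi_power_def
    by (subst prod.remove[of UNIV i]) (auto simp: axis_def intro!: arg_cong2[where f="(*)"] prod.cong)
  have eq': "mi_power h (\<gamma> - axis i 1) = (h $ i) ^ (\<gamma> $ i - 1) * ?r"
    unfolding mi_power_def
    by (subst prod.remove[of UNIV i]) (auto simp: axis_def intro!: arg_cong2[where f="(*)"] prod.cong)
  show ?thesis
    unfolding eq eq' by (auto intro!: derivative_eq_intros)
qed

text \<open>
  Differentiating a Taylor polynomial along an axis yields the Taylor polynomial, of one order less, of
  the shifted coefficients; this is what carries the induction for the remainder.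
\<close>

lemma mi_taylor_has_derivative_axis:
  fixes d :: "nat ^ 'n \<Rightarrow> 'a :: real_normed_field"
  shows "((\<lambda>t. mi_taylor (Suc s) d (h + t *\<^sub>R axis i 1)) has_vector_derivative
     mi_taylor s (\<lambda>\<beta>. d (\<beta> + axis i 1)) h) (at 0)"
proof -
  let ?c = "\<lambda>\<gamma>. d \<gamma> / of_nat (mi_fact \<gamma>)"
  let ?D = "\<lambda>\<gamma>::nat^'n. if \<gamma> $ i = 0 then 0 else real (\<gamma> $ i) * mi_power h (\<gamma> - axis i 1)"
  have "((\<lambda>t. mi_taylor (Suc s) d (h + t *\<^sub>R axis i 1)) has_vector_derivative
     (\<Sum>\<gamma> | mi_order \<gamma> \<le> Suc s. ?c \<gamma> * of_real (?D \<gamma>))) (at 0)"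
    unfolding mi_taylor_def
  proof (intro has_vector_derivative_sum has_vector_derivative_mult_right)
    fix \<gamma>
    show "((\<lambda>t. of_real (mi_power (h + t *\<^sub>R axis i 1) \<gamma>) :: 'a) has_vector_derivative of_real (?D \<gamma>)) (at 0)"
      using mi_power_has_derivative_axis[of h i \<gamma>]
      by (intro has_vector_derivative_of_real) (simp add: has_real_derivative_iff_has_vector_derivative)
  qed
  also have "(\<Sum>\<gamma> | mi_order \<gamma> \<le> Suc s. ?c \<gamma> * of_real (?D \<gamma>))
      = (\<Sum>\<gamma>\<in>(\<lambda>\<beta>. \<beta> + axis i 1) ` {\<beta>. mi_order \<beta> \<le> s}. ?c \<gamma> * of_real (?D \<gamma>))"
  proof (rule sum.mono_neutral_right[OF finite_mi_order_le])
    show "(\<lambda>\<beta>. \<beta> + axis i 1) ` {\<beta>. mi_order \<beta> \<le> s} \<subseteq> {\<gamma>. mi_order \<gamma> \<le> Suc s}"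
      by (auto simp: mi_order_axis[unfolded One_nat_def])
    show "\<forall>\<gamma>\<in>{\<gamma>. mi_order \<gamma> \<le> Suc s} - (\<lambda>\<beta>. \<beta> + axis i 1) ` {\<beta>. mi_order \<beta> \<le> s}. ?c \<gamma> * of_real (?D \<gamma>) = 0"
    proof
      fix \<gamma> :: "nat ^ 'n"
      assume \<gamma>: "\<gamma> \<in> {\<gamma>. mi_order \<gamma> \<le> Suc s} - (\<lambda>\<beta>. \<beta> + axis i 1) ` {\<beta>. mi_order \<beta> \<le> s}"
      have "\<gamma> $ i = 0"
      proof (rule ccontr)
        assume "\<gamma> $ i \<noteq> 0"
        then have "\<gamma> = (\<gamma> - axis i 1) + axis i 1"
          by (auto simp: vec_eq_iff axis_def)
        moreover from this have "mi_order (\<gamma> - axis i 1) \<le> s"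
          using \<gamma> mi_order_axis[of "\<gamma> - axis i 1" i] by simp
        ultimately show False using \<gamma> by blast
      qed
      then show "?c \<gamma> * of_real (?D \<gamma>) = 0" by simp
    qed
  qed
  also have "\<dots> = mi_taylor s (\<lambda>\<beta>. d (\<beta> + axis i 1)) h"
    unfolding mi_taylor_def
    proof (subst sum.reindex)
      show "inj_on (\<lambda>\<beta>. \<beta> + axis i 1) {\<beta>::nat^'n. mi_order \<beta> \<le> s}"
        by (auto simp: inj_on_def)
      show "sum ((\<lambda>\<gamma>. ?c \<gamma> * of_real (?D \<gamma>)) \<circ> (\<lambda>\<beta>. \<beta> + axis i 1)) {\<beta>. mi_order \<beta> \<le> s}
        = (\<Sum>\<beta> | mi_order \<beta> \<le> s. d (\<beta> + axis i 1) / of_nat (mi_fact \<beta>) * of_real (mi_power h \<beta>))"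
      proof (intro sum.cong refl)
        fix \<beta> :: "nat ^ 'n"
        have "\<beta> + axis i 1 - axis i 1 = \<beta>" by simp
        moreover have "(of_nat (Suc (\<beta> $ i)) :: 'a) \<noteq> 0" by (rule of_nat_neq_0)
        ultimately show "((\<lambda>\<gamma>. ?c \<gamma> * of_real (?D \<gamma>)) \<circ> (\<lambda>\<beta>. \<beta> + axis i 1)) \<beta>
          = d (\<beta> + axis i 1) / of_nat (mi_fact \<beta>) * of_real (mi_power h \<beta>)"
          by (simp add: mi_fact_axis[unfolded One_nat_def] del: of_nat_Suc mult_Suc)
      qed
    qed
  finally show ?thesis .
qed

text \<open>
  Partial derivatives give no total derivative here, so the increment is taken one coordinate at a
  time. The intermediate points stay in the ball because replacing coordinates of \<open>y\<close> by those of the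
  centre brings the point closer to the centre.
\<close>

lemma norm_increment_le_along_axes:
  fixes f :: "real ^ 'n \<Rightarrow> 'a :: real_normed_vector"
  assumes der: "\<And>z i. norm (z - x) < r \<Longrightarrow>
      ((\<lambda>t. f (z + t *\<^sub>R axis i 1)) has_vector_derivative f' i z) (at 0)"
    and bd: "\<And>z i. norm (z - x) < r \<Longrightarrow> norm (f' i z) \<le> B"
    and y: "norm (y - x) < r"
  shows "norm (f y - f x) \<le> real CARD('n) * (B * r)"
proof -
  have r: "r > 0" using y norm_ge_zero[of "y - x"] by linarith
  have B: "B \<ge> 0" using bd[of x undefined] r order_trans[OF norm_ge_zero] by auto
  \<comment> \<open>The corners of a path from \<open>x\<close> to \<open>y\<close> along the axes, indexed by the coordinates already moved.\<close>
  define p where "p J = (\<chi> i. if i \<in> J then y $ i else x $ i)" for J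
  have step: "norm (f (p (insert j J)) - f (p J)) \<le> B * r" if "j \<notin> J" for j J
  proof -
    define g where "g t = f (p J + t *\<^sub>R axis j 1)" for t
    define u where "u = y $ j - x $ j"
    have inside: "norm (p J + t *\<^sub>R axis j 1 - x) < r" if t: "t \<in> closed_segment 0 u" for t
    proof -
      have "\<bar>t\<bar> \<le> \<bar>u\<bar>" using t by (auto simp: closed_segment_eq_real_ivl split: if_splits)
      then have "norm (p J + t *\<^sub>R axis j 1 - x) \<le> norm (y - x)"
        using \<open>j \<notin> J\<close> by (intro norm_le_componentwise_cart) (auto simp: p_def axis_def u_def)
      with y show ?thesis by simp
    qed
    have "norm (g u - g 0) \<le> B * norm (u - 0)"
    proof (rule differentiable_bound[where f = g and f' = "\<lambda>t h. h *\<^sub>R f' j (p J + t *\<^sub>R axis j 1)" and S = "closed_segment 0 u"])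
      fix t assume t: "t \<in> closed_segment 0 u"
      have "((\<lambda>e. f (p J + t *\<^sub>R axis j 1 + e *\<^sub>R axis j 1)) has_vector_derivative f' j (p J + t *\<^sub>R axis j 1)) (at 0)"
        by (rule der[OF inside[OF t]])
      then have "((\<lambda>e. g (t + e)) has_vector_derivative f' j (p J + t *\<^sub>R axis j 1)) (at 0)"
        by (simp add: g_def scaleR_add_left add.assoc)
      then have "(g has_vector_derivative f' j (p J + t *\<^sub>R axis j 1)) (at t)"
        unfolding has_vector_derivative_def has_derivative_at by simp
      then show "(g has_derivative (\<lambda>h. h *\<^sub>R f' j (p J + t *\<^sub>R axis j 1))) (at t within closed_segment 0 u)"
        unfolding has_vector_derivative_def by (rule has_derivative_at_withinI)
      show "onorm (\<lambda>h. h *\<^sub>R f' j (p J + t *\<^sub>R axis j 1)) \<le> B"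
        by (rule onorm_le) (use bd[OF inside[OF t]] in \<open>auto simp: mult.commute[of B] intro!: mult_left_mono\<close>)
    qed auto
    moreover have "p J + u *\<^sub>R axis j 1 = p (insert j J)"
      using \<open>j \<notin> J\<close> by (auto simp: p_def u_def vec_eq_iff axis_def)
    moreover have "norm u \<le> r"
      using component_le_norm_cart[of "y - x" j] y by (simp add: u_def)
    then have "B * norm u \<le> B * r" using B by (intro mult_left_mono)
    ultimately show ?thesis by (simp add: g_def)
  qed
  have "norm (f (p J) - f x) \<le> real (card J) * (B * r)" if "finite J" for J
    using that
  proof (induction J rule: finite_induct)
    case empty
    then show ?case by (simp add: p_def)
  next
    case (insert j J)
    have "norm (f (p (insert j J)) - f x) \<le> norm (f (p (insert j J)) - f (p J)) + norm (f (p J) - f x)"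
      using norm_triangle_ineq[of "f (p (insert j J)) - f (p J)" "f (p J) - f x"] by simp
    also have "\<dots> \<le> B * r + real (card J) * (B * r)"
      by (intro add_mono step insert)
    finally show ?case using insert.hyps by (simp add: algebra_simps)
  qed
  from this[of UNIV] show ?thesis by (simp add: p_def)
qed

text \<open>
  The family \<open>D\<close> plays the role of the partial derivatives of \<open>D 0\<close>. Stating the estimate for a family
  rather than for iterated derivatives lets the induction on \<open>s\<close> pass to the families
  \<open>\<lambda>\<gamma>. D (\<gamma> + axis i 1)\<close>: the partial derivatives of the remainder are remainders of order \<open>s - 1\<close>.
\<close>

lemma mi_taylor_remainder:
  fixes D :: "nat ^ 'n \<Rightarrow> real ^ 'n \<Rightarrow> 'a :: real_normed_field"
  assumes "\<And>\<gamma> i z. mi_order \<gamma> < s \<Longrightarrow> norm (z - x) < r \<Longrightarrow>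
      ((\<lambda>t. D \<gamma> (z + t *\<^sub>R axis i 1)) has_vector_derivative D (\<gamma> + axis i 1) z) (at 0)"
    and "\<And>\<gamma> z. mi_order \<gamma> = s \<Longrightarrow> norm (z - x) < r \<Longrightarrow> norm (D \<gamma> z - D \<gamma> x) \<le> H"
    and "norm (y - x) < r"
  shows "norm (D 0 y - mi_taylor s (\<lambda>\<gamma>. D \<gamma> x) (y - x)) \<le> (real CARD('n) * r) ^ s * H"
  using assms
proof (induction s arbitrary: D y)
  case 0
  have "{\<gamma>::nat^'n. mi_order \<gamma> = 0} = {0}" by (auto simp: mi_order_eq_0_iff)
  then show ?case using "0.prems"(2)[of 0 y] "0.prems"(3) by (simp add: mi_taylor_def)
next
  case (Suc s)
  define R where "R z = D 0 z - mi_taylor (Suc s) (\<lambda>\<gamma>. D \<gamma> x) (z - x)" for z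
  define R' where "R' i z = D (0 + axis i 1) z - mi_taylor s (\<lambda>\<beta>. D (\<beta> + axis i 1) x) (z - x)" for i z
  have "norm (R y - R x) \<le> real CARD('n) * (((real CARD('n) * r) ^ s * H) * r)"
  proof (rule norm_increment_le_along_axes[where f' = R'])
    fix z and i :: 'n assume z: "norm (z - x) < r"
    have "((\<lambda>t. D 0 (z + t *\<^sub>R axis i 1) - mi_taylor (Suc s) (\<lambda>\<gamma>. D \<gamma> x) ((z - x) + t *\<^sub>R axis i 1))
        has_vector_derivative R' i z) (at 0)"
      unfolding R'_def
      by (intro has_vector_derivative_diff Suc.prems(1) mi_taylor_has_derivative_axis z) simp
    then show "((\<lambda>t. R (z + t *\<^sub>R axis i 1)) has_vector_derivative R' i z) (at 0)"
      by (simp add: R_def algebra_simps)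
    show "norm (R' i z) \<le> (real CARD('n) * r) ^ s * H"
      unfolding R'_def
    proof (rule Suc.IH[OF _ _ z])
      fix \<gamma> :: "nat ^ 'n" and j w assume "mi_order \<gamma> < s" "norm (w - x) < r"
      then show "((\<lambda>t. D (\<gamma> + axis i 1) (w + t *\<^sub>R axis j 1)) has_vector_derivative D ((\<gamma> + axis j 1) + axis i 1) w) (at 0)"
        using Suc.prems(1)[of "\<gamma> + axis i 1" w j] by (simp add: mi_order_axis[unfolded One_nat_def] ac_simps)
    next
      fix \<gamma> :: "nat ^ 'n" and w assume "mi_order \<gamma> = s" "norm (w - x) < r"
      then show "norm (D (\<gamma> + axis i 1) w - D (\<gamma> + axis i 1) x) \<le> H"
        by (intro Suc.prems(2)) (auto simp: mi_order_axis[unfolded One_nat_def])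
    qed
  qed (rule Suc.prems)
  moreover have "R x = 0"
  proof -
    have "mi_power 0 \<gamma> = (if \<gamma> = 0 then 1 else 0)" for \<gamma> :: "nat ^ 'n"
      by (auto simp: mi_power_def vec_eq_iff)
    then have "mi_taylor (Suc s) (\<lambda>\<gamma>. D \<gamma> x) (x - x) = D 0 x"
      unfolding mi_taylor_def
      by (subst sum.remove[OF finite_mi_order_le, of 0]) auto
    then show ?thesis by (simp add: R_def)
  qed
  ultimately show ?case by (simp add: R_def algebra_simps)
qed

section \<open>Square-integrable functions of bounded support\<close>

lemma integrable_dominated:
  fixes f :: "'b \<Rightarrow> 'c::{banach, second_countable_topology}" and g :: "'b \<Rightarrow> real"
  assumes "f \<in> borel_measurable M" "integrable M g" "\<And>x. norm (f x) \<le> g x"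
  shows "integrable M f"
  by (rule Bochner_Integration.integrable_bound[OF assms(2,1)])
    (auto simp: assms(3) intro!: AE_I2 order_trans[OF assms(3)])

lemma nn_integral_linear_combination3:
  assumes "f \<in> borel_measurable M" "g \<in> borel_measurable M" "h \<in> borel_measurable M"
  shows "(\<integral>\<^sup>+x. a * f x + b * g x + c * h x \<partial>M)
    = a * (\<integral>\<^sup>+x. f x \<partial>M) + b * (\<integral>\<^sup>+x. g x \<partial>M) + c * (\<integral>\<^sup>+x. h x \<partial>M)"
  using assms by (simp add: nn_integral_add nn_integral_cmult)

lemma inverse_Suc_at_right_0: "filterlim (\<lambda>k. inverse (real (Suc k))) (at_right 0) sequentially"
  unfolding filterlim_at by (auto intro: LIMSEQ_inverse_real_of_nat always_eventually simp del: of_nat_Suc)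

text \<open>
  Borel representatives are used throughout, so that product measurability and Fubini are available for
  \<open>lborel\<close>.
\<close>

definition bounded_L2 :: "(real ^ 'n \<Rightarrow> 'a :: {real_normed_field, euclidean_space}) set" where
  "bounded_L2 = {f \<in> borel_measurable borel. integrable lborel (\<lambda>x. (norm (f x))\<^sup>2) \<and>
     (\<exists>R. \<forall>x. R < norm x \<longrightarrow> f x = 0)}"

lemma bounded_L2_measurable: "f \<in> bounded_L2 \<Longrightarrow> f \<in> borel_measurable borel"
  by (simp add: bounded_L2_def)

lemma bounded_L2_square: "f \<in> bounded_L2 \<Longrightarrow> integrable lborel (\<lambda>x. (norm (f x))\<^sup>2)"
  by (simp add: bounded_L2_def)

lemma bounded_L2_in_L2: "f \<in> bounded_L2 \<Longrightarrow> f \<in> L2"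
  by (auto simp: bounded_L2_def L2_def integrable_completion measurable_completion)

lemma bounded_L2_combine:
  fixes u v :: "real ^ 'n \<Rightarrow> 'a :: {real_normed_field, euclidean_space}"
  assumes u: "u \<in> bounded_L2" and v: "v \<in> bounded_L2"
  shows "(\<lambda>x. u x + c * v x) \<in> bounded_L2"
proof -
  obtain R S where RS: "\<forall>x. R < norm x \<longrightarrow> u x = 0" "\<forall>x. S < norm x \<longrightarrow> v x = 0"
    using u v by (auto simp: bounded_L2_def)
  note [measurable] = bounded_L2_measurable[OF u] bounded_L2_measurable[OF v]
  have "integrable lborel (\<lambda>x. (norm (u x + c * v x))\<^sup>2)"
  proof (rule integrable_dominated)
    show "integrable lborel (\<lambda>x. 2 * (norm (u x))\<^sup>2 + 2 * ((norm c)\<^sup>2 * (norm (v x))\<^sup>2))"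
      using bounded_L2_square[OF u] bounded_L2_square[OF v] by auto
    fix x
    have "(norm (u x + c * v x))\<^sup>2 \<le> (norm (u x) + norm (c * v x))\<^sup>2"
      by (intro power_mono norm_triangle_ineq) auto
    also have "\<dots> \<le> 2 * (norm (u x))\<^sup>2 + 2 * (norm (c * v x))\<^sup>2"
      using sum_squares_bound[of "norm (u x)" "norm (c * v x)"] by (simp add: power2_sum)
    finally show "norm ((norm (u x + c * v x))\<^sup>2) \<le> 2 * (norm (u x))\<^sup>2 + 2 * ((norm c)\<^sup>2 * (norm (v x))\<^sup>2)"
      by (simp add: norm_mult power_mult_distrib)
  qed measurable
  moreover have "\<forall>x. max R S < norm x \<longrightarrow> u x + c * v x = 0"
    using RS by auto
  ultimately show ?thesis
    unfolding bounded_L2_def by (auto intro: exI[of _ "max R S"])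
qed

lemma bounded_L2_cut:
  assumes f: "f \<in> bounded_L2" and [measurable]: "S \<in> sets borel"
  shows "(\<lambda>x. if x \<in> S then f x else 0) \<in> bounded_L2"
proof -
  note [measurable] = bounded_L2_measurable[OF f]
  have "integrable lborel (\<lambda>x. (norm (if x \<in> S then f x else 0))\<^sup>2)"
    by (rule Bochner_Integration.integrable_bound[OF bounded_L2_square[OF f]]) auto
  then show ?thesis
    using f by (auto simp: bounded_L2_def)
qed

lemma bounded_L2_of_bounded:
  fixes f :: "real ^ 'n \<Rightarrow> 'a :: {real_normed_field, euclidean_space}"
  assumes [measurable]: "f \<in> borel_measurable borel"
    and "\<And>x. norm (f x) \<le> B" and "\<And>x. R < norm x \<Longrightarrow> f x = 0"
  shows "f \<in> bounded_L2"
proof -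
  have "integrable lborel (\<lambda>x. (norm (f x))\<^sup>2)"
  proof (rule integrable_dominated)
    have "emeasure lborel (cball (0::real^'n) R) < \<infinity>"
      using emeasure_lborel_cball_finite[of "0::real^'n" R] by simp
    then show "integrable lborel (\<lambda>x::real^'n. indicator (cball 0 R) x * B\<^sup>2)"
      by (intro integrable_mult_left integrable_real_indicator) auto
    fix x
    show "norm ((norm (f x))\<^sup>2) \<le> indicator (cball 0 R) x * B\<^sup>2"
      using assms(3)[of x] assms(2)[of x] by (cases "R < norm x") (auto simp: power_mono)
  qed measurable
  then show ?thesis
    using assms by (auto simp: bounded_L2_def)
qed

lemma bounded_L2_integrable_mult:
  fixes f g :: "real ^ 'n \<Rightarrow> 'a :: {real_normed_field, euclidean_space}"
  assumes f: "f \<in> bounded_L2" and [measurable]: "g \<in> borel_measurable borel"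
    and g: "\<And>x. f x \<noteq> 0 \<Longrightarrow> norm (g x) \<le> B"
  shows "integrable lborel (\<lambda>x. f x * g x)"
proof -
  note [measurable] = bounded_L2_measurable[OF f]
  obtain R where R: "\<And>x. R < norm x \<Longrightarrow> f x = 0"
    using f by (auto simp: bounded_L2_def)
  define g' where "g' x = (if norm x \<le> R \<and> norm (g x) \<le> B then g x else 0)" for x
  have "g' \<in> bounded_L2"
    unfolding g'_def by (rule bounded_L2_of_bounded[where B="max 0 B" and R=R]) auto
  then have "integrable lborel (\<lambda>x. f x * g' x)"
    by (intro integrable_mult_L2) (use f bounded_L2_square bounded_L2_measurable in auto)
  also have "(\<lambda>x. f x * g' x) = (\<lambda>x. f x * g x)"
  proof
    fix x
    show "f x * g' x = f x * g x"
      by (cases "f x = 0") (use R[of x] g[of x] in \<open>auto simp: g'_def\<close>)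
  qed
  finally show ?thesis .
qed

lemma bounded_L2_integrable:
  fixes f :: "real ^ 'n \<Rightarrow> 'a :: {real_normed_field, euclidean_space}"
  assumes "f \<in> bounded_L2" shows "integrable lborel f"
  using bounded_L2_integrable_mult[OF assms, of "\<lambda>x. 1" 1] by simp

section \<open>Standard kernels and their truncations\<close>

lemma mi_deriv_0 [simp]: "mi_deriv 0 F = F"
proof -
  have "foldr (\<lambda>i. partial_deriv i ^^ ((0 :: nat ^ 'n) $ i)) xs F = F" for xs and F :: "real ^ 'n \<Rightarrow> 'b :: real_normed_vector"
    by (induction xs) auto
  then show ?thesis by (simp add: mi_deriv_def)
qed

text \<open>
  The estimates of \<^const>\<open>standard_kernel\<close> on which the argument rests, with the constants fixed. Those on
  \<open>K\<close> itself control the truncated operators, those on the derivatives in the second variable the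
  Taylor remainder.
\<close>

locale kernel_bounds =
  fixes K :: "real ^ 'n \<Rightarrow> real ^ 'n \<Rightarrow> 'a :: {real_normed_field, euclidean_space}"
    and s :: nat and C \<delta> :: real
  assumes C: "C > 0" and delta: "0 < \<delta>"
    and partials: "\<And>x. has_partials_upto s (- {x}) (K x)"
    and size: "\<And>x y. x \<noteq> y \<Longrightarrow> norm (K x y) \<le> C / norm (x - y) ^ CARD('n)"
    and regular1: "\<And>x y z. x \<noteq> y \<Longrightarrow> norm (x - y) \<ge> 2 * norm (y - z) \<Longrightarrow>
       norm (K y x - K z x) \<le> C * (norm (y - z) powr \<delta> / norm (x - y) powr (real CARD('n) + \<delta>))"
    and regular2: "\<And>x y z. x \<noteq> y \<Longrightarrow> norm (x - y) \<ge> 2 * norm (y - z) \<Longrightarrow>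
       norm (K x y - K x z) \<le> C * (norm (y - z) powr \<delta> / norm (x - y) powr (real CARD('n) + \<delta>))"
    and deriv_size: "\<And>\<gamma> x y. mi_order \<gamma> \<le> s \<Longrightarrow> x \<noteq> y \<Longrightarrow>
       norm (mi_deriv \<gamma> (K x) y) \<le> C / norm (x - y) ^ (CARD('n) + mi_order \<gamma>)"
    and deriv_regular: "\<And>\<gamma> x y z. mi_order \<gamma> = s \<Longrightarrow> x \<noteq> y \<Longrightarrow> norm (x - y) \<ge> 2 * norm (y - z) \<Longrightarrow>
       norm (mi_deriv \<gamma> (K x) y - mi_deriv \<gamma> (K x) z)
         \<le> C * (norm (y - z) powr \<delta> / norm (x - y) powr (real CARD('n) + real s + \<delta>))"

lemma standard_kernel_bounds:
  fixes K :: "real ^ 'n \<Rightarrow> real ^ 'n \<Rightarrow> 'a :: {real_normed_field, euclidean_space}"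
  assumes "standard_kernel s K"
  obtains C \<delta> where "kernel_bounds K s C \<delta>"
proof -
  define Q where "Q C \<delta> \<gamma> \<longleftrightarrow>
        (\<forall>x y. x \<noteq> y \<longrightarrow>
           norm (mi_deriv2 \<gamma> K x y) \<le> C / norm (x - y) ^ (CARD('n) + mi_order \<gamma>)) \<and>
        (\<forall>x y. x \<noteq> y \<longrightarrow>
           norm (mi_deriv1 \<gamma> K x y) \<le> C / norm (x - y) ^ (CARD('n) + mi_order \<gamma>)) \<and>
        (\<forall>x y z. x \<noteq> y \<and> norm (x - y) \<ge> 2 * norm (y - z) \<longrightarrow>
           norm (mi_deriv2 \<gamma> K x y - mi_deriv2 \<gamma> K x z)
             \<le> C * (norm (y - z) powr \<delta>
                     / norm (x - y) powr (real CARD('n) + real (mi_order \<gamma>) + \<delta>))) \<and>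
        (\<forall>x y z. x \<noteq> y \<and> norm (x - y) \<ge> 2 * norm (y - z) \<longrightarrow>
           norm (mi_deriv1 \<gamma> K y x - mi_deriv1 \<gamma> K z x)
             \<le> C * (norm (y - z) powr \<delta>
                     / norm (x - y) powr (real CARD('n) + real (mi_order \<gamma>) + \<delta>)))" for C \<delta> \<gamma>
  note k = assms[unfolded standard_kernel_def, folded Q_def, THEN conjunct2]
  have p: "has_partials_upto s (- {x}) (K x)" for x
    using k[THEN conjunct1] by (rule spec)
  obtain C \<delta> where C: "C > 0" "0 < \<delta>" and Q: "\<And>\<gamma>. mi_order \<gamma> \<le> s \<Longrightarrow> Q C \<delta> \<gamma>"
    using k[THEN conjunct2, THEN conjunct2] by blast
  note Q = Q[unfolded Q_def]
  have "kernel_bounds K s C \<delta>"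
  proof
    fix x y z :: "real ^ 'n" assume xy: "x \<noteq> y"
    show "norm (K x y) \<le> C / norm (x - y) ^ CARD('n)"
      using Q[of 0] xy by (simp add: mi_deriv2_def)
    assume z: "norm (x - y) \<ge> 2 * norm (y - z)"
    show "norm (K y x - K z x) \<le> C * (norm (y - z) powr \<delta> / norm (x - y) powr (real CARD('n) + \<delta>))"
      using Q[of 0, THEN conjunct2, THEN conjunct2, THEN conjunct2, rule_format, of x y z] xy z by (simp add: mi_deriv1_def)
    show "norm (K x y - K x z) \<le> C * (norm (y - z) powr \<delta> / norm (x - y) powr (real CARD('n) + \<delta>))"
      using Q[of 0, THEN conjunct2, THEN conjunct2, THEN conjunct1, rule_format, of x y z] xy z by (simp add: mi_deriv2_def)
  next
    fix \<gamma> :: "nat ^ 'n" and x y :: "real ^ 'n" assume "mi_order \<gamma> \<le> s" "x \<noteq> y"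
    then show "norm (mi_deriv \<gamma> (K x) y) \<le> C / norm (x - y) ^ (CARD('n) + mi_order \<gamma>)"
      using Q[of \<gamma>, THEN conjunct1] by (simp add: mi_deriv2_def)
  next
    fix \<gamma> :: "nat ^ 'n" and x y z :: "real ^ 'n"
    assume "mi_order \<gamma> = s" "x \<noteq> y" "norm (x - y) \<ge> 2 * norm (y - z)"
    then show "norm (mi_deriv \<gamma> (K x) y - mi_deriv \<gamma> (K x) z)
         \<le> C * (norm (y - z) powr \<delta> / norm (x - y) powr (real CARD('n) + real s + \<delta>))"
      using Q[of \<gamma>, THEN conjunct2, THEN conjunct2, THEN conjunct1, rule_format, of x y z] by (simp add: mi_deriv2_def)
  qed (use C p in auto)
  then show thesis using that by blast
qed

context kernel_bounds begin

text \<open>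
  The Hoelder estimates in each variable are locally uniform in the other one, so they add up to joint
  continuity, and the kernel is Borel measurable in both variables together.
\<close>

lemma continuous_on_off_diagonal: "continuous_on {p. fst p \<noteq> snd p} (\<lambda>p. K (fst p) (snd p))"
proof (clarsimp simp: continuous_on_def)
  fix x y :: "real ^ 'n" assume "x \<noteq> y"
  then have xy: "norm (x - y) > 0" "norm (y - x) > 0" by auto
  let ?F = "at (x, y) within {p. fst p \<noteq> snd p}"
  let ?e = "real CARD('n) + \<delta>"
  have f: "(fst \<longlongrightarrow> x) ?F" and s: "(snd \<longlongrightarrow> y) ?F"
    by (auto intro!: tendsto_eq_intros)
  have "((\<lambda>p. norm (snd p - x) - 2 * norm (x - fst p)) \<longlongrightarrow> norm (y - x) - 2 * norm (x - x)) ?F"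
    by (intro tendsto_intros f s)
  then have "\<forall>\<^sub>F p in ?F. norm (snd p - x) - 2 * norm (x - fst p) > 0"
    using xy by (intro order_tendstoD) auto
  moreover have "((\<lambda>p. norm (x - y) - 2 * norm (y - snd p)) \<longlongrightarrow> norm (x - y) - 2 * norm (y - y)) ?F"
    by (intro tendsto_intros f s)
  then have "\<forall>\<^sub>F p in ?F. norm (x - y) - 2 * norm (y - snd p) > 0"
    using xy by (intro order_tendstoD) auto
  ultimately have "\<forall>\<^sub>F p in ?F. norm (K (fst p) (snd p) - K x y)
      \<le> C * (norm (x - fst p) powr \<delta> / norm (snd p - x) powr ?e) + C * (norm (y - snd p) powr \<delta> / norm (x - y) powr ?e)"
  proof eventually_elim
    case (elim p)
    have "norm (snd p - x) > 0" using elim(1) by (smt (verit) norm_ge_zero)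
    then have "snd p \<noteq> x" by auto
    have "norm (K (fst p) (snd p) - K x y) \<le> norm (K x (snd p) - K (fst p) (snd p)) + norm (K x y - K x (snd p))"
      by norm
    also have "\<dots> \<le> C * (norm (x - fst p) powr \<delta> / norm (snd p - x) powr ?e) + C * (norm (y - snd p) powr \<delta> / norm (x - y) powr ?e)"
      using elim \<open>snd p \<noteq> x\<close> \<open>x \<noteq> y\<close> by (intro add_mono regular1 regular2) auto
    finally show ?case .
  qed
  moreover have "((\<lambda>p. C * (norm (x - fst p) powr \<delta> / norm (snd p - x) powr ?e) + C * (norm (y - snd p) powr \<delta> / norm (x - y) powr ?e))
      \<longlongrightarrow> C * (norm (x - x) powr \<delta> / norm (y - x) powr ?e) + C * (norm (y - y) powr \<delta> / norm (x - y) powr ?e)) ?F"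
    using xy delta by (intro tendsto_intros f s tendsto_powr') (auto intro: always_eventually)
  ultimately have "((\<lambda>p. K (fst p) (snd p) - K x y) \<longlongrightarrow> 0) ?F"
    using delta by (elim Lim_null_comparison) simp
  then show "((\<lambda>p. K (fst p) (snd p)) \<longlongrightarrow> K x y) ?F"
    by (simp add: LIM_zero_iff)
qed

text \<open>At a nonpositive level the truncation removes the diagonal only, where \<open>K\<close> carries no information.\<close>

definition trunc :: "real \<Rightarrow> real ^ 'n \<Rightarrow> real ^ 'n \<Rightarrow> 'a" where
  "trunc \<eta> x y = (if x = y \<or> norm (x - y) < \<eta> then 0 else K x y)"

lemma trunc_measurable [measurable (raw)]:
  assumes [measurable]: "f \<in> borel_measurable M" "g \<in> borel_measurable M"
  shows "(\<lambda>w. trunc \<eta> (f w) (g w)) \<in> borel_measurable M"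
proof -
  let ?S = "{p. fst p \<noteq> snd p} :: ((real^'n) \<times> (real^'n)) set"
  have op: "open ?S" by (intro open_Collect_neq continuous_intros)
  have k: "(\<lambda>p. if p \<in> ?S then K (fst p) (snd p) else 0) \<in> borel_measurable borel"
    using op by (intro borel_measurable_continuous_on_if continuous_on_off_diagonal) auto
  have "(\<lambda>w. (f w, g w)) \<in> measurable M borel"
    by (simp add: borel_prod[symmetric])
  from measurable_compose[OF this k]
  have [measurable]: "(\<lambda>w. if f w \<noteq> g w then K (f w) (g w) else 0) \<in> borel_measurable M"
    by (simp only: mem_Collect_eq fst_conv snd_conv)
  have "(\<lambda>w. trunc \<eta> (f w) (g w)) = (\<lambda>w. if norm (f w - g w) < \<eta> then (0::'a) else (if f w \<noteq> g w then K (f w) (g w) else 0))"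
    by (auto simp: trunc_def)
  then show ?thesis by simp
qed

lemma trunc_bound:
  assumes "\<eta> > 0" shows "norm (trunc \<eta> x y) \<le> C / \<eta> ^ CARD('n)"
proof (cases "x = y \<or> norm (x - y) < \<eta>")
  case False
  then have "C / norm (x - y) ^ CARD('n) \<le> C / \<eta> ^ CARD('n)"
    using C assms by (intro divide_left_mono power_mono mult_pos_pos) auto
  then show ?thesis using False size[of x y] by (auto simp: trunc_def)
qed (use C assms in \<open>auto simp: trunc_def\<close>)

definition op_trunc :: "real \<Rightarrow> (real ^ 'n \<Rightarrow> 'a) \<Rightarrow> real ^ 'n \<Rightarrow> 'a" where
  "op_trunc \<eta> f x = (LINT y|lborel. trunc \<eta> x y * f y)"

definition op_trunc_transpose :: "real \<Rightarrow> (real ^ 'n \<Rightarrow> 'a) \<Rightarrow> real ^ 'n \<Rightarrow> 'a" where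
  "op_trunc_transpose \<eta> f y = (LINT x|lborel. trunc \<eta> x y * f x)"

lemma trunc_integrable:
  assumes f: "f \<in> bounded_L2" and "\<eta> > 0"
  shows "integrable lborel (\<lambda>y. trunc \<eta> x y * f y)" "integrable lborel (\<lambda>x. trunc \<eta> x y * f x)"
  using bounded_L2_integrable_mult[OF f, of "\<lambda>y. trunc \<eta> x y" "C / \<eta> ^ CARD('n)"]
    bounded_L2_integrable_mult[OF f, of "\<lambda>x. trunc \<eta> x y" "C / \<eta> ^ CARD('n)"]
    trunc_bound[OF assms(2)]
  by (simp_all add: mult.commute[of "trunc _ _ _"])

lemma op_trunc_measurable:
  assumes f: "f \<in> bounded_L2"
  shows "op_trunc \<eta> f \<in> borel_measurable borel" "op_trunc_transpose \<eta> f \<in> borel_measurable borel"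
  using bounded_L2_measurable[OF f] unfolding op_trunc_def[abs_def] op_trunc_transpose_def[abs_def]
  by measurable

lemma op_trunc_duality:
  assumes f: "f \<in> bounded_L2" and g: "g \<in> bounded_L2" and "\<eta> > 0"
  shows "(LINT x|lborel. op_trunc \<eta> f x * g x) = (LINT y|lborel. op_trunc_transpose \<eta> g y * f y)"
proof -
  note [measurable] = bounded_L2_measurable[OF f] bounded_L2_measurable[OF g]
  have fi: "integrable lborel (\<lambda>x. norm (f x))" and gi: "integrable lborel (\<lambda>x. norm (g x))"
    using bounded_L2_integrable f g by auto
  have "integrable (lborel \<Otimes>\<^sub>M lborel) (\<lambda>(x, y). trunc \<eta> x y * f y * g x)"
  proof (rule integrable_dominated)
    show "integrable (lborel \<Otimes>\<^sub>M lborel) (\<lambda>(x, y). norm (g x) * (C / \<eta> ^ CARD('n) * norm (f y)))"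
    proof (rule lborel_pair.Fubini_integrable)
      have "(\<lambda>x. LINT y|lborel. norm (norm (g x) * (C / \<eta> ^ CARD('n) * norm (f y))))
          = (\<lambda>x. norm (g x) * (LINT y|lborel. \<bar>C / \<eta> ^ CARD('n)\<bar> * norm (f y)))"
        by (simp add: abs_mult)
      then show "integrable lborel (\<lambda>x. LINT y|lborel. norm (case (x, y) of (x, y) \<Rightarrow> norm (g x) * (C / \<eta> ^ CARD('n) * norm (f y))))"
        using gi by simp
    qed (use fi in simp_all)
    fix p :: "(real ^ 'n) \<times> (real ^ 'n)"
    show "norm (case p of (x, y) \<Rightarrow> trunc \<eta> x y * f y * g x)
        \<le> (case p of (x, y) \<Rightarrow> norm (g x) * (C / \<eta> ^ CARD('n) * norm (f y)))"
      using mult_right_mono[OF trunc_bound[OF \<open>\<eta> > 0\<close>, of "fst p" "snd p"], of "norm (f (snd p)) * norm (g (fst p))"]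
      by (simp add: norm_mult mult_ac split_beta)
  qed measurable
  from lborel_pair.Fubini_integral[OF this]
  have "(LINT y|lborel. LINT x|lborel. trunc \<eta> x y * f y * g x) = (LINT x|lborel. LINT y|lborel. trunc \<eta> x y * f y * g x)"
    by simp
  moreover have "(LINT y|lborel. trunc \<eta> x y * f y * g x) = op_trunc \<eta> f x * g x" for x
    unfolding op_trunc_def using trunc_integrable[OF f \<open>\<eta> > 0\<close>] by simp
  moreover have "(LINT x|lborel. trunc \<eta> x y * f y * g x) = op_trunc_transpose \<eta> g y * f y" for y
  proof -
    have "(LINT x|lborel. trunc \<eta> x y * f y * g x) = (LINT x|lborel. trunc \<eta> x y * g x * f y)"
      by (simp add: mult_ac)
    then show ?thesis
      unfolding op_trunc_transpose_def using trunc_integrable[OF g \<open>\<eta> > 0\<close>] by simp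
  qed
  ultimately show ?thesis by (simp only:)
qed

end

section \<open>Uniform boundedness of the truncated operators\<close>

text \<open>
  \<open>T\<close> is normalised to return Borel functions, so that its images can be integrated against functions of
  two variables; \<open>borel_cz_operator_borel_version\<close> passes to this form.
\<close>

locale borel_cz_operator = kernel_bounds K s C \<delta>
  for K :: "real ^ 'n \<Rightarrow> real ^ 'n \<Rightarrow> 'a :: {real_normed_field, euclidean_space}"
    and s :: nat and C \<delta> :: real +
  fixes T :: "(real ^ 'n \<Rightarrow> 'a) \<Rightarrow> real ^ 'n \<Rightarrow> 'a" and M :: real
  assumes T_measurable: "\<And>f. f \<in> bounded_L2 \<Longrightarrow> T f \<in> borel_measurable borel"
    and T_add: "\<And>f g. f \<in> bounded_L2 \<Longrightarrow> g \<in> bounded_L2 \<Longrightarrow>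
      AE x in lborel. T (\<lambda>x. f x + g x) x = T f x + T g x"
    and M: "M \<ge> 0"
    and T_bound: "\<And>f. f \<in> bounded_L2 \<Longrightarrow>
      (\<integral>\<^sup>+x. ennreal ((norm (T f x))\<^sup>2) \<partial>lborel) \<le> ennreal M * (\<integral>\<^sup>+x. ennreal ((norm (f x))\<^sup>2) \<partial>lborel)"
    and T_lim: "\<And>f. f \<in> bounded_L2 \<Longrightarrow>
      AE x in lborel. ((\<lambda>\<eta>. op_trunc \<eta> f x) \<longlongrightarrow> T f x) (at_right 0)"
begin

text \<open>
  Below the distance to the support the truncations do not depend on the level, so their limit is
  attained.
\<close>

lemma T_off_support:
  assumes f: "f \<in> bounded_L2"
  shows "AE x in lborel. \<forall>\<epsilon>>0. (\<forall>y. norm (x - y) < \<epsilon> \<longrightarrow> f y = 0) \<longrightarrow> T f x = op_trunc \<epsilon> f x"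
  using T_lim[OF f]
proof eventually_elim
  case (elim x)
  show ?case
  proof (intro allI impI)
    fix \<epsilon> :: real assume \<epsilon>: "\<epsilon> > 0" "\<forall>y. norm (x - y) < \<epsilon> \<longrightarrow> f y = 0"
    have "op_trunc \<eta> f x = op_trunc \<epsilon> f x" if "\<eta> < \<epsilon>" for \<eta>
      unfolding op_trunc_def using \<epsilon> that by (intro Bochner_Integration.integral_cong) (auto simp: trunc_def)
    then have "\<forall>\<^sub>F \<eta> in at_right 0. op_trunc \<eta> f x = op_trunc \<epsilon> f x"
      using \<epsilon> by (auto simp: eventually_at_right intro!: exI[of _ \<epsilon>])
    then have "((\<lambda>\<eta>. op_trunc \<eta> f x) \<longlongrightarrow> op_trunc \<epsilon> f x) (at_right 0)"
      by (rule tendsto_eventually)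
    with elim show "T f x = op_trunc \<epsilon> f x"
      by (intro tendsto_unique[OF trivial_limit_at_right_real])
  qed
qed

text \<open>
  Write \<open>f = f1 + f2\<close> with \<open>f1\<close> the restriction to the ball of radius \<open>\<eta>\<close> about \<open>x\<close>. For \<open>z\<close> within
  \<open>\<eta> / 2\<close> of \<open>x\<close>, both the truncated integral at \<open>x\<close> and \<open>T f2 z = T f z - T f1 z\<close> integrate the kernel
  against \<open>f2\<close>, so by regularity in the first variable they differ by a convolution with the tail \<open>k\<close>.
\<close>

lemma op_trunc_pointwise_bound:
  fixes x :: "real ^ 'n"
  assumes f: "f \<in> bounded_L2" and \<eta>: "\<eta> > 0"
  defines "k \<equiv> \<lambda>u::real ^ 'n. if norm u \<ge> \<eta> then C * (\<eta> / 2) powr \<delta> / norm u powr (real CARD('n) + \<delta>) else 0"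
    and "f1 \<equiv> \<lambda>y. if y \<in> ball x \<eta> then f y else 0"
  shows "AE z in lborel. z \<in> ball x (\<eta> / 2) \<longrightarrow>
    ennreal ((norm (op_trunc \<eta> f x))\<^sup>2) \<le> 3 * (\<integral>\<^sup>+y. ennreal (k (x - y) * norm (f y)) \<partial>lborel)\<^sup>2
      + 3 * ennreal ((norm (T f z))\<^sup>2) + 3 * ennreal ((norm (T f1 z))\<^sup>2)"
proof -
  note [measurable] = bounded_L2_measurable[OF f]
  have k0: "k u \<ge> 0" for u unfolding k_def using C by auto
  have km[measurable]: "k \<in> borel_measurable borel" unfolding k_def by measurable
  have kb: "k u \<le> C * (\<eta> / 2) powr \<delta> / \<eta> powr (real CARD('n) + \<delta>)" for u
    unfolding k_def using C \<eta> delta by (auto intro!: divide_left_mono powr_mono2 mult_pos_pos)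
  define f2 where "f2 y = (if y \<in> - ball x \<eta> then f y else 0)" for y
  have f1: "f1 \<in> bounded_L2" unfolding f1_def by (intro bounded_L2_cut f) auto
  have f2: "f2 \<in> bounded_L2" unfolding f2_def[abs_def] by (intro bounded_L2_cut f) auto
  have sum: "(\<lambda>y. f1 y + f2 y) = f" by (auto simp: f1_def f2_def)
  have ki: "integrable lborel (\<lambda>y. k (x - y) * norm (f y))"
  proof (rule integrable_dominated)
    show "integrable lborel (\<lambda>y. C * (\<eta> / 2) powr \<delta> / \<eta> powr (real CARD('n) + \<delta>) * norm (f y))"
      using bounded_L2_integrable[OF f] by auto
    show "norm (k (x - y) * norm (f y)) \<le> C * (\<eta> / 2) powr \<delta> / \<eta> powr (real CARD('n) + \<delta>) * norm (f y)" for y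
      using mult_right_mono[OF kb[of "x - y"] norm_ge_zero[of "f y"]] k0[of "x - y"] by (simp add: abs_mult)
  qed measurable
  define e where "e = (LINT y|lborel. k (x - y) * norm (f y))"
  have e0: "e \<ge> 0" unfolding e_def using k0 by (intro integral_nonneg_AE) auto
  have E: "(\<integral>\<^sup>+y. ennreal (k (x - y) * norm (f y)) \<partial>lborel) = ennreal e"
    unfolding e_def using ki k0 by (intro nn_integral_eq_integral) auto
  show ?thesis
    using T_add[OF f1 f2] T_off_support[OF f2] unfolding sum
  proof eventually_elim
    case (elim z)
    show ?case
    proof
      assume "z \<in> ball x (\<eta> / 2)"
      then have z: "norm (x - z) < \<eta> / 2" by (simp add: dist_norm)
      have "f2 y = 0" if "norm (z - y) < \<eta> / 2" for y
        using norm_triangle_ineq[of "x - z" "z - y"] z that by (simp add: f2_def dist_norm)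
      then have Tf2: "T f2 z = op_trunc (\<eta> / 2) f2 z"
        using elim(2) \<eta> by auto
      have "norm (op_trunc \<eta> f x - op_trunc (\<eta> / 2) f2 z)
          = norm (LINT y|lborel. trunc \<eta> x y * f y - trunc (\<eta> / 2) z y * f2 y)"
        unfolding op_trunc_def using trunc_integrable f f2 \<eta> by simp
      also have "\<dots> \<le> (LINT y|lborel. norm (trunc \<eta> x y * f y - trunc (\<eta> / 2) z y * f2 y))"
        by (rule integral_norm_bound)
      also have "\<dots> \<le> e"
        unfolding e_def
      proof (rule integral_mono[OF _ ki])
        show "integrable lborel (\<lambda>y. norm (trunc \<eta> x y * f y - trunc (\<eta> / 2) z y * f2 y))"
          using trunc_integrable f f2 \<eta> by (intro integrable_norm Bochner_Integration.integrable_diff) auto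
        fix y
        show "norm (trunc \<eta> x y * f y - trunc (\<eta> / 2) z y * f2 y) \<le> k (x - y) * norm (f y)"
        proof (cases "norm (x - y) < \<eta>")
          case True
          then show ?thesis using k0[of "x - y"] by (simp add: trunc_def f2_def dist_norm)
        next
          case False
          have "\<eta> / 2 \<le> norm (z - y)"
            using norm_triangle_ineq[of "x - z" "z - y"] z False by simp
          moreover from this have "z \<noteq> y" "x \<noteq> y" using \<eta> False by auto
          ultimately have "trunc \<eta> x y * f y - trunc (\<eta> / 2) z y * f2 y = (K x y - K z y) * f y"
            using False by (simp add: trunc_def f2_def dist_norm algebra_simps)
          moreover have "norm (K x y - K z y) \<le> k (x - y)"
          proof -
            have "norm (K x y - K z y) \<le> C * (norm (x - z) powr \<delta> / norm (y - x) powr (real CARD('n) + \<delta>))"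
              using \<open>x \<noteq> y\<close> z False by (intro regular1) (auto simp: norm_minus_commute)
            also have "\<dots> \<le> C * ((\<eta> / 2) powr \<delta> / norm (y - x) powr (real CARD('n) + \<delta>))"
              using C z delta by (intro mult_left_mono divide_right_mono powr_mono2) auto
            finally show ?thesis using False by (simp add: k_def norm_minus_commute)
          qed
          ultimately show ?thesis by (simp add: norm_mult mult_right_mono)
        qed
      qed
      finally have "norm (op_trunc \<eta> f x) \<le> e + norm (T f z) + norm (T f1 z)"
        using norm_triangle_ineq[of "op_trunc \<eta> f x - op_trunc (\<eta> / 2) f2 z" "T f2 z"]
          norm_triangle_ineq4[of "T f z" "T f1 z"] elim(1) Tf2 by simp
      then have "(norm (op_trunc \<eta> f x))\<^sup>2 \<le> (e + norm (T f z) + norm (T f1 z))\<^sup>2"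
        by (intro power_mono) auto
      also have "\<dots> \<le> 3 * e\<^sup>2 + 3 * (norm (T f z))\<^sup>2 + 3 * (norm (T f1 z))\<^sup>2"
        using sum_squares_bound[of e "norm (T f z)"] sum_squares_bound[of e "norm (T f1 z)"]
          sum_squares_bound[of "norm (T f z)" "norm (T f1 z)"]
        by (simp add: power2_eq_square algebra_simps)
      finally have "ennreal ((norm (op_trunc \<eta> f x))\<^sup>2) \<le> ennreal (3 * e\<^sup>2 + 3 * (norm (T f z))\<^sup>2 + 3 * (norm (T f1 z))\<^sup>2)"
        by (rule ennreal_leI)
      also have "\<dots> = 3 * (ennreal e)\<^sup>2 + 3 * ennreal ((norm (T f z))\<^sup>2) + 3 * ennreal ((norm (T f1 z))\<^sup>2)"
        using e0 by (simp add: ennreal_mult ennreal_power)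
      finally show "ennreal ((norm (op_trunc \<eta> f x))\<^sup>2) \<le> 3 * (\<integral>\<^sup>+y. ennreal (k (x - y) * norm (f y)) \<partial>lborel)\<^sup>2
      + 3 * ennreal ((norm (T f z))\<^sup>2) + 3 * ennreal ((norm (T f1 z))\<^sup>2)"
        unfolding E .
    qed
  qed
qed

text \<open>
  The pointwise bound is averaged over \<open>z\<close> in the half ball and integrated over \<open>x\<close>. Each term becomes a
  convolution: the tail has \<open>L\<^sup>1\<close> norm independent of \<open>\<eta>\<close>, the average of \<open>\<bar>T f\<bar>\<^sup>2\<close> integrates to that of
  \<open>T f\<close>, and the term with \<open>f1\<close> costs the ratio \<open>2\<^sup>n\<close> of the volumes of the two balls.
\<close>

lemma op_trunc_uniform_bound:
  obtains B where "B \<ge> 0" "\<And>\<eta> f. \<eta> > 0 \<Longrightarrow> f \<in> bounded_L2 \<Longrightarrow>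
    (\<integral>\<^sup>+x. ennreal ((norm (op_trunc \<eta> f x))\<^sup>2) \<partial>lborel) \<le> ennreal B * (\<integral>\<^sup>+x. ennreal ((norm (f x))\<^sup>2) \<partial>lborel)"
proof -
  obtain A where A': "A > 0" "\<And>\<eta>. \<eta> > 0 \<Longrightarrow>
      (\<integral>\<^sup>+(u::real^'n). ennreal (if norm u \<ge> \<eta> then 1 / norm u powr (real DIM(real^'n) + \<delta>) else 0) \<partial>lborel) \<le> ennreal (A * \<eta> powr (-\<delta>))"
    by (rule nn_integral_power_tail[where 'b = "real ^ 'n", OF delta]) (rule that)
  note A = A'[unfolded DIM_cart DIM_real mult_1_right]
  define B where "B = 3 * (C * A)\<^sup>2 + 3 * M + 3 * M * 2 ^ CARD('n)"
  have B: "B \<ge> 0" unfolding B_def using M by auto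
  have "(\<integral>\<^sup>+x. ennreal ((norm (op_trunc \<eta> f x))\<^sup>2) \<partial>lborel) \<le> ennreal B * (\<integral>\<^sup>+x. ennreal ((norm (f x))\<^sup>2) \<partial>lborel)"
    if \<eta>: "\<eta> > 0" and f: "f \<in> bounded_L2" for \<eta> f
  proof -
    note [measurable] = bounded_L2_measurable[OF f] op_trunc_measurable(1)[OF f] T_measurable[OF f]
    have [measurable]: "ball (0::real^'n) r \<in> sets borel" for r by simp
    have indm[measurable]: "(\<lambda>z. indicator (ball (0::real^'n) r) (x - z) :: ennreal) \<in> borel_measurable borel" for r x
      by measurable
    let ?N = "\<integral>\<^sup>+x. ennreal ((norm (f x))\<^sup>2) \<partial>lborel"
    define k where "k = (\<lambda>u::real ^ 'n. if norm u \<ge> \<eta> then C * (\<eta> / 2) powr \<delta> / norm u powr (real CARD('n) + \<delta>) else 0)"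
    have k0: "k u \<ge> 0" for u unfolding k_def using C by auto
    have km[measurable]: "k \<in> borel_measurable borel" unfolding k_def by measurable
    have ik: "(\<integral>\<^sup>+u. ennreal (k u) \<partial>lborel) \<le> ennreal (C * A)"
    proof -
      have "(\<integral>\<^sup>+u. ennreal (k u) \<partial>lborel) = (\<integral>\<^sup>+(u::real^'n). ennreal (C * (\<eta> / 2) powr \<delta>) * ennreal (if norm u \<ge> \<eta> then 1 / norm u powr (real CARD('n) + \<delta>) else 0) \<partial>lborel)"
        using C by (intro nn_integral_cong) (simp add: k_def flip: ennreal_mult)
      also have "\<dots> = ennreal (C * (\<eta> / 2) powr \<delta>) * (\<integral>\<^sup>+(u::real^'n). ennreal (if norm u \<ge> \<eta> then 1 / norm u powr (real CARD('n) + \<delta>) else 0) \<partial>lborel)"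
        by (intro nn_integral_cmult) measurable
      also have "\<dots> \<le> ennreal (C * (\<eta> / 2) powr \<delta>) * ennreal (A * \<eta> powr (-\<delta>))"
        by (intro mult_left_mono A \<eta>) auto
      also have "\<dots> = ennreal (C * A * (1 / 2) powr \<delta>)"
        using C A \<eta> by (simp add: powr_divide powr_minus field_simps flip: ennreal_mult)
      also have "\<dots> \<le> ennreal (C * A)"
      proof (rule ennreal_leI)
        have "(1 / 2) powr \<delta> \<le> (1 / 2 :: real) powr 0" using delta by (intro powr_mono') auto
        then show "C * A * (1 / 2) powr \<delta> \<le> C * A"
          using C A by (intro mult_left_le) auto
      qed
      finally show ?thesis .
    qed
    define E where "E x = (\<integral>\<^sup>+y. ennreal (k (x - y) * norm (f y)) \<partial>lborel)" for x
    have [measurable]: "E \<in> borel_measurable borel" unfolding E_def by measurable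
    define v where "v = emeasure lborel (ball (0::real^'n) (\<eta> / 2))"
    define w where "w = emeasure lborel (ball (0::real^'n) \<eta>)"
    have v: "v \<noteq> 0" "v \<noteq> top"
      using content_ball_pos[of "\<eta> / 2" "0::real^'n"] \<eta> emeasure_lborel_ball_finite[of "0::real^'n" "\<eta>/2"]
      by (auto simp: v_def measure_def zero_less_iff_neq_zero)
    have w: "w = 2 ^ CARD('n) * v"
    proof -
      have "measure lborel (ball (0::real^'n) \<eta>) = 2 ^ CARD('n) * measure lborel (ball (0::real^'n) (\<eta> / 2))"
        using content_ball_conv_unit_ball[of "\<eta>" "0::real^'n"] content_ball_conv_unit_ball[of "\<eta> / 2" "0::real^'n"] \<eta>
        by (simp add: power_divide)
      then have "ennreal (measure lborel (ball (0::real^'n) \<eta>)) = 2 ^ CARD('n) * ennreal (measure lborel (ball (0::real^'n) (\<eta> / 2)))"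
        by (simp add: ennreal_mult ennreal_power flip: ennreal_numeral)
      then show ?thesis
        unfolding v_def w_def using emeasure_lborel_ball_finite[of "0::real^'n"]
        by (subst (1 2) emeasure_eq_ennreal_measure) (auto simp: top.not_eq_extremum)
    qed
    have pt: "v * ennreal ((norm (op_trunc \<eta> f x))\<^sup>2) \<le> v * 3 * (E x)\<^sup>2
        + 3 * (\<integral>\<^sup>+z. indicator (ball 0 (\<eta> / 2)) (x - z) * ennreal ((norm (T f z))\<^sup>2) \<partial>lborel)
        + 3 * ennreal M * (\<integral>\<^sup>+y. indicator (ball 0 \<eta>) (x - y) * ennreal ((norm (f y))\<^sup>2) \<partial>lborel)" for x
    proof -
      define f1 where "f1 = (\<lambda>y. if y \<in> ball x \<eta> then f y else 0)"
      have f1: "f1 \<in> bounded_L2" unfolding f1_def by (intro bounded_L2_cut f) auto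
      note [measurable] = T_measurable[OF f1]
      let ?I = "\<lambda>z. indicator (ball 0 (\<eta> / 2)) (x - z) :: ennreal"
      have iv: "(\<integral>\<^sup>+z. ?I z * c \<partial>lborel) = v * c" for c
      proof -
        have ind: "indicator (ball (0::real^'n) (\<eta> / 2)) \<in> borel_measurable borel"
          by (intro borel_measurable_indicator) auto
        show ?thesis
          using nn_integral_lborel_reflect[OF ind, of x] indm[of "\<eta> / 2" x] by (simp add: nn_integral_multc v_def)
      qed
      have "v * ennreal ((norm (op_trunc \<eta> f x))\<^sup>2) = (\<integral>\<^sup>+z. ?I z * ennreal ((norm (op_trunc \<eta> f x))\<^sup>2) \<partial>lborel)"
        by (simp only: iv)
      also have "\<dots> \<le> (\<integral>\<^sup>+z. 3 * (E x)\<^sup>2 * ?I z + 3 * (?I z * ennreal ((norm (T f z))\<^sup>2)) + 3 * ennreal ((norm (T f1 z))\<^sup>2) \<partial>lborel)"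
      proof (rule nn_integral_mono_AE)
        show "AE z in lborel. ?I z * ennreal ((norm (op_trunc \<eta> f x))\<^sup>2)
            \<le> 3 * (E x)\<^sup>2 * ?I z + 3 * (?I z * ennreal ((norm (T f z))\<^sup>2)) + 3 * ennreal ((norm (T f1 z))\<^sup>2)"
        proof -
          have "AE z in lborel. z \<in> ball x (\<eta> / 2) \<longrightarrow> ennreal ((norm (op_trunc \<eta> f x))\<^sup>2)
              \<le> 3 * (E x)\<^sup>2 + 3 * ennreal ((norm (T f z))\<^sup>2) + 3 * ennreal ((norm (T f1 z))\<^sup>2)"
            using op_trunc_pointwise_bound[OF f \<eta>, of x] unfolding E_def k_def f1_def .
          then show ?thesis
            by eventually_elim (auto simp: indicator_def dist_norm norm_minus_commute)
        qed
      qed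
      also have "\<dots> = v * 3 * (E x)\<^sup>2 + 3 * (\<integral>\<^sup>+z. ?I z * ennreal ((norm (T f z))\<^sup>2) \<partial>lborel) + 3 * (\<integral>\<^sup>+z. ennreal ((norm (T f1 z))\<^sup>2) \<partial>lborel)"
        using nn_integral_linear_combination3[of ?I lborel "\<lambda>z. ?I z * ennreal ((norm (T f z))\<^sup>2)" "\<lambda>z. ennreal ((norm (T f1 z))\<^sup>2)" "3 * (E x)\<^sup>2" 3 3]
          iv[of 1] by (simp add: mult_ac)
      also have "\<dots> \<le> v * 3 * (E x)\<^sup>2 + 3 * (\<integral>\<^sup>+z. ?I z * ennreal ((norm (T f z))\<^sup>2) \<partial>lborel)
          + 3 * (ennreal M * (\<integral>\<^sup>+y. ennreal ((norm (f1 y))\<^sup>2) \<partial>lborel))"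
        by (intro add_left_mono mult_left_mono T_bound f1) auto
      also have "(\<integral>\<^sup>+y. ennreal ((norm (f1 y))\<^sup>2) \<partial>lborel) = (\<integral>\<^sup>+y. indicator (ball 0 \<eta>) (x - y) * ennreal ((norm (f y))\<^sup>2) \<partial>lborel)"
        by (intro nn_integral_cong) (auto simp: f1_def dist_norm indicator_def norm_minus_commute)
      finally show ?thesis by (simp add: mult.assoc)
    qed
    have "v * (\<integral>\<^sup>+x. ennreal ((norm (op_trunc \<eta> f x))\<^sup>2) \<partial>lborel) = (\<integral>\<^sup>+x. v * ennreal ((norm (op_trunc \<eta> f x))\<^sup>2) \<partial>lborel)"
      by (intro nn_integral_cmult[symmetric]) measurable
    also have "\<dots> \<le> (\<integral>\<^sup>+x. v * 3 * (E x)\<^sup>2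
        + 3 * (\<integral>\<^sup>+z. indicator (ball 0 (\<eta> / 2)) (x - z) * ennreal ((norm (T f z))\<^sup>2) \<partial>lborel)
        + 3 * ennreal M * (\<integral>\<^sup>+y. indicator (ball 0 \<eta>) (x - y) * ennreal ((norm (f y))\<^sup>2) \<partial>lborel) \<partial>lborel)"
      by (intro nn_integral_mono pt)
    also have "\<dots> = v * 3 * (\<integral>\<^sup>+x. (E x)\<^sup>2 \<partial>lborel)
        + 3 * (\<integral>\<^sup>+x. \<integral>\<^sup>+z. indicator (ball 0 (\<eta> / 2)) (x - z) * ennreal ((norm (T f z))\<^sup>2) \<partial>lborel \<partial>lborel)
        + 3 * ennreal M * (\<integral>\<^sup>+x. \<integral>\<^sup>+y. indicator (ball 0 \<eta>) (x - y) * ennreal ((norm (f y))\<^sup>2) \<partial>lborel \<partial>lborel)"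
      by (rule nn_integral_linear_combination3) measurable
    also have "\<dots> = v * (3 * (\<integral>\<^sup>+x. (E x)\<^sup>2 \<partial>lborel))
        + 3 * (v * (\<integral>\<^sup>+z. ennreal ((norm (T f z))\<^sup>2) \<partial>lborel)) + 3 * ennreal M * (w * ?N)"
    proof -
      have ind: "indicator (ball (0::real^'n) r) \<in> borel_measurable borel" for r
        by (intro borel_measurable_indicator) auto
      show ?thesis
        using nn_integral_convolution_eq[OF ind, of "\<lambda>z. ennreal ((norm (T f z))\<^sup>2)" "\<eta> / 2"]
          nn_integral_convolution_eq[OF ind, of "\<lambda>z. ennreal ((norm (f z))\<^sup>2)" \<eta>]
        by (simp add: v_def w_def mult.assoc)
    qed
    also have "\<dots> \<le> v * (3 * (ennreal (C * A))\<^sup>2 * ?N) + 3 * (v * (ennreal M * ?N)) + 3 * ennreal M * (w * ?N)"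
    proof (intro add_right_mono add_mono mult_left_mono)
      have "(\<integral>\<^sup>+x. (E x)\<^sup>2 \<partial>lborel) \<le> (\<integral>\<^sup>+u. ennreal (k u) \<partial>lborel)\<^sup>2 * ?N"
        unfolding E_def by (rule nn_integral_convolution_square_le) (auto simp: k0)
      also have "\<dots> \<le> (ennreal (C * A))\<^sup>2 * ?N"
        by (intro mult_right_mono power_mono ik) auto
      finally show "3 * (\<integral>\<^sup>+x. (E x)\<^sup>2 \<partial>lborel) \<le> 3 * (ennreal (C * A))\<^sup>2 * ?N"
        by (simp add: mult.assoc mult_left_mono)
    qed (auto intro: T_bound f)
    also have "\<dots> = v * ((3 * (ennreal (C * A))\<^sup>2 + 3 * ennreal M + 3 * ennreal M * 2 ^ CARD('n)) * ?N)"
      by (simp only: w distrib_left distrib_right mult_ac)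
    also have "3 * (ennreal (C * A))\<^sup>2 + 3 * ennreal M + 3 * ennreal M * 2 ^ CARD('n) = ennreal B"
    proof -
      have "ennreal (2 ^ CARD('n)) = 2 ^ CARD('n)" by (simp flip: ennreal_power)
      moreover have "3 * (C * A)\<^sup>2 \<ge> 0" "3 * M \<ge> 0" "3 * M * 2 ^ CARD('n) \<ge> 0" "C * A \<ge> 0"
        using C A(1) M by auto
      ultimately show ?thesis
        unfolding B_def using M by (simp only: ennreal_plus add_nonneg_nonneg ennreal_mult'' ennreal_mult' ennreal_numeral ennreal_power zero_le_numeral zero_le_power)
    qed
    finally show ?thesis
      using v by (simp add: ennreal_mult_le_mult_iff)
  qed
  then show thesis using that B by blast
qed

section \<open>The transposed truncations and the limit in the duality\<close>

text \<open>
  Duality: with \<open>h\<close> the transposed truncation of \<open>g\<close>, test against \<open>a = \<bar>h\<bar>\<^sup>2 / h\<close> on \<open>S\<close>, which has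
  \<open>\<bar>a\<bar> = \<bar>h\<bar>\<close> and \<open>h a = \<bar>h\<bar>\<^sup>2\<close> and stands in for the complex conjugate. The bounded set \<open>S\<close>
  guarantees beforehand that the norm being estimated is finite.
\<close>

lemma op_trunc_transpose_bound:
  obtains B where "B \<ge> 0" "\<And>\<eta> g S R. \<eta> > 0 \<Longrightarrow> g \<in> bounded_L2 \<Longrightarrow> S \<in> sets borel \<Longrightarrow> S \<subseteq> cball 0 R \<Longrightarrow>
    (\<integral>\<^sup>+y. indicator S y * ennreal ((norm (op_trunc_transpose \<eta> g y))\<^sup>2) \<partial>lborel)
      \<le> ennreal B * (\<integral>\<^sup>+x. ennreal ((norm (g x))\<^sup>2) \<partial>lborel)"
proof -
  obtain B where B: "B \<ge> 0" "\<And>\<eta> f. \<eta> > 0 \<Longrightarrow> f \<in> bounded_L2 \<Longrightarrow>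
    (\<integral>\<^sup>+x. ennreal ((norm (op_trunc \<eta> f x))\<^sup>2) \<partial>lborel) \<le> ennreal B * (\<integral>\<^sup>+x. ennreal ((norm (f x))\<^sup>2) \<partial>lborel)"
    using op_trunc_uniform_bound by blast
  have "(\<integral>\<^sup>+y. indicator S y * ennreal ((norm (op_trunc_transpose \<eta> g y))\<^sup>2) \<partial>lborel)
      \<le> ennreal B * (\<integral>\<^sup>+x. ennreal ((norm (g x))\<^sup>2) \<partial>lborel)"
    if \<eta>: "\<eta> > 0" and g: "g \<in> bounded_L2" and S[measurable]: "S \<in> sets borel" and SR: "S \<subseteq> cball 0 R" for \<eta> g S R
  proof -
    note [measurable] = bounded_L2_measurable[OF g] op_trunc_measurable(2)[OF g]
    define h where "h = op_trunc_transpose \<eta> g"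
    have hm[measurable]: "h \<in> borel_measurable borel" unfolding h_def by measurable
    define H where "H = C / \<eta> ^ CARD('n) * (LINT x|lborel. norm (g x))"
    have hH: "norm (h y) \<le> H" for y
    proof -
      have "norm (h y) \<le> (LINT x|lborel. norm (trunc \<eta> x y * g x))"
        unfolding h_def op_trunc_transpose_def by (rule integral_norm_bound)
      also have "\<dots> \<le> (LINT x|lborel. C / \<eta> ^ CARD('n) * norm (g x))"
      proof (intro integral_mono integrable_norm trunc_integrable(2)[OF g \<eta>])
        show "integrable lborel (\<lambda>x. C / \<eta> ^ CARD('n) * norm (g x))"
          using bounded_L2_integrable[OF g] by (intro integrable_mult_right integrable_norm)
        show "norm (trunc \<eta> x y * g x) \<le> C / \<eta> ^ CARD('n) * norm (g x)" for x
          using mult_right_mono[OF trunc_bound[OF \<eta>, of x y] norm_ge_zero[of "g x"]] by (simp add: norm_mult)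
      qed
      finally show ?thesis by (simp add: H_def)
    qed
    define a where "a y = (if y \<in> S then of_real ((norm (h y))\<^sup>2) / h y else 0)" for y
    have na: "norm (a y) = indicator S y * norm (h y)" for y
      by (simp add: a_def norm_divide norm_power power2_eq_square norm_mult del: of_real_power)
    have ha: "h y * a y = of_real (indicator S y * (norm (h y))\<^sup>2)" for y
      by (cases "h y = 0") (auto simp: a_def)
    have a: "a \<in> bounded_L2"
    proof (rule bounded_L2_of_bounded)
      show "a \<in> borel_measurable borel" unfolding a_def by measurable
      show "norm (a y) \<le> H" for y
        using hH[of y] order_trans[OF norm_ge_zero hH[of y]] by (auto simp: na indicator_def)
      show "a y = 0" if "R < norm y" for y
        using that SR by (auto simp: a_def)
    qed
    note [measurable] = op_trunc_measurable(1)[OF a] bounded_L2_measurable[OF a]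
    let ?G = "\<integral>\<^sup>+x. ennreal ((norm (g x))\<^sup>2) \<partial>lborel"
    define X where "X = (LINT y|lborel. indicator S y * (norm (h y))\<^sup>2)"
    have Xi: "integrable lborel (\<lambda>y. indicator S y * (norm (h y))\<^sup>2)"
    proof -
      have "(norm (a y))\<^sup>2 = indicator S y * (norm (h y))\<^sup>2" for y
        by (auto simp: na indicator_def)
      then show ?thesis using bounded_L2_square[OF a] by simp
    qed
    have X0: "X \<ge> 0" unfolding X_def by (intro integral_nonneg_AE) auto
    have XE: "(\<integral>\<^sup>+y. ennreal (indicator S y * (norm (h y))\<^sup>2) \<partial>lborel) = ennreal X"
      unfolding X_def using Xi by (intro nn_integral_eq_integral) auto
    have Xa: "(\<integral>\<^sup>+y. ennreal ((norm (a y))\<^sup>2) \<partial>lborel) = ennreal X"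
      unfolding XE[symmetric] by (intro nn_integral_cong) (auto simp: na indicator_def)
    have int: "integrable lborel (\<lambda>x. op_trunc \<eta> a x * g x)"
    proof (rule integrable_mult_L2)
      show "integrable lborel (\<lambda>x. (norm (op_trunc \<eta> a x))\<^sup>2)"
      proof (rule integrableI_nonneg)
        have "(\<integral>\<^sup>+x. ennreal ((norm (op_trunc \<eta> a x))\<^sup>2) \<partial>lborel) \<le> ennreal B * ennreal X"
          using B(2)[OF \<eta> a] Xa by simp
        also have "\<dots> < \<infinity>" by (simp add: ennreal_mult_less_top)
        finally show "(\<integral>\<^sup>+x. ennreal ((norm (op_trunc \<eta> a x))\<^sup>2) \<partial>lborel) < \<infinity>" .
      qed auto
    qed (use bounded_L2_square[OF g] in auto)
    have "of_real X = (LINT y|lborel. h y * a y)"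
      unfolding ha X_def by (rule integral_bounded_linear[OF bounded_linear_of_real Xi, symmetric])
    also have "\<dots> = (LINT x|lborel. op_trunc \<eta> a x * g x)"
      using op_trunc_duality[OF a g \<eta>] by (simp add: h_def)
    finally have "X = norm (LINT x|lborel. op_trunc \<eta> a x * g x)"
      using X0 by (metis abs_of_nonneg norm_of_real)
    then have "ennreal X \<le> (\<integral>\<^sup>+x. ennreal (norm (op_trunc \<eta> a x * g x)) \<partial>lborel)"
      using integral_norm_bound_ennreal[OF int] by simp
    also have "\<dots> = (\<integral>\<^sup>+x. ennreal (norm (op_trunc \<eta> a x)) * ennreal (norm (g x)) \<partial>lborel)"
      by (simp add: norm_mult ennreal_mult)
    finally have "(ennreal X)\<^sup>2 \<le> (\<integral>\<^sup>+x. ennreal (norm (op_trunc \<eta> a x)) * ennreal (norm (g x)) \<partial>lborel)\<^sup>2"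
      by (intro power_mono) auto
    also have "\<dots> \<le> (\<integral>\<^sup>+x. (ennreal (norm (op_trunc \<eta> a x)))\<^sup>2 \<partial>lborel) * (\<integral>\<^sup>+x. (ennreal (norm (g x)))\<^sup>2 \<partial>lborel)"
      by (rule Cauchy_Schwarz_nn_integral) measurable
    also have "\<dots> = (\<integral>\<^sup>+x. ennreal ((norm (op_trunc \<eta> a x))\<^sup>2) \<partial>lborel) * ?G"
      by (simp add: ennreal_power)
    also have "\<dots> \<le> (ennreal B * ennreal X) * ?G"
      using B(2)[OF \<eta> a] Xa by (intro mult_right_mono) auto
    finally have *: "ennreal X * ennreal X \<le> ennreal X * (ennreal B * ?G)"
      by (simp add: power2_eq_square mult_ac)
    have "ennreal X \<le> ennreal B * ?G"
    proof (cases "X = 0")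
      case False
      then have "ennreal X \<noteq> 0" using X0 by simp
      with * show ?thesis by (simp add: ennreal_mult_le_mult_iff)
    qed simp
    moreover have "(\<integral>\<^sup>+y. indicator S y * ennreal ((norm (h y))\<^sup>2) \<partial>lborel) = ennreal X"
      unfolding XE[symmetric] by (intro nn_integral_cong) (auto simp: indicator_def)
    ultimately show ?thesis by (simp add: h_def)
  qed
  then show thesis using that B(1) by blast
qed

lemma bounded_L2_nn_finite:
  assumes "f \<in> bounded_L2"
  obtains N where "N \<ge> 0" "(\<integral>\<^sup>+x. ennreal ((norm (f x))\<^sup>2) \<partial>lborel) = ennreal N"
proof
  show "(\<integral>\<^sup>+x. ennreal ((norm (f x))\<^sup>2) \<partial>lborel) = ennreal (LINT x|lborel. (norm (f x))\<^sup>2)"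
    using bounded_L2_square[OF assms] by (intro nn_integral_eq_integral) auto
qed auto

text \<open>
  Both sides of \<open>op_trunc_duality\<close> converge, by the uniform bounds and almost everywhere convergence.
\<close>

lemma pairing_eq_transpose_limit:
  assumes f: "f \<in> bounded_L2" and g: "g \<in> bounded_L2"
    and [measurable]: "H \<in> borel_measurable borel"
    and lim: "AE y in lborel. f y \<noteq> 0 \<longrightarrow> (\<lambda>k. op_trunc_transpose (inverse (real (Suc k))) g y) \<longlonglongrightarrow> H y"
  shows "(LINT x|lborel. T f x * g x) = (LINT y|lborel. H y * f y)"
    and "integrable lborel (\<lambda>x. T f x * g x)" and "integrable lborel (\<lambda>y. H y * f y)"
proof -
  note [measurable] = bounded_L2_measurable[OF f] bounded_L2_measurable[OF g]
    op_trunc_measurable(1)[OF f] op_trunc_measurable(2)[OF g] T_measurable[OF f]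
  let ?e = "\<lambda>k. inverse (real (Suc k))"
  have e: "?e k > 0" for k by simp
  define S where "S = {y. f y \<noteq> 0}"
  have S[measurable]: "S \<in> sets borel" unfolding S_def by measurable
  obtain R where R: "\<And>x. R < norm x \<Longrightarrow> f x = 0" using f by (auto simp: bounded_L2_def)
  have SR: "S \<subseteq> cball 0 R" using R by (force simp: S_def)
  obtain N where N: "N \<ge> 0" "(\<integral>\<^sup>+x. ennreal ((norm (f x))\<^sup>2) \<partial>lborel) = ennreal N"
    using bounded_L2_nn_finite[OF f] .
  obtain N' where N': "N' \<ge> 0" "(\<integral>\<^sup>+x. ennreal ((norm (g x))\<^sup>2) \<partial>lborel) = ennreal N'"
    using bounded_L2_nn_finite[OF g] .
  obtain B where B: "B \<ge> 0" "\<And>\<eta> f. \<eta> > 0 \<Longrightarrow> f \<in> bounded_L2 \<Longrightarrow>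
    (\<integral>\<^sup>+x. ennreal ((norm (op_trunc \<eta> f x))\<^sup>2) \<partial>lborel) \<le> ennreal B * (\<integral>\<^sup>+x. ennreal ((norm (f x))\<^sup>2) \<partial>lborel)"
    using op_trunc_uniform_bound by blast
  obtain B' where B': "B' \<ge> 0" "\<And>\<eta> g S R. \<eta> > 0 \<Longrightarrow> g \<in> bounded_L2 \<Longrightarrow> S \<in> sets borel \<Longrightarrow> S \<subseteq> cball 0 R \<Longrightarrow>
    (\<integral>\<^sup>+y. indicator S y * ennreal ((norm (op_trunc_transpose \<eta> g y))\<^sup>2) \<partial>lborel)
      \<le> ennreal B' * (\<integral>\<^sup>+x. ennreal ((norm (g x))\<^sup>2) \<partial>lborel)"
    using op_trunc_transpose_bound by blast
  have "AE x in lborel. (\<lambda>k. op_trunc (?e k) f x) \<longlonglongrightarrow> T f x"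
    using T_lim[OF f] by eventually_elim (rule filterlim_compose[OF _ inverse_Suc_at_right_0])
  note lim1 = weak_limit_of_AE_limit[where g = g and B = "B * N", OF _ _ _ bounded_L2_square[OF g] this]
  have bd1: "(\<integral>\<^sup>+x. ennreal ((norm (op_trunc (?e k) f x))\<^sup>2) \<partial>lborel) \<le> ennreal (B * N)" for k
    using B(2)[OF e f] N B(1) by (simp add: ennreal_mult)
  define F where "F k y = (if y \<in> S then op_trunc_transpose (?e k) g y else 0)" for k y
  define F' where "F' y = (if y \<in> S then H y else 0)" for y
  have "AE y in lborel. (\<lambda>k. F k y) \<longlonglongrightarrow> F' y"
    using lim by eventually_elim (auto simp: F_def F'_def S_def)
  note lim2 = weak_limit_of_AE_limit[where g = f and B = "B' * N'", OF _ _ _ bounded_L2_square[OF f] this]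
  have bd2: "(\<integral>\<^sup>+x. ennreal ((norm (F k x))\<^sup>2) \<partial>lborel) \<le> ennreal (B' * N')" for k
  proof -
    have "(\<integral>\<^sup>+x. ennreal ((norm (F k x))\<^sup>2) \<partial>lborel)
        = (\<integral>\<^sup>+y. indicator S y * ennreal ((norm (op_trunc_transpose (?e k) g y))\<^sup>2) \<partial>lborel)"
      by (intro nn_integral_cong) (auto simp: F_def)
    then show ?thesis
      using B'(2)[OF e g S SR] N' B'(1) by (simp add: ennreal_mult)
  qed
  have [measurable]: "F k \<in> borel_measurable borel" "F' \<in> borel_measurable borel" for k
    unfolding F_def F'_def by measurable
  have i1: "integrable lborel (\<lambda>x. (norm (T f x))\<^sup>2)"
    by (rule lim1(1)[OF _ _ _ bd1]) auto
  then show "integrable lborel (\<lambda>x. T f x * g x)"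
    by (intro integrable_mult_L2) (use bounded_L2_square[OF g] in auto)
  have i2: "integrable lborel (\<lambda>x. (norm (F' x))\<^sup>2)"
    by (rule lim2(1)[OF _ _ _ bd2]) auto
  then have "integrable lborel (\<lambda>x. F' x * f x)"
    by (intro integrable_mult_L2) (use bounded_L2_square[OF f] in auto)
  moreover have F'f: "F' x * f x = H x * f x" for x by (simp add: F'_def S_def)
  ultimately show "integrable lborel (\<lambda>y. H y * f y)" by simp
  have "(\<lambda>k. LINT x|lborel. op_trunc (?e k) f x * g x) \<longlonglongrightarrow> (LINT x|lborel. T f x * g x)"
    by (rule lim1(2)[OF _ _ _ bd1]) auto
  moreover have "(\<lambda>k. LINT x|lborel. F k x * f x) \<longlonglongrightarrow> (LINT x|lborel. F' x * f x)"
    by (rule lim2(2)[OF _ _ _ bd2]) auto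
  moreover have "(LINT x|lborel. op_trunc (?e k) f x * g x) = (LINT x|lborel. F k x * f x)" for k
    unfolding op_trunc_duality[OF f g e]
    by (intro Bochner_Integration.integral_cong) (auto simp: F_def S_def)
  ultimately have "(LINT x|lborel. T f x * g x) = (LINT x|lborel. F' x * f x)"
    using LIMSEQ_unique by simp
  then show "(LINT x|lborel. T f x * g x) = (LINT y|lborel. H y * f y)"
    by (simp add: F'f)
qed

end

section \<open>Taylor expansion of the kernel\<close>

lemma has_vector_derivative_difference_quotient:
  assumes "(f has_vector_derivative D) (at x)"
  shows "((\<lambda>t. (f (x + t) - f x) /\<^sub>R t) \<longlongrightarrow> D) (at 0)"
proof -
  have "((\<lambda>t. norm (f (x + t) - f x - t *\<^sub>R D) / norm t) \<longlongrightarrow> 0) (at 0)"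
    using assms by (simp add: has_vector_derivative_def has_derivative_at)
  moreover have "\<forall>\<^sub>F t in at 0. norm (f (x + t) - f x - t *\<^sub>R D) / norm t = norm ((f (x + t) - f x) /\<^sub>R t - D)"
  proof (rule eventually_mono[OF eventually_neq_at_within[of 0]])
    fix t :: real assume "t \<noteq> 0"
    then have "f (x + t) - f x - t *\<^sub>R D = t *\<^sub>R ((f (x + t) - f x) /\<^sub>R t - D)"
      by (simp add: scaleR_diff_right)
    with \<open>t \<noteq> 0\<close> show "norm (f (x + t) - f x - t *\<^sub>R D) / norm t = norm ((f (x + t) - f x) /\<^sub>R t - D)"
      by (metis nonzero_mult_div_cancel_left norm_eq_zero norm_scaleR real_norm_def)
  qed
  ultimately have "((\<lambda>t. norm ((f (x + t) - f x) /\<^sub>R t - D)) \<longlongrightarrow> 0) (at 0)"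
    by (rule Lim_transform_eventually)
  then show ?thesis
    by (simp add: tendsto_norm_zero_iff LIM_zero_iff)
qed

lemma mi_taylor_measurable [measurable (raw)]:
  fixes d :: "nat ^ 'n \<Rightarrow> 'b \<Rightarrow> 'a :: {real_normed_field, euclidean_space}"
  assumes "\<And>\<gamma>. mi_order \<gamma> \<le> s \<Longrightarrow> d \<gamma> \<in> borel_measurable N" and [measurable]: "h \<in> borel_measurable N"
  shows "(\<lambda>w. mi_taylor s (\<lambda>\<gamma>. d \<gamma> w) (h w)) \<in> borel_measurable N"
  unfolding mi_taylor_def
proof (rule borel_measurable_sum)
  fix \<gamma> :: "nat ^ 'n" assume "\<gamma> \<in> {\<gamma>. mi_order \<gamma> \<le> s}"
  then have [measurable]: "d \<gamma> \<in> borel_measurable N" using assms(1) by simp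
  show "(\<lambda>w. d \<gamma> w / of_nat (mi_fact \<gamma>) * of_real (mi_power (h w) \<gamma>)) \<in> borel_measurable N"
    by measurable
qed

lemma norm_mi_taylor_le:
  fixes d :: "nat ^ 'n \<Rightarrow> 'a :: real_normed_field"
  assumes "\<And>\<gamma>. mi_order \<gamma> \<le> s \<Longrightarrow> norm (d \<gamma>) \<le> A" and h: "norm h \<le> R" "R \<ge> 1"
  shows "norm (mi_taylor s d h) \<le> real (card {\<gamma> :: nat ^ 'n. mi_order \<gamma> \<le> s}) * (A * R ^ s)"
  unfolding mi_taylor_def
proof (rule sum_norm_bound)
  fix \<gamma> :: "nat ^ 'n" assume "\<gamma> \<in> {\<gamma>. mi_order \<gamma> \<le> s}"
  then have \<gamma>: "mi_order \<gamma> \<le> s" by simp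
  have A: "A \<ge> 0" using order_trans[OF norm_ge_zero assms(1)[OF \<gamma>]] .
  have "\<bar>mi_power h \<gamma>\<bar> \<le> norm h ^ mi_order \<gamma>" by (rule abs_mi_power_le)
  also have "\<dots> \<le> R ^ mi_order \<gamma>" using h by (intro power_mono) auto
  also have "\<dots> \<le> R ^ s" using h \<gamma> by (intro power_increasing) auto
  finally have p: "\<bar>mi_power h \<gamma>\<bar> \<le> R ^ s" .
  have "norm (d \<gamma> / of_nat (mi_fact \<gamma>)) \<le> A"
  proof -
    have "norm (d \<gamma>) / real (mi_fact \<gamma>) \<le> norm (d \<gamma>) / 1"
      using mi_fact_nonzero[of \<gamma>] by (intro divide_left_mono) (auto simp: Suc_le_eq simp del: mi_fact_nonzero)
    then show ?thesis using assms(1)[OF \<gamma>] by (simp add: norm_divide)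
  qed
  with p A show "norm (d \<gamma> / of_nat (mi_fact \<gamma>) * of_real (mi_power h \<gamma>)) \<le> A * R ^ s"
    by (simp only: norm_mult norm_of_real) (intro mult_mono, auto)
qed

lemma bounded_L2_integrable_mi_power:
  fixes f :: "real ^ 'n \<Rightarrow> 'a :: {real_normed_field, euclidean_space}"
  assumes f: "f \<in> bounded_L2"
  shows "integrable lborel (\<lambda>y. f y * of_real (mi_power (y - x) \<gamma> * mi_power y \<beta>))"
proof -
  obtain R where R: "\<And>x. R < norm x \<Longrightarrow> f x = 0" using f by (auto simp: bounded_L2_def)
  show ?thesis
  proof (rule bounded_L2_integrable_mult[OF f])
    show "norm (of_real (mi_power (y - x) \<gamma> * mi_power y \<beta>) :: 'a) \<le> (R + norm x) ^ mi_order \<gamma> * R ^ mi_order \<beta>"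
      if "f y \<noteq> 0" for y
    proof -
      have y: "norm y \<le> R" using R[of y] that by force
      have yx: "norm (y - x) \<le> R + norm x" using norm_triangle_ineq4[of y x] y by simp
      have "\<bar>mi_power (y - x) \<gamma>\<bar> \<le> (R + norm x) ^ mi_order \<gamma>"
        by (rule order_trans[OF abs_mi_power_le power_mono[OF yx norm_ge_zero]])
      moreover have "\<bar>mi_power y \<beta>\<bar> \<le> R ^ mi_order \<beta>"
        by (rule order_trans[OF abs_mi_power_le power_mono[OF y norm_ge_zero]])
      ultimately show ?thesis
        unfolding norm_of_real abs_mult by (intro mult_mono) (auto intro: order_trans[OF abs_ge_zero])
    qed
  qed measurable
qed

text \<open>
  One factor \<open>y\<^sub>i - x\<^sub>i\<close> at a time is traded for a factor \<open>y\<^sub>i\<close> and a constant. Carrying the unshifted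
  power \<open>\<beta>\<close> along makes the induction close without expanding the shifted monomial.
\<close>

lemma moments_vanish_shifted:
  fixes f :: "real ^ 'n \<Rightarrow> 'a :: {real_normed_field, euclidean_space}"
  assumes f: "f \<in> bounded_L2"
    and mom: "\<And>\<gamma>. mi_order \<gamma> \<le> s \<Longrightarrow> (LINT y|lborel. f y * of_real (mi_power y \<gamma>)) = 0"
    and "mi_order \<gamma> + mi_order \<beta> \<le> s"
  shows "(LINT y|lborel. f y * of_real (mi_power (y - x) \<gamma> * mi_power y \<beta>)) = 0"
  using assms(3)
proof (induction "mi_order \<gamma>" arbitrary: \<gamma> \<beta>)
  case 0
  then have "\<gamma> = 0" by (simp add: mi_order_eq_0_iff)
  then show ?case using mom[of \<beta>] 0 by simp
next
  case (Suc m)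
  obtain \<alpha> i where \<gamma>: "\<gamma> = \<alpha> + axis i 1" and \<alpha>: "mi_order \<alpha> = m"
    using mi_order_SucE[OF Suc.hyps(2)[symmetric]] .
  have eq: "f y * of_real (mi_power (y - x) \<gamma> * mi_power y \<beta>)
      = f y * of_real (mi_power (y - x) \<alpha> * mi_power y (\<beta> + axis i 1))
        - of_real (x $ i) * (f y * of_real (mi_power (y - x) \<alpha> * mi_power y \<beta>))" for y
    unfolding \<gamma> mi_power_axis by (simp add: algebra_simps)
  have "(LINT y|lborel. f y * of_real (mi_power (y - x) \<alpha> * mi_power y (\<beta> + axis i 1))) = 0"
    using Suc.prems Suc.hyps(2) \<alpha> by (intro Suc.hyps(1)) (simp_all add: mi_order_axis[unfolded One_nat_def])
  moreover have "(LINT y|lborel. f y * of_real (mi_power (y - x) \<alpha> * mi_power y \<beta>)) = 0"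
    using Suc.prems Suc.hyps(2) \<alpha> by (intro Suc.hyps(1)) simp_all
  ultimately show ?case
    unfolding eq using bounded_L2_integrable_mi_power[OF f] by (simp del: of_real_mult)
qed

lemma bounded_L2_mi_taylor:
  fixes f :: "real ^ 'n \<Rightarrow> 'a :: {real_normed_field, euclidean_space}"
  assumes f: "f \<in> bounded_L2"
  shows "integrable lborel (\<lambda>y. mi_taylor s d (y - x) * f y)"
    and "(\<And>\<gamma>. mi_order \<gamma> \<le> s \<Longrightarrow> (LINT y|lborel. f y * of_real (mi_power y \<gamma>)) = 0) \<Longrightarrow>
      (LINT y|lborel. mi_taylor s d (y - x) * f y) = 0"
proof -
  have eq: "mi_taylor s d (y - x) * f y
      = (\<Sum>\<gamma> | mi_order \<gamma> \<le> s. d \<gamma> / of_nat (mi_fact \<gamma>) * (f y * of_real (mi_power (y - x) \<gamma> * mi_power y 0)))" for y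
    unfolding mi_taylor_def sum_distrib_right by (intro sum.cong) (simp_all add: mult_ac)
  note i = bounded_L2_integrable_mi_power[OF f, of x _ 0]
  show "integrable lborel (\<lambda>y. mi_taylor s d (y - x) * f y)"
    unfolding eq by (intro Bochner_Integration.integrable_sum integrable_mult_right i)
  show "(LINT y|lborel. mi_taylor s d (y - x) * f y) = 0"
    if mom: "\<And>\<gamma>. mi_order \<gamma> \<le> s \<Longrightarrow> (LINT y|lborel. f y * of_real (mi_power y \<gamma>)) = 0"
  proof -
    have "(LINT y|lborel. mi_taylor s d (y - x) * f y)
        = (\<Sum>\<gamma> | mi_order \<gamma> \<le> s. LINT y|lborel. d \<gamma> / of_nat (mi_fact \<gamma>) * (f y * of_real (mi_power (y - x) \<gamma> * mi_power y 0)))"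
      unfolding eq by (intro Bochner_Integration.integral_sum integrable_mult_right i)
    also have "\<dots> = 0"
      using moments_vanish_shifted[OF f mom, of s _ 0 x] by (intro sum.neutral) (auto simp del: of_real_mult)
    finally show ?thesis .
  qed
qed

context kernel_bounds begin

definition kernel_deriv :: "real ^ 'n \<Rightarrow> nat ^ 'n \<Rightarrow> real ^ 'n \<Rightarrow> 'a" where
  "kernel_deriv u \<gamma> x = (if x = u then 0 else mi_deriv \<gamma> (K x) u)"

text \<open>
  For fixed \<open>u\<close>, a derivative in the second variable is the limit of difference quotients, each of them
  Borel in \<open>x\<close> by induction on the order. The value at \<open>x = u\<close>, where the kernel is unspecified, is set
  to zero so that the limit holds at every point.
\<close>

lemma kernel_deriv_measurable:
  "mi_order \<gamma> \<le> s \<Longrightarrow> kernel_deriv u \<gamma> \<in> borel_measurable borel"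
proof (induction "mi_order \<gamma>" arbitrary: \<gamma> u)
  case 0
  then have "\<gamma> = 0" by (simp add: mi_order_eq_0_iff)
  then have "kernel_deriv u \<gamma> = (\<lambda>x. trunc 0 x u)"
    by (auto simp: kernel_deriv_def trunc_def)
  then show ?case by simp
next
  case (Suc m)
  obtain \<alpha> i where \<gamma>: "\<gamma> = \<alpha> + axis i 1" and \<alpha>: "mi_order \<alpha> = m"
    using mi_order_SucE[OF Suc.hyps(2)[symmetric]] .
  let ?e = "\<lambda>k. inverse (real (Suc k))"
  define q where "q k x = (if x = u then 0 else
      (kernel_deriv (u + ?e k *\<^sub>R axis i 1) \<alpha> x - kernel_deriv u \<alpha> x) /\<^sub>R ?e k)" for k x
  have m[measurable]: "kernel_deriv v \<alpha> \<in> borel_measurable borel" for v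
    using Suc.hyps Suc.prems \<alpha> by (intro Suc.hyps(1)) auto
  show ?case
  proof (rule borel_measurable_LIMSEQ_metric)
    show "q k \<in> borel_measurable borel" for k
      unfolding q_def by measurable
    fix x :: "real ^ 'n"
    show "(\<lambda>k. q k x) \<longlonglongrightarrow> kernel_deriv u \<gamma> x"
    proof (cases "x = u")
      case False
      have "((\<lambda>t. mi_deriv \<alpha> (K x) (u + t *\<^sub>R axis i 1)) has_vector_derivative mi_deriv \<gamma> (K x) u) (at 0)"
        using partials[of x] False Suc.prems Suc.hyps(2) \<alpha> unfolding \<gamma> has_partials_upto_def by auto
      then have "((\<lambda>t. (mi_deriv \<alpha> (K x) (u + t *\<^sub>R axis i 1) - mi_deriv \<alpha> (K x) u) /\<^sub>R t) \<longlongrightarrow> mi_deriv \<gamma> (K x) u) (at 0)"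
        using has_vector_derivative_difference_quotient by fastforce
      moreover have "filterlim ?e (at 0) sequentially"
        by (rule filterlim_mono[OF inverse_Suc_at_right_0 at_le order_refl]) auto
      ultimately have "(\<lambda>k. (mi_deriv \<alpha> (K x) (u + ?e k *\<^sub>R axis i 1) - mi_deriv \<alpha> (K x) u) /\<^sub>R ?e k) \<longlonglongrightarrow> mi_deriv \<gamma> (K x) u"
        by (rule filterlim_compose)
      moreover have "\<forall>\<^sub>F k in sequentially. (mi_deriv \<alpha> (K x) (u + ?e k *\<^sub>R axis i 1) - mi_deriv \<alpha> (K x) u) /\<^sub>R ?e k = q k x"
      proof -
        have "(\<lambda>k. u + ?e k *\<^sub>R axis i 1) \<longlonglongrightarrow> u + 0 *\<^sub>R axis i 1"
          by (intro tendsto_intros LIMSEQ_inverse_real_of_nat)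
        then have "\<forall>\<^sub>F k in sequentially. u + ?e k *\<^sub>R axis i 1 \<noteq> x"
          using False by (intro tendsto_imp_eventually_ne) auto
        then show ?thesis
          by eventually_elim (use False in \<open>auto simp: q_def kernel_deriv_def\<close>)
      qed
      ultimately show ?thesis
        using False by (simp add: kernel_deriv_def tendsto_cong)
    qed (simp add: q_def kernel_deriv_def)
  qed
qed

lemma kernel_taylor_remainder:
  assumes y: "norm (y - u) < R" and x: "norm (x - u) \<ge> 2 * R"
  shows "norm (K x y - mi_taylor s (\<lambda>\<gamma>. kernel_deriv u \<gamma> x) (y - u))
    \<le> (real CARD('n) * R) ^ s * (C * (R powr \<delta> / norm (x - u) powr (real CARD('n) + real s + \<delta>)))"
proof -
  have R: "R > 0" using y norm_ge_zero[of "y - u"] by linarith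
  then have xu: "x \<noteq> u" using x by auto
  have "norm (mi_deriv 0 (K x) y - mi_taylor s (\<lambda>\<gamma>. mi_deriv \<gamma> (K x) u) (y - u))
      \<le> (real CARD('n) * R) ^ s * (C * (R powr \<delta> / norm (x - u) powr (real CARD('n) + real s + \<delta>)))"
  proof (rule mi_taylor_remainder[OF _ _ y])
    fix \<gamma> :: "nat ^ 'n" and i z assume "mi_order \<gamma> < s" "norm (z - u) < R"
    moreover from this have "z \<noteq> x" using x R by auto
    ultimately show "((\<lambda>t. mi_deriv \<gamma> (K x) (z + t *\<^sub>R axis i 1)) has_vector_derivative mi_deriv (\<gamma> + axis i 1) (K x) z) (at 0)"
      using partials[of x] unfolding has_partials_upto_def by auto
  next
    fix \<gamma> :: "nat ^ 'n" and z assume \<gamma>: "mi_order \<gamma> = s" and z: "norm (z - u) < R"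
    have "norm (mi_deriv \<gamma> (K x) u - mi_deriv \<gamma> (K x) z)
        \<le> C * (norm (u - z) powr \<delta> / norm (x - u) powr (real CARD('n) + real s + \<delta>))"
      using z x xu by (intro deriv_regular \<gamma>) (auto simp: norm_minus_commute)
    also have "\<dots> \<le> C * (R powr \<delta> / norm (x - u) powr (real CARD('n) + real s + \<delta>))"
      using C z delta by (intro mult_left_mono divide_right_mono powr_mono2) (auto simp: norm_minus_commute)
    finally show "norm (mi_deriv \<gamma> (K x) z - mi_deriv \<gamma> (K x) u)
        \<le> C * (R powr \<delta> / norm (x - u) powr (real CARD('n) + real s + \<delta>))"
      by (simp add: norm_minus_commute)
  qed
  then show ?thesis using xu by (simp add: kernel_deriv_def)
qed

text \<open>
  The radius is at most one so that a single bound serves all orders up to \<open>s\<close>.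
\<close>

lemma kernel_deriv_bound:
  assumes "mi_order \<gamma> \<le> s" "0 < r" "r \<le> 1" "norm (x - u) \<ge> r"
  shows "norm (kernel_deriv u \<gamma> x) \<le> C / r ^ (CARD('n) + s)"
proof -
  have "x \<noteq> u" using assms by auto
  have "norm (kernel_deriv u \<gamma> x) \<le> C / norm (x - u) ^ (CARD('n) + mi_order \<gamma>)"
    using deriv_size[OF assms(1) \<open>x \<noteq> u\<close>] \<open>x \<noteq> u\<close> by (simp add: kernel_deriv_def)
  also have "\<dots> \<le> C / r ^ (CARD('n) + mi_order \<gamma>)"
    using assms C \<open>x \<noteq> u\<close> by (intro divide_left_mono power_mono mult_pos_pos) auto
  also have "\<dots> \<le> C / r ^ (CARD('n) + s)"
    using assms C by (intro divide_left_mono power_decreasing mult_pos_pos) auto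
  finally show ?thesis .
qed

text \<open>
  The integrand of \<^const>\<open>truncated_modified_cz\<close> for the transposed kernel, in terms of \<^term>\<open>trunc\<close> and
  \<^term>\<open>kernel_deriv\<close>; the values on the diagonal and at \<open>u\<close> are thereby zero and the function is Borel.
\<close>

definition modified_integrand where
  "modified_integrand u r p \<eta> y x = (if norm (x - y) < \<eta> then 0 else
     (trunc \<eta> x y - (if x \<in> ball u r then 0 else mi_taylor s (\<lambda>\<gamma>. kernel_deriv u \<gamma> x) (y - u))) * p x)"

lemma modified_integrand_measurable:
  assumes p[measurable]: "p \<in> borel_measurable borel"
  shows "(\<lambda>(x, y). modified_integrand u r p \<eta> y x) \<in> borel_measurable (borel \<Otimes>\<^sub>M borel)"
    and "modified_integrand u r p \<eta> y \<in> borel_measurable borel"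
proof -
  have [measurable]: "ball u r \<in> sets borel" by simp
  have [measurable]: "(\<lambda>p. mi_taylor s (\<lambda>\<gamma>. kernel_deriv u \<gamma> (fst p)) (snd p - u)) \<in> borel_measurable (borel \<Otimes>\<^sub>M borel)"
  proof (rule mi_taylor_measurable)
    show "(\<lambda>w. kernel_deriv u \<gamma> (fst w)) \<in> borel_measurable (borel \<Otimes>\<^sub>M borel)" if "mi_order \<gamma> \<le> s" for \<gamma>
      by (rule measurable_compose[OF measurable_fst kernel_deriv_measurable[OF that]])
  qed measurable
  show m: "(\<lambda>(x, y). modified_integrand u r p \<eta> y x) \<in> borel_measurable (borel \<Otimes>\<^sub>M borel)"
    unfolding modified_integrand_def split_beta by measurable
  have "(\<lambda>x. (x, y)) \<in> measurable borel (borel \<Otimes>\<^sub>M borel)" by measurable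
  from measurable_compose[OF this m] show "modified_integrand u r p \<eta> y \<in> borel_measurable borel"
    by simp
qed

lemma truncated_modified_cz_eq:
  assumes \<eta>: "\<eta> > 0" and r: "r > 0" and p: "p \<in> borel_measurable borel"
  shows "truncated_modified_cz s (transpose_kernel K) u r p \<eta> y = (LINT x|lborel. modified_integrand u r p \<eta> y x)"
proof -
  have "truncated_modified_cz s (transpose_kernel K) u r p \<eta> y = (LINT x|lebesgue. modified_integrand u r p \<eta> y x)"
    unfolding truncated_modified_cz_def set_lebesgue_integral_def
  proof (intro Bochner_Integration.integral_cong refl)
    fix x
    have "(\<Sum>\<gamma> | mi_order \<gamma> \<le> s. mi_deriv1 \<gamma> (transpose_kernel K) u x / of_nat (mi_fact \<gamma>)
          * of_real (mi_power (y - u) \<gamma>) * indicator (- ball u r) x)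
        = (if x \<in> ball u r then 0 else mi_taylor s (\<lambda>\<gamma>. kernel_deriv u \<gamma> x) (y - u))"
    proof (cases "x \<in> ball u r")
      case False
      then have "x \<noteq> u" using r by auto
      with False show ?thesis
        by (simp add: mi_taylor_def kernel_deriv_def mi_deriv1_def transpose_kernel_def)
    qed simp
    moreover have "trunc \<eta> x y = K x y" if "\<not> norm (x - y) < \<eta>"
      using that \<eta> by (auto simp: trunc_def)
    ultimately show "indicator (- ball y \<eta>) x *\<^sub>R ((transpose_kernel K y x
        - (\<Sum>\<gamma> | mi_order \<gamma> \<le> s. mi_deriv1 \<gamma> (transpose_kernel K) u x / of_nat (mi_fact \<gamma>)
          * of_real (mi_power (y - u) \<gamma>) * indicator (- ball u r) x)) * p x) = modified_integrand u r p \<eta> y x"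
      by (auto simp: modified_integrand_def transpose_kernel_def indicator_def dist_norm norm_minus_commute)
  qed
  also have "\<dots> = (LINT x|lborel. modified_integrand u r p \<eta> y x)"
    using modified_integrand_measurable(2)[OF p] by (intro integral_completion) simp
  finally show ?thesis .
qed

lemma mi_taylor_kernel_measurable [measurable (raw)]:
  assumes [measurable]: "f \<in> borel_measurable N" "g \<in> borel_measurable N"
  shows "(\<lambda>w. mi_taylor s (\<lambda>\<gamma>. kernel_deriv u \<gamma> (f w)) (g w - u)) \<in> borel_measurable N"
proof (rule mi_taylor_measurable)
  show "(\<lambda>w. kernel_deriv u \<gamma> (f w)) \<in> borel_measurable N" if "mi_order \<gamma> \<le> s" for \<gamma>
    by (rule measurable_compose[OF assms(1) kernel_deriv_measurable[OF that]])
qed measurable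

text \<open>
  Beyond the ball the remainder has order \<open>-n - s - \<delta>\<close> in \<open>x\<close>, and the monomial costs at most \<open>s\<close> powers,
  which leaves an integrable majorant independent of \<open>y\<close>.
\<close>

lemma far_part_bound:
  assumes R: "R \<ge> 1" and \<nu>: "mi_order \<nu> \<le> s"
  obtains W where "integrable lborel W"
    "\<And>x y. norm (x - u) \<ge> 2 * R + norm u \<Longrightarrow> norm (y - u) < R \<Longrightarrow>
      norm ((K x y - mi_taylor s (\<lambda>\<gamma>. kernel_deriv u \<gamma> x) (y - u)) * of_real (mi_power x \<nu>)) \<le> W x"
    "\<And>x. 0 \<le> W x"
proof -
  let ?e = "real CARD('n) + \<delta>"
  define c where "c = (real CARD('n) * R) ^ s * (C * R powr \<delta>) * 2 ^ s"
  have c0: "c \<ge> 0" unfolding c_def using R C by auto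
  define W where "W x = c * (if norm (x - u) \<ge> 1 then 1 / norm (x - u) powr ?e else 0)" for x
  obtain A where A: "A > 0" "\<And>\<eta>. \<eta> > 0 \<Longrightarrow>
      (\<integral>\<^sup>+(x::real^'n). ennreal (if norm x \<ge> \<eta> then 1 / norm x powr (real DIM(real^'n) + \<delta>) else 0) \<partial>lborel) \<le> ennreal (A * \<eta> powr (-\<delta>))"
    by (rule nn_integral_power_tail[where 'b = "real ^ 'n", OF delta]) (rule that)
  have "integrable lborel (\<lambda>x. if norm (x - u) \<ge> 1 then 1 / norm (x - u) powr ?e else 0)"
  proof (rule integrableI_nonneg)
    have "(\<integral>\<^sup>+x. ennreal (if norm (x - u) \<ge> 1 then 1 / norm (x - u) powr ?e else 0) \<partial>lborel)
        = (\<integral>\<^sup>+(x::real^'n). ennreal (if norm x \<ge> 1 then 1 / norm x powr ?e else 0) \<partial>lborel)"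
      by (rule nn_integral_lborel_shift[of "\<lambda>x. ennreal (if norm x \<ge> 1 then 1 / norm x powr ?e else 0)"]) measurable
    also have "\<dots> \<le> ennreal (A * 1 powr (-\<delta>))"
      using A(2)[of 1] unfolding DIM_cart DIM_real mult_1_right by simp
    finally show "(\<integral>\<^sup>+x. ennreal (if norm (x - u) \<ge> 1 then 1 / norm (x - u) powr ?e else 0) \<partial>lborel) < \<infinity>"
      by (rule order.strict_trans1) simp
  qed auto
  then have W: "integrable lborel W"
    unfolding W_def by (rule integrable_mult_right)
  have "norm ((K x y - mi_taylor s (\<lambda>\<gamma>. kernel_deriv u \<gamma> x) (y - u)) * of_real (mi_power x \<nu>)) \<le> W x"
    if x: "norm (x - u) \<ge> 2 * R + norm u" and y: "norm (y - u) < R" for x y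
  proof -
    define t where "t = norm (x - u)"
    have t: "t \<ge> 1" "t \<ge> 2 * R" "t > 0" using x R norm_ge_zero[of u] unfolding t_def by linarith+
    have "norm x \<le> 2 * t"
      using norm_triangle_ineq[of "x - u" u] x R unfolding t_def by simp
    then have "\<bar>mi_power x \<nu>\<bar> \<le> (2 * t) ^ mi_order \<nu>"
      by (intro order_trans[OF abs_mi_power_le] power_mono) auto
    also have "\<dots> \<le> (2 * t) ^ s" using t \<nu> by (intro power_increasing) auto
    finally have p: "\<bar>mi_power x \<nu>\<bar> \<le> (2 * t) ^ s" .
    have "norm (K x y - mi_taylor s (\<lambda>\<gamma>. kernel_deriv u \<gamma> x) (y - u))
        \<le> (real CARD('n) * R) ^ s * (C * (R powr \<delta> / t powr (real CARD('n) + real s + \<delta>)))"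
      unfolding t_def by (rule kernel_taylor_remainder[OF y]) (use t in \<open>simp add: t_def\<close>)
    then have "norm ((K x y - mi_taylor s (\<lambda>\<gamma>. kernel_deriv u \<gamma> x) (y - u)) * of_real (mi_power x \<nu>))
        \<le> (real CARD('n) * R) ^ s * (C * (R powr \<delta> / t powr (real CARD('n) + real s + \<delta>))) * (2 * t) ^ s"
      unfolding norm_mult norm_of_real using p R C t by (intro mult_mono) auto
    also have "t powr (real CARD('n) + real s + \<delta>) = t ^ s * t powr ?e"
      using t by (simp add: powr_add powr_realpow mult_ac)
    also have "(real CARD('n) * R) ^ s * (C * (R powr \<delta> / (t ^ s * t powr ?e))) * (2 * t) ^ s = W x"
      using t by (simp add: W_def c_def t_def[symmetric] power_mult_distrib field_simps)
    finally show ?thesis .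
  qed
  then show thesis
    using that[OF W] c0 by (simp add: W_def)
qed

end

context borel_cz_operator begin

section \<open>The adjoint identity\<close>

text \<open>
  For \<open>y\<close> in the support of \<open>f\<close> the modified integral splits into three parts: the transposed truncation
  of \<open>\<phi>\<close>, the monomial cut off to the large ball \<open>B\<close>; a polynomial in \<open>y\<close>, from the Taylor terms between
  the two balls; and an absolutely convergent integral \<open>F\<close> over the complement of \<open>B\<close>. The first
  gives the pairing of \<open>T f\<close> with the monomial on \<open>B\<close>, the second pairs to zero with \<open>f\<close>, and the
  third gives, by Fubini, the pairing outside \<open>B\<close>. The integrability of \<open>G f\<close> is stated for
  every \<open>f\<close>, so that \<open>f \<mapsto> \<integral> G f\<close> is a linear functional on all of \<^const>\<open>bounded_L2\<close>.
\<close>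

lemma adjoint_identity:
  fixes u :: "real ^ 'n" and \<nu> :: "nat ^ 'n"
  defines "p \<equiv> \<lambda>x. of_real (mi_power x \<nu>) :: 'a"
  assumes r: "r > 0" and \<nu>: "mi_order \<nu> \<le> s" and f: "f \<in> bounded_L2"
    and G[measurable]: "G \<in> borel_measurable borel"
    and lim: "AE y in lborel. (\<lambda>k. LINT x|lborel. modified_integrand u r p (inverse (real (Suc k))) y x) \<longlonglongrightarrow> G y"
  shows "integrable lborel (\<lambda>y. G y * f y)"
    and "(\<And>\<gamma>. mi_order \<gamma> \<le> s \<Longrightarrow> (LINT y|lborel. f y * of_real (mi_power y \<gamma>)) = 0) \<Longrightarrow>
      (LINT x|lborel. T f x * p x) = (LINT y|lborel. G y * f y)"
proof -
  note [measurable] = bounded_L2_measurable[OF f] T_measurable[OF f]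
  have p[measurable]: "p \<in> borel_measurable borel" unfolding p_def by measurable
  obtain R0 where R0: "\<And>y. R0 < norm y \<Longrightarrow> f y = 0" using f by (auto simp: bounded_L2_def)
  define R where "R = max R0 0 + norm u + 1"
  have R: "R \<ge> 1" unfolding R_def by simp
  have fR: "norm (y - u) < R" if "f y \<noteq> 0" for y
    using R0[of y] that norm_triangle_ineq4[of y u] unfolding R_def by (cases "R0 < norm y") auto
  \<comment> \<open>The factor \<open>2\<close> is the separation in the Taylor estimate, \<open>norm u\<close> makes powers of \<open>x\<close> comparable to powers of \<open>x - u\<close>, and \<open>r\<close> places the ball of the definition inside \<open>B\<close>.\<close>
  define \<rho> where "\<rho> = 2 * R + norm u + r"
  define B where "B = ball u \<rho>"
  have B[measurable]: "B \<in> sets borel" "ball u r \<in> sets borel" unfolding B_def by simp_all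
  have outB: "norm (x - u) \<ge> 2 * R + norm u" "x \<notin> ball u r" if "x \<notin> B" for x
  proof -
    have "norm (x - u) \<ge> 2 * R + norm u + r"
      using that unfolding B_def \<rho>_def by (simp add: dist_norm norm_minus_commute)
    then show "norm (x - u) \<ge> 2 * R + norm u" "x \<notin> ball u r"
      using r R norm_ge_zero[of u] by (auto simp: dist_norm norm_minus_commute simp del: norm_ge_zero)
  qed
  define tay where "tay x y = mi_taylor s (\<lambda>\<gamma>. kernel_deriv u \<gamma> x) (y - u)" for x y
  have tay_m[measurable (raw)]: "(\<lambda>w. tay (a w) (b w)) \<in> borel_measurable N"
    if [measurable]: "a \<in> borel_measurable N" "b \<in> borel_measurable N" for a b and N :: "'b measure"
    unfolding tay_def by measurable
  obtain W where W: "integrable lborel W" "\<And>x. 0 \<le> W x"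
    "\<And>x y. norm (x - u) \<ge> 2 * R + norm u \<Longrightarrow> norm (y - u) < R \<Longrightarrow> norm ((K x y - tay x y) * p x) \<le> W x"
    using far_part_bound[OF R \<nu>, of u] unfolding tay_def p_def by metis
  define \<phi> where "\<phi> x = (if x \<in> B then p x else 0)" for x
  have inB: "norm x \<le> \<rho> + norm u" if "x \<in> B" for x
    using that norm_triangle_ineq[of "x - u" u] by (auto simp: B_def dist_norm norm_minus_commute)
  have pB: "norm (p x) \<le> (\<rho> + norm u) ^ mi_order \<nu>" if "x \<in> B" for x
    unfolding p_def norm_of_real using inB[OF that]
    by (intro order_trans[OF abs_mi_power_le] power_mono) auto
  have cutB: "(\<lambda>x. if x \<in> B \<and> x \<notin> ball u r then h x * p x else 0) \<in> bounded_L2"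
    if [measurable]: "h \<in> borel_measurable borel" and h: "\<And>x. x \<notin> ball u r \<Longrightarrow> norm (h x) \<le> b" for h :: "real ^ 'n \<Rightarrow> 'a" and b
  proof (rule bounded_L2_of_bounded)
    show "norm (if x \<in> B \<and> x \<notin> ball u r then h x * p x else 0) \<le> max 0 (b * (\<rho> + norm u) ^ mi_order \<nu>)" for x
      using mult_mono[OF h pB, of x x] order_trans[OF norm_ge_zero h[of x]] by (auto simp: norm_mult)
    show "(if x \<in> B \<and> x \<notin> ball u r then h x * p x else 0) = 0" if "\<rho> + norm u < norm x" for x
      using inB[of x] that by auto
  qed measurable
  have \<phi>: "\<phi> \<in> bounded_L2"
  proof (rule bounded_L2_of_bounded)
    show "\<phi> \<in> borel_measurable borel" unfolding \<phi>_def by measurable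
    show "norm (\<phi> x) \<le> max 0 ((\<rho> + norm u) ^ mi_order \<nu>)" for x
      using pB[of x] by (auto simp: \<phi>_def)
    show "\<phi> x = 0" if "\<rho> + norm u < norm x" for x
      using inB[of x] that by (auto simp: \<phi>_def)
  qed
  define b where "b = C / (min r 1) ^ (CARD('n) + s)"
  have kb: "norm (kernel_deriv u \<gamma> x) \<le> b" if "x \<notin> ball u r" "mi_order \<gamma> \<le> s" for \<gamma> x
    unfolding b_def using that r by (intro kernel_deriv_bound) (auto simp: dist_norm norm_minus_commute)
  have tb: "norm (tay x y) \<le> real (card {\<gamma> :: nat ^ 'n. mi_order \<gamma> \<le> s}) * (b * R ^ s)"
    if "x \<notin> ball u r" "norm (y - u) < R" for x y
    unfolding tay_def using kb that R by (intro norm_mi_taylor_le) auto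
  define q where "q \<gamma> = (LINT x|lborel. (if x \<in> B \<and> x \<notin> ball u r then kernel_deriv u \<gamma> x * p x else 0))" for \<gamma>
  define mid where "mid y x = (if x \<in> B \<and> x \<notin> ball u r then tay x y * p x else 0)" for y x
  have midm[measurable]: "mid y \<in> borel_measurable borel" for y
    unfolding mid_def by measurable
  have mid: "integrable lborel (mid y)" if "norm (y - u) < R" for y
    unfolding mid_def[abs_def] by (rule bounded_L2_integrable[OF cutB[OF _ tb[OF _ that]]]) auto
  have midq: "(LINT x|lborel. mid y x) = mi_taylor s q (y - u)" for y
  proof -
    have mq: "mid y x = (\<Sum>\<gamma> | mi_order \<gamma> \<le> s. (of_real (mi_power (y - u) \<gamma>) / of_nat (mi_fact \<gamma>)) *
        (if x \<in> B \<and> x \<notin> ball u r then kernel_deriv u \<gamma> x * p x else 0))" for x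
    proof (cases "x \<in> B \<and> x \<notin> ball u r")
      case True
      then show ?thesis
        unfolding mid_def tay_def mi_taylor_def sum_distrib_right if_P[OF True]
        by (intro sum.cong) simp_all
    next
      case False
      then show ?thesis unfolding mid_def if_not_P[OF False] by simp
    qed
    have "integrable lborel (\<lambda>x. if x \<in> B \<and> x \<notin> ball u r then kernel_deriv u \<gamma> x * p x else 0)"
      if "mi_order \<gamma> \<le> s" for \<gamma>
      using bounded_L2_integrable[OF cutB[OF kernel_deriv_measurable[OF that] kb[OF _ that]]] by simp
    then show ?thesis
      unfolding mq by (subst Bochner_Integration.integral_sum) (auto simp: mi_taylor_def q_def mult_ac intro!: sum.cong)
  qed
  define far where "far y x = (if x \<in> B then 0 else (trunc R x y - tay x y) * p x)" for y x
  have farm[measurable]: "far y \<in> borel_measurable borel" for y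
    unfolding far_def by measurable
  have far_trunc: "trunc \<eta> x y = K x y" "\<not> norm (x - y) < \<eta>"
    if "x \<notin> B" "norm (y - u) < R" "\<eta> \<le> R" for x y \<eta>
  proof -
    have "norm (x - y) \<ge> R"
      using outB(1)[OF that(1)] that(2) norm_triangle_ineq[of "x - y" "y - u"] norm_ge_zero[of u]
      by (simp del: norm_ge_zero)
    then show "\<not> norm (x - y) < \<eta>" using that(3) by simp
    moreover have "x \<noteq> y" using \<open>norm (x - y) \<ge> R\<close> R by auto
    ultimately show "trunc \<eta> x y = K x y" by (simp add: trunc_def)
  qed
  have far_bound: "norm (far y x) \<le> W x" if "norm (y - u) < R" for x y
    using W(2)[of x] W(3)[OF outB(1) that, of x] far_trunc(1)[OF _ that order_refl, of x] by (auto simp: far_def)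
  have far: "integrable lborel (far y)" if "norm (y - u) < R" for y
    by (rule integrable_dominated[OF _ W(1) far_bound[OF that]]) measurable
  define F where "F y = (LINT x|lborel. far y x)" for y
  have [measurable]: "F \<in> borel_measurable borel"
    unfolding F_def far_def by measurable
  let ?e = "\<lambda>k. inverse (real (Suc k))"
  have e: "?e k > 0" "?e k \<le> 1" for k by (auto simp: field_simps)
  \<comment> \<open>Outside \<open>B\<close> the points \<open>x\<close> and \<open>y\<close> are at least \<open>R\<close> apart, so truncating at a level below \<open>R\<close> leaves the kernel unchanged.\<close>
  have dec: "(LINT x|lborel. modified_integrand u r p (?e k) y x)
      = op_trunc_transpose (?e k) \<phi> y - (LINT x|lborel. (if norm (x - y) < ?e k then 0 else mid y x)) + F y"
    if y: "norm (y - u) < R" for k y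
  proof -
    have "modified_integrand u r p (?e k) y x = trunc (?e k) x y * \<phi> x - (if norm (x - y) < ?e k then 0 else mid y x) + far y x" for x
    proof (cases "x \<in> B")
      case True
      then show ?thesis
        by (auto simp: modified_integrand_def \<phi>_def mid_def far_def tay_def trunc_def algebra_simps)
    next
      case False
      then show ?thesis
        using far_trunc[OF False y] outB(2)[OF False] R e(2)[of k]
        by (simp add: modified_integrand_def \<phi>_def mid_def far_def tay_def order_trans[OF e(2) R])
    qed
    moreover have "integrable lborel (\<lambda>x. if norm (x - y) < ?e k then 0 else mid y x)"
      by (rule Bochner_Integration.integrable_bound[OF mid[OF y]]) auto
    ultimately show ?thesis
      using trunc_integrable(2)[OF \<phi> e(1)] far[OF y] by (simp add: op_trunc_transpose_def F_def)
  qed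
  have midlim: "(\<lambda>k. LINT x|lborel. (if norm (x - y) < ?e k then 0 else mid y x)) \<longlonglongrightarrow> mi_taylor s q (y - u)"
    if y: "norm (y - u) < R" for y
    unfolding midq[symmetric]
  proof (rule integral_dominated_convergence[where w = "\<lambda>x. norm (mid y x)"])
    show "AE x in lborel. (\<lambda>k. if norm (x - y) < ?e k then 0 else mid y x) \<longlonglongrightarrow> mid y x"
      using AE_lborel_singleton[of y]
    proof eventually_elim
      case (elim x)
      have "\<forall>\<^sub>F k in sequentially. ?e k < norm (x - y)"
        using elim by (intro order_tendstoD(2)[OF LIMSEQ_inverse_real_of_nat]) simp
      then have "\<forall>\<^sub>F k in sequentially. (if norm (x - y) < ?e k then 0 else mid y x) = mid y x"
        by eventually_elim simp
      then show ?case by (rule tendsto_eventually)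
    qed
  qed (use mid[OF y] in \<open>auto intro!: AE_I2\<close>)
  define H where "H y = G y + mi_taylor s q (y - u) - F y" for y
  have Hm[measurable]: "H \<in> borel_measurable borel"
    unfolding H_def by measurable
  have "AE y in lborel. f y \<noteq> 0 \<longrightarrow> (\<lambda>k. op_trunc_transpose (?e k) \<phi> y) \<longlonglongrightarrow> H y"
    using lim
  proof eventually_elim
    case (elim y)
    show ?case
    proof
      assume "f y \<noteq> 0"
      then have y: "norm (y - u) < R" by (rule fR)
      have "(\<lambda>k. (LINT x|lborel. modified_integrand u r p (?e k) y x)
          + (LINT x|lborel. (if norm (x - y) < ?e k then 0 else mid y x)) - F y) \<longlonglongrightarrow> H y"
        unfolding H_def by (intro tendsto_intros elim midlim y)
      then show "(\<lambda>k. op_trunc_transpose (?e k) \<phi> y) \<longlonglongrightarrow> H y"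
        unfolding dec[OF y] by simp
    qed
  qed
  note near = pairing_eq_transpose_limit[OF f \<phi> Hm this]
  have Z: "integrable (lborel \<Otimes>\<^sub>M lborel) (\<lambda>(x, y). far y x * f y)"
  proof (rule integrable_dominated)
    show "(\<lambda>(x, y). far y x * f y) \<in> borel_measurable (lborel \<Otimes>\<^sub>M lborel)"
      unfolding far_def by measurable
    show "integrable (lborel \<Otimes>\<^sub>M lborel) (\<lambda>(x, y). W x * norm (f y))"
    proof (rule lborel_pair.Fubini_integrable)
      show "(\<lambda>(x, y). W x * norm (f y)) \<in> borel_measurable (lborel \<Otimes>\<^sub>M lborel)"
        using borel_measurable_integrable[OF W(1)] by measurable
      have "(\<lambda>x. LINT y|lborel. norm (W x * norm (f y))) = (\<lambda>x. W x * (LINT y|lborel. norm (f y)))"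
        using W(2) by (simp add: abs_mult)
      then show "integrable lborel (\<lambda>x. LINT y|lborel. norm (case (x, y) of (x, y) \<Rightarrow> W x * norm (f y)))"
        using W(1) by simp
    qed (use bounded_L2_integrable[OF f] in simp_all)
    fix z :: "(real ^ 'n) \<times> (real ^ 'n)"
    show "norm (case z of (x, y) \<Rightarrow> far y x * f y) \<le> (case z of (x, y) \<Rightarrow> W x * norm (f y))"
    proof (cases "f (snd z) = 0")
      case False
      then show ?thesis
        using far_bound[OF fR[OF False], of "fst z"] by (simp add: split_beta norm_mult mult_right_mono)
    qed (simp add: split_beta)
  qed
  have Zy: "(LINT x|lborel. far y x * f y) = F y * f y" for y
    unfolding F_def using far[OF fR, of y] by (cases "f y = 0") auto
  have Fi: "integrable lborel (\<lambda>y. F y * f y)"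
    using lborel_pair.integrable_snd[OF Z] by (simp only: Zy)
  have Gf: "G y * f y = H y * f y - mi_taylor s q (y - u) * f y + F y * f y" for y
    by (simp add: H_def algebra_simps)
  show "integrable lborel (\<lambda>y. G y * f y)"
    unfolding Gf using near(3) bounded_L2_mi_taylor(1)[OF f] Fi by simp
  show "(LINT x|lborel. T f x * p x) = (LINT y|lborel. G y * f y)"
    if mom: "\<And>\<gamma>. mi_order \<gamma> \<le> s \<Longrightarrow> (LINT y|lborel. f y * of_real (mi_power y \<gamma>)) = 0"
  proof -
    have Zx: "AE x in lborel. (LINT y|lborel. far y x * f y) = (if x \<in> B then 0 else T f x * p x)"
      using T_off_support[OF f]
    proof eventually_elim
      case (elim x)
      show ?case
      proof (cases "x \<in> B")
        case True
        then show ?thesis by (simp add: far_def)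
      next
        case False
        have "\<forall>y. norm (x - y) < R \<longrightarrow> f y = 0"
          using far_trunc(2)[OF False fR order_refl] by blast
        then have T: "T f x = op_trunc R f x" using elim R by auto
        have "(LINT y|lborel. far y x * f y) = (LINT y|lborel. (trunc R x y * f y) * p x - (tay x y * f y) * p x)"
          using False by (simp add: far_def algebra_simps)
        also have "\<dots> = (LINT y|lborel. (trunc R x y * f y) * p x) - (LINT y|lborel. (tay x y * f y) * p x)"
          using trunc_integrable(1)[OF f, of R x] R bounded_L2_mi_taylor(1)[OF f]
          by (intro Bochner_Integration.integral_diff) (auto simp: tay_def)
        also have "\<dots> = op_trunc R f x * p x"
          using bounded_L2_mi_taylor(2)[OF f mom] by (simp add: op_trunc_def tay_def)
        finally show ?thesis using False T by simp
      qed
    qed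
    have FfT: "(LINT y|lborel. F y * f y) = (LINT x|lborel. (if x \<in> B then 0 else T f x * p x))"
    proof -
      have "(LINT y|lborel. F y * f y) = (LINT x|lborel. LINT y|lborel. far y x * f y)"
        using lborel_pair.Fubini_integral[OF Z] by (simp only: Zy)
      also have "\<dots> = (LINT x|lborel. (if x \<in> B then 0 else T f x * p x))"
      proof (rule integral_cong_AE)
        show "(\<lambda>x. LINT y|lborel. far y x * f y) \<in> borel_measurable lborel"
          unfolding far_def by measurable
      qed (use Zx in measurable)
      finally show ?thesis .
    qed
    have Tfar: "integrable lborel (\<lambda>x. if x \<in> B then 0 else T f x * p x)"
    proof (rule integrable_cong_AE_imp[OF lborel_pair.integrable_fst'[OF Z]])
      show "AE x in lborel. (LINT y|lborel. (case (x, y) of (x, y) \<Rightarrow> far y x * f y)) = (if x \<in> B then 0 else T f x * p x)"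
        using Zx by (simp only: prod.case)
    qed measurable
    have "(LINT x|lborel. T f x * p x) = (LINT x|lborel. T f x * \<phi> x + (if x \<in> B then 0 else T f x * p x))"
      by (intro Bochner_Integration.integral_cong) (simp_all add: \<phi>_def)
    also have "\<dots> = (LINT x|lborel. T f x * \<phi> x) + (LINT x|lborel. (if x \<in> B then 0 else T f x * p x))"
      by (intro Bochner_Integration.integral_add near(2) Tfar)
    also have "\<dots> = (LINT y|lborel. H y * f y) + (LINT y|lborel. F y * f y)"
      by (simp only: near(1) FfT)
    also have "\<dots> = (LINT y|lborel. G y * f y)"
      unfolding Gf using near(3) bounded_L2_mi_taylor(1)[OF f] bounded_L2_mi_taylor(2)[OF f mom] Fi by simp
    finally show ?thesis .
  qed
qed

end

section \<open>Borel representatives\<close>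

lemma L2_AE_zero_of_norm:
  assumes f: "f \<in> L2" and "L2_norm f \<le> 0"
  shows "AE x in lebesgue. f x = 0"
proof -
  have i: "integrable lebesgue (\<lambda>x. (norm (f x))\<^sup>2)" using f by (simp add: L2_def)
  have "0 \<le> (LINT x|lebesgue. (norm (f x))\<^sup>2)" by (intro integral_nonneg_AE) auto
  with assms(2) have "(LINT x|lebesgue. (norm (f x))\<^sup>2) = 0"
    by (simp add: L2_norm_def)
  then have "AE x in lebesgue. (norm (f x))\<^sup>2 = 0"
    using integral_nonneg_eq_0_iff_AE[OF i] by simp
  then show ?thesis by simp
qed

text \<open>
  The difference of the two functions has norm zero, hence so has its image, and additivity applies.
\<close>

lemma bounded_linear_L2_cong_AE:
  fixes T :: "(real ^ 'n \<Rightarrow> 'a :: {real_normed_field, euclidean_space}) \<Rightarrow> real ^ 'n \<Rightarrow> 'a"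
  assumes T: "bounded_linear_L2 T" and f: "f \<in> L2" and g: "g \<in> L2"
    and eq: "AE x in lebesgue. f x = g x"
  shows "AE x in lebesgue. T f x = T g x"
proof -
  define n where "n x = f x - g x" for x
  have n0: "AE x in lebesgue. n x = 0" using eq by eventually_elim (simp add: n_def)
  have [measurable]: "n \<in> borel_measurable lebesgue"
    using f g unfolding n_def L2_def by (auto intro: borel_measurable_diff)
  have sq: "AE x in lebesgue. 0 = (norm (n x))\<^sup>2" using n0 by eventually_elim simp
  have "integrable lebesgue (\<lambda>x. (norm (n x))\<^sup>2)"
    by (rule integrable_cong_AE_imp[OF integrable_zero _ sq]) measurable
  then have n: "n \<in> L2" by (simp add: L2_def)
  have "(LINT x|lebesgue. (norm (n x))\<^sup>2) = (LINT x|(lebesgue :: (real ^ 'n) measure). 0)"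
    using sq by (intro integral_cong_AE) (auto elim: eventually_mono)
  then have "L2_norm n = 0" by (simp add: L2_norm_def)
  then have "L2_norm (T n) \<le> 0"
    using T n unfolding bounded_linear_L2_def by (metis mult_zero_right)
  moreover have "T n \<in> L2" using T n unfolding bounded_linear_L2_def by blast
  ultimately have "AE x in lebesgue. T n x = 0" by (intro L2_AE_zero_of_norm)
  moreover have "AE x in lebesgue. T (\<lambda>x. g x + n x) x = T g x + T n x"
    using T g n unfolding bounded_linear_L2_def by blast
  then have "AE x in lebesgue. T f x = T g x + T n x" by (simp add: n_def)
  ultimately show ?thesis by eventually_elim simp
qed

definition borel_version :: "('b :: euclidean_space \<Rightarrow> 'c :: euclidean_space) \<Rightarrow> 'b \<Rightarrow> 'c" where
  "borel_version f = (SOME g. g \<in> borel_measurable borel \<and> (AE x in lborel. f x = g x))"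

lemma borel_version:
  assumes "f \<in> borel_measurable lebesgue"
  shows "borel_version f \<in> borel_measurable borel" "AE x in lborel. f x = borel_version f x"
proof -
  have "\<exists>g. g \<in> borel_measurable borel \<and> (AE x in lborel. f x = g x)"
    using lebesgue_measurable_borel_version[OF assms] by metis
  from someI_ex[OF this]
  show "borel_version f \<in> borel_measurable borel" "AE x in lborel. f x = borel_version f x"
    by (simp_all add: borel_version_def)
qed

lemma borel_cz_operator_borel_version:
  fixes K :: "real ^ 'n \<Rightarrow> real ^ 'n \<Rightarrow> 'a :: {real_normed_field, euclidean_space}"
  assumes K: "kernel_bounds K s C \<delta>" and cz: "cz_operator K T"
  obtains M where "borel_cz_operator K s C \<delta> (\<lambda>f. borel_version (T f)) M"
proof -
  interpret kernel_bounds K s C \<delta> by (rule K)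
  have T: "bounded_linear_L2 T"
    and lim: "\<And>f. f \<in> L2 \<Longrightarrow> AE x in lebesgue.
        ((\<lambda>\<eta>. LINT y : - ball x \<eta> | lebesgue. K x y * f y) \<longlongrightarrow> T f x) (at_right 0)"
    using cz by (auto simp: cz_operator_def)
  obtain D where D: "\<And>f. f \<in> L2 \<Longrightarrow> L2_norm (T f) \<le> D * L2_norm f"
    using T unfolding bounded_linear_L2_def by blast
  have TL: "T f \<in> L2" if "f \<in> L2" for f using T that by (auto simp: bounded_linear_L2_def)
  have Tm: "T f \<in> borel_measurable lebesgue" if "f \<in> bounded_L2" for f
    using TL[OF bounded_L2_in_L2[OF that]] by (simp add: L2_def)
  have nnL2: "(\<integral>\<^sup>+x. ennreal ((norm (f x))\<^sup>2) \<partial>lborel) = ennreal ((L2_norm f)\<^sup>2)" if "f \<in> L2" for f :: "real ^ 'n \<Rightarrow> 'a"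
  proof -
    have "0 \<le> (LINT x|lebesgue. (norm (f x))\<^sup>2)" by (intro integral_nonneg_AE) auto
    then have "(L2_norm f)\<^sup>2 = (LINT x|lebesgue. (norm (f x))\<^sup>2)" by (simp add: L2_norm_def)
    moreover have "(\<integral>\<^sup>+x. ennreal ((norm (f x))\<^sup>2) \<partial>lebesgue) = ennreal (LINT x|lebesgue. (norm (f x))\<^sup>2)"
      using that by (intro nn_integral_eq_integral) (auto simp: L2_def)
    ultimately show ?thesis by (simp add: nn_integral_completion)
  qed
  have "borel_cz_operator K s C \<delta> (\<lambda>f. borel_version (T f)) (D\<^sup>2)"
  proof
    fix f :: "real ^ 'n \<Rightarrow> 'a" assume f: "f \<in> bounded_L2"
    note ae = borel_version(2)[OF Tm[OF f]]
    note fL = bounded_L2_in_L2[OF f]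
    show "borel_version (T f) \<in> borel_measurable borel" by (rule borel_version(1)[OF Tm[OF f]])
    show "AE x in lborel. ((\<lambda>\<eta>. op_trunc \<eta> f x) \<longlongrightarrow> borel_version (T f) x) (at_right 0)"
      using lim[OF fL, unfolded AE_completion_iff] ae
    proof eventually_elim
      case (elim x)
      have "\<forall>\<^sub>F \<eta> in at_right 0. (LINT y : - ball x \<eta> | lebesgue. K x y * f y) = op_trunc \<eta> f x"
        using eventually_at_right_less[of "0::real"]
      proof eventually_elim
        fix \<eta> :: real assume \<eta>: "0 < \<eta>"
        note [measurable] = bounded_L2_measurable[OF f]
        have "(LINT y : - ball x \<eta> | lebesgue. K x y * f y) = (LINT y|lebesgue. trunc \<eta> x y * f y)"
          unfolding set_lebesgue_integral_def using \<eta>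
          by (intro Bochner_Integration.integral_cong) (auto simp: trunc_def indicator_def dist_norm)
        also have "\<dots> = op_trunc \<eta> f x"
          unfolding op_trunc_def by (intro integral_completion) measurable
        finally show "(LINT y : - ball x \<eta> | lebesgue. K x y * f y) = op_trunc \<eta> f x" .
      qed
      from tendsto_cong[OF this] show ?case using elim by simp
    qed
    have "(\<integral>\<^sup>+x. ennreal ((norm (borel_version (T f) x))\<^sup>2) \<partial>lborel) = (\<integral>\<^sup>+x. ennreal ((norm (T f x))\<^sup>2) \<partial>lborel)"
      using ae by (intro nn_integral_cong_AE) (auto elim: eventually_mono)
    also have "\<dots> = ennreal ((L2_norm (T f))\<^sup>2)" by (rule nnL2[OF TL[OF fL]])
    also have "\<dots> \<le> ennreal ((D * L2_norm f)\<^sup>2)"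
    proof (intro ennreal_leI power_mono D fL)
      show "0 \<le> L2_norm (T f)"
        unfolding L2_norm_def by (intro real_sqrt_ge_zero integral_nonneg_AE) auto
    qed
    also have "\<dots> = ennreal (D\<^sup>2) * (\<integral>\<^sup>+x. ennreal ((norm (f x))\<^sup>2) \<partial>lborel)"
      by (simp add: nnL2[OF fL] power_mult_distrib ennreal_mult)
    finally show "(\<integral>\<^sup>+x. ennreal ((norm (borel_version (T f) x))\<^sup>2) \<partial>lborel) \<le> ennreal (D\<^sup>2) * (\<integral>\<^sup>+x. ennreal ((norm (f x))\<^sup>2) \<partial>lborel)" .
  next
    fix f g :: "real ^ 'n \<Rightarrow> 'a" assume f: "f \<in> bounded_L2" and g: "g \<in> bounded_L2"
    have "AE x in lebesgue. T (\<lambda>x. f x + g x) x = T f x + T g x"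
      using T bounded_L2_in_L2[OF f] bounded_L2_in_L2[OF g] by (simp add: bounded_linear_L2_def)
    then have "AE x in lborel. T (\<lambda>x. f x + g x) x = T f x + T g x"
      unfolding AE_completion_iff .
    moreover have "(\<lambda>x. f x + g x) \<in> bounded_L2" using bounded_L2_combine[OF f g, of 1] by simp
    note borel_version(2)[OF Tm[OF this]]
    ultimately show "AE x in lborel. borel_version (T (\<lambda>x. f x + g x)) x = borel_version (T f) x + borel_version (T g) x"
      using borel_version(2)[OF Tm[OF f]] borel_version(2)[OF Tm[OF g]]
      by eventually_elim simp
  qed simp
  then show thesis using that by blast
qed

lemma bounded_L2_representative:
  fixes a :: "real ^ 'n \<Rightarrow> 'a :: {real_normed_field, euclidean_space}"
  assumes a: "a \<in> L2" and cpt: "compact (closure {x. a x \<noteq> 0})"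
  obtains f where "f \<in> bounded_L2" "AE x in lborel. a x = f x"
proof -
  have "bounded {x. a x \<noteq> 0}"
    using compact_imp_bounded[OF cpt] closure_subset by (rule bounded_subset)
  then obtain R where R: "\<And>x. a x \<noteq> 0 \<Longrightarrow> norm x \<le> R" by (auto simp: bounded_iff)
  have am: "a \<in> borel_measurable lebesgue" using a by (simp add: L2_def)
  note bv[measurable] = borel_version(1)[OF am]
  define f where "f x = (if norm x \<le> R then borel_version a x else 0)" for x
  have fm[measurable]: "f \<in> borel_measurable borel" unfolding f_def by measurable
  have ae: "AE x in lborel. a x = f x"
    using borel_version(2)[OF am] by eventually_elim (use R in \<open>force simp: f_def\<close>)
  have "integrable lebesgue (\<lambda>x. (norm (f x))\<^sup>2)"
  proof (rule integrable_cong_AE_imp)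
    show "integrable lebesgue (\<lambda>x. (norm (a x))\<^sup>2)" using a by (simp add: L2_def)
    show "(\<lambda>x. (norm (f x))\<^sup>2) \<in> borel_measurable lebesgue"
      by (intro measurable_completion) measurable
    show "AE x in lebesgue. (norm (a x))\<^sup>2 = (norm (f x))\<^sup>2"
      unfolding AE_completion_iff using ae by eventually_elim simp
  qed
  then have "integrable lborel (\<lambda>x. (norm (f x))\<^sup>2)"
    by (subst (asm) integrable_completion) auto
  then have "f \<in> bounded_L2"
    by (auto simp: bounded_L2_def f_def intro!: exI[of _ R])
  then show thesis using that ae by blast
qed

lemma bounded_L2_compact_support:
  assumes "f \<in> bounded_L2"
  shows "compact (closure {x. f x \<noteq> 0})"
proof -
  obtain R where "\<And>x. R < norm x \<Longrightarrow> f x = 0" using assms by (auto simp: bounded_L2_def)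
  then have "{x. f x \<noteq> 0} \<subseteq> cball 0 R" by force
  then show ?thesis by (auto simp: compact_closure intro: bounded_subset)
qed

section \<open>Polynomial images and vanishing moments\<close>

text \<open>
  The test function \<open>\<bar>D\<bar> / D\<close>, cut off to a ball, is bounded by one and turns the integral into that of
  \<open>\<bar>D\<bar>\<close> over the ball.
\<close>

lemma AE_zero_if_annihilates_bounded_L2:
  fixes D :: "real ^ 'n \<Rightarrow> 'a :: {real_normed_field, euclidean_space}"
  assumes D[measurable]: "D \<in> borel_measurable borel"
    and int: "\<And>f. f \<in> bounded_L2 \<Longrightarrow> integrable lborel (\<lambda>x. D x * f x)"
    and zero: "\<And>f. f \<in> bounded_L2 \<Longrightarrow> (LINT x|lborel. D x * f x) = 0"
  shows "AE x in lborel. D x = 0"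
proof -
  have "AE x in lborel. norm x \<le> real N \<longrightarrow> D x = 0" for N
  proof -
    define f where "f x = (if norm x \<le> real N then of_real (norm (D x)) / D x else 0)" for x
    have f: "f \<in> bounded_L2"
    proof (rule bounded_L2_of_bounded)
      show "f \<in> borel_measurable borel" unfolding f_def by measurable
      show "norm (f x) \<le> 1" for x
        by (simp add: f_def norm_divide)
      show "f x = 0" if "real N < norm x" for x
        using that by (simp add: f_def)
    qed
    have Df: "D x * f x = of_real (if norm x \<le> real N then norm (D x) else 0)" for x
      by (simp add: f_def)
    have "integrable lborel (\<lambda>x. norm (D x * f x))"
      using int[OF f] by simp
    also have "(\<lambda>x. norm (D x * f x)) = (\<lambda>x. if norm x \<le> real N then norm (D x) else 0)"
      unfolding Df by auto
    finally have i: "integrable lborel (\<lambda>x. if norm x \<le> real N then norm (D x) else 0)" .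
    have "of_real (LINT x|lborel. (if norm x \<le> real N then norm (D x) else 0)) = (LINT x|lborel. D x * f x)"
      unfolding Df by (rule integral_bounded_linear[OF bounded_linear_of_real i, symmetric])
    then have "(LINT x|lborel. (if norm x \<le> real N then norm (D x) else 0)) = 0"
      using zero[OF f] by simp
    then have "AE x in lborel. (if norm x \<le> real N then norm (D x) else 0) = 0"
      by (subst (asm) integral_nonneg_eq_0_iff_AE[OF i]) auto
    then show ?thesis by eventually_elim (auto split: if_splits)
  qed
  then have "AE x in lborel. \<forall>N. norm x \<le> real N \<longrightarrow> D x = 0"
    by (subst AE_all_countable) blast
  then show ?thesis
    by eventually_elim (use real_arch_simple in blast)
qed

theorem proposition2p16:
  fixes K :: "real ^ 'n \<Rightarrow> real ^ 'n \<Rightarrow> 'a :: {real_normed_field, euclidean_space}"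
    and T :: "(real ^ 'n \<Rightarrow> 'a) \<Rightarrow> real ^ 'n \<Rightarrow> 'a"
    and x\<^sub>0 :: "real ^ 'n" and r\<^sub>0 :: real and s :: nat
  assumes "standard_kernel s K"
    and "cz_operator K T"
    and "r\<^sub>0 > 0"
    and limit_exists: "\<And>\<nu> :: nat ^ 'n. mi_order \<nu> \<le> s \<Longrightarrow> AE x in lebesgue. \<exists>l.
      ((\<lambda>\<eta>. truncated_modified_cz s (transpose_kernel K) x\<^sub>0 r\<^sub>0
               (\<lambda>y. of_real (mi_power y \<nu>)) \<eta> x) \<longlongrightarrow> l) (at_right 0)"
  shows "adjoint_vanishes_on_polys s T \<longleftrightarrow>
    (\<forall>\<nu> :: nat ^ 'n. mi_order \<nu> \<le> s \<longrightarrow>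
      (\<exists>P \<in> poly_fun s. AE x in lebesgue.
         modified_cz s (transpose_kernel K) x\<^sub>0 r\<^sub>0 (\<lambda>y. of_real (mi_power y \<nu>)) x = P x))"
proof -
  obtain C \<delta> where kc: "kernel_bounds K s C \<delta>" using standard_kernel_bounds[OF assms(1)] .
  obtain M where core: "borel_cz_operator K s C \<delta> (\<lambda>f. borel_version (T f)) M"
    using borel_cz_operator_borel_version[OF kc assms(2)] .
  interpret borel_cz_operator K s C \<delta> "\<lambda>f. borel_version (T f)" M by (rule core)
  have T: "bounded_linear_L2 T" using assms(2) by (simp add: cz_operator_def)
  let ?e = "\<lambda>k. inverse (real (Suc k))"
  let ?p = "\<lambda>\<nu> x. of_real (mi_power x \<nu>) :: 'a"
  have p: "?p \<nu> \<in> borel_measurable borel" for \<nu> by measurable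
  define g where "g \<nu> k y = (LINT x|lborel. modified_integrand x\<^sub>0 r\<^sub>0 (?p \<nu>) (?e k) y x)" for \<nu> k y
  \<comment> \<open>The limit along a sequence of levels is a Borel function that agrees almost everywhere with the limit over all levels.\<close>
  define G where "G \<nu> y = lim (\<lambda>k. g \<nu> k y)" for \<nu> y
  have [measurable]: "g \<nu> k \<in> borel_measurable borel" for \<nu> k
  proof -
    have "(\<lambda>(y, x). modified_integrand x\<^sub>0 r\<^sub>0 (?p \<nu>) (?e k) y x) \<in> borel_measurable (borel \<Otimes>\<^sub>M lborel)"
      using measurable_compose[OF measurable_pair_swap' modified_integrand_measurable(1)[OF p]]
      by (simp add: split_beta)
    then show ?thesis unfolding g_def by (rule lborel.borel_measurable_lebesgue_integral)
  qed
  have Gm[measurable]: "G \<nu> \<in> borel_measurable borel" for \<nu>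
    unfolding G_def by measurable
  have G: "AE y in lborel. (\<lambda>k. g \<nu> k y) \<longlonglongrightarrow> G \<nu> y \<and>
      modified_cz s (transpose_kernel K) x\<^sub>0 r\<^sub>0 (?p \<nu>) y = G \<nu> y" if "mi_order \<nu> \<le> s" for \<nu>
    using limit_exists[OF that, unfolded AE_completion_iff]
  proof eventually_elim
    case (elim y)
    then obtain l where l: "((\<lambda>\<eta>. truncated_modified_cz s (transpose_kernel K) x\<^sub>0 r\<^sub>0 (?p \<nu>) \<eta> y) \<longlongrightarrow> l) (at_right 0)"
      by blast
    then have "modified_cz s (transpose_kernel K) x\<^sub>0 r\<^sub>0 (?p \<nu>) y = l"
      unfolding modified_cz_def by (intro tendsto_Lim) auto
    moreover have "(\<lambda>k. g \<nu> k y) \<longlonglongrightarrow> l"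
      using filterlim_compose[OF l inverse_Suc_at_right_0] truncated_modified_cz_eq[OF _ \<open>r\<^sub>0 > 0\<close> p]
      by (simp add: g_def)
    moreover from this have "G \<nu> y = l" unfolding G_def by (rule limI)
    ultimately show ?case by simp
  qed
  have id: "integrable lborel (\<lambda>y. G \<nu> y * f y)"
    "(\<And>\<gamma>. mi_order \<gamma> \<le> s \<Longrightarrow> (LINT y|lborel. f y * ?p \<gamma> y) = 0) \<Longrightarrow>
      (LINT x|lborel. borel_version (T f) x * ?p \<nu> x) = (LINT y|lborel. G \<nu> y * f y)"
    if "mi_order \<nu> \<le> s" "f \<in> bounded_L2" for \<nu> f
  proof -
    have "AE y in lborel. (\<lambda>k. LINT x|lborel. modified_integrand x\<^sub>0 r\<^sub>0 (?p \<nu>) (?e k) y x) \<longlonglongrightarrow> G \<nu> y"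
      using G[OF that(1)] unfolding g_def by eventually_elim simp
    from adjoint_identity[OF \<open>r\<^sub>0 > 0\<close> that Gm this]
    show "integrable lborel (\<lambda>y. G \<nu> y * f y)"
      "(\<And>\<gamma>. mi_order \<gamma> \<le> s \<Longrightarrow> (LINT y|lborel. f y * ?p \<gamma> y) = 0) \<Longrightarrow>
        (LINT x|lborel. borel_version (T f) x * ?p \<nu> x) = (LINT y|lborel. G \<nu> y * f y)"
      by blast+
  qed
  have pl: "(LINT x|lebesgue. h x * ?p \<gamma> x) = (LINT x|lborel. h' x * ?p \<gamma> x)"
    if "h \<in> borel_measurable lebesgue" and [measurable]: "h' \<in> borel_measurable borel"
      and "AE x in lborel. h x = h' x" for h h' \<gamma>
  proof -
    have pm: "?p \<gamma> \<in> borel_measurable lebesgue" "h' \<in> borel_measurable lebesgue"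
      by (intro measurable_completion, measurable)+
    have "(LINT x|lebesgue. h x * ?p \<gamma> x) = (LINT x|lebesgue. h' x * ?p \<gamma> x)"
    proof (rule integral_cong_AE)
      show "AE x in lebesgue. h x * ?p \<gamma> x = h' x * ?p \<gamma> x"
        unfolding AE_completion_iff using that(3) by eventually_elim simp
    qed (use that(1) pm in \<open>auto intro: borel_measurable_times\<close>)
    also have "\<dots> = (LINT x|lborel. h' x * ?p \<gamma> x)"
      by (intro integral_completion) measurable
    finally show ?thesis .
  qed
  have Tb: "T f \<in> borel_measurable lebesgue" if "f \<in> L2" for f
    using T that by (auto simp: bounded_linear_L2_def L2_def)
  show ?thesis
  proof
    assume adj: "adjoint_vanishes_on_polys s T"
    show "\<forall>\<nu> :: nat ^ 'n. mi_order \<nu> \<le> s \<longrightarrow>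
      (\<exists>P \<in> poly_fun s. AE x in lebesgue. modified_cz s (transpose_kernel K) x\<^sub>0 r\<^sub>0 (?p \<nu>) x = P x)"
    proof (intro allI impI)
      fix \<nu> :: "nat ^ 'n" assume \<nu>: "mi_order \<nu> \<le> s"
      let ?I = "{\<gamma> :: nat ^ 'n. mi_order \<gamma> \<le> s}"
      have fp: "integrable lborel (\<lambda>y. f y * ?p \<gamma> y)" if "f \<in> bounded_L2" for f \<gamma>
        using bounded_L2_integrable_mi_power[OF that, of 0 0 \<gamma>] by simp
      have "\<exists>c. \<forall>f\<in>bounded_L2. (LINT y|lborel. G \<nu> y * f y) = (\<Sum>\<gamma>\<in>?I. c \<gamma> * (LINT y|lborel. f y * ?p \<gamma> y))"
      proof (rule functional_in_span_if_kernels_le[OF finite_mi_order_le])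
        fix f h :: "real ^ 'n \<Rightarrow> 'a" and c :: 'a assume f: "f \<in> bounded_L2" and h: "h \<in> bounded_L2"
        show "(\<lambda>x. f x + c * h x) \<in> bounded_L2" by (rule bounded_L2_combine[OF f h])
        have "(LINT y|lborel. (f y + c * h y) * ?p \<gamma> y) = (LINT y|lborel. f y * ?p \<gamma> y + c * (h y * ?p \<gamma> y))" for \<gamma>
          by (simp add: algebra_simps)
        then show "(LINT y|lborel. (f y + c * h y) * ?p \<gamma> y) = (LINT y|lborel. f y * ?p \<gamma> y) + c * (LINT y|lborel. h y * ?p \<gamma> y)" for \<gamma>
          using fp[OF f] fp[OF h] by simp
        have "(LINT y|lborel. G \<nu> y * (f y + c * h y)) = (LINT y|lborel. G \<nu> y * f y + c * (G \<nu> y * h y))"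
          by (simp add: algebra_simps)
        then show "(LINT y|lborel. G \<nu> y * (f y + c * h y)) = (LINT y|lborel. G \<nu> y * f y) + c * (LINT y|lborel. G \<nu> y * h y)"
          using id(1)[OF \<nu> f] id(1)[OF \<nu> h] by simp
      next
        fix f :: "real ^ 'n \<Rightarrow> 'a" assume f: "f \<in> bounded_L2"
          and mom: "\<And>\<gamma>. \<gamma> \<in> ?I \<Longrightarrow> (LINT y|lborel. f y * ?p \<gamma> y) = 0"
        note fL = bounded_L2_in_L2[OF f]
        have fl: "f \<in> borel_measurable lebesgue" using fL by (simp add: L2_def)
        have "(LINT x|lebesgue. f x * ?p \<gamma> x) = 0" if "mi_order \<gamma> \<le> s" for \<gamma>
          using pl[OF fl bounded_L2_measurable[OF f]] mom that by simp
        then have "(LINT x|lebesgue. T f x * ?p \<nu> x) = 0"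
          using adj fL bounded_L2_compact_support[OF f] \<nu> unfolding adjoint_vanishes_on_polys_def by blast
        then have "(LINT x|lborel. borel_version (T f) x * ?p \<nu> x) = 0"
          using pl[OF Tb[OF fL] borel_version[OF Tb[OF fL]]] by simp
        then show "(LINT y|lborel. G \<nu> y * f y) = 0"
          using id(2)[OF \<nu> f] mom by simp
      qed
      then obtain c where c: "\<And>f. f \<in> bounded_L2 \<Longrightarrow>
          (LINT y|lborel. G \<nu> y * f y) = (\<Sum>\<gamma>\<in>?I. c \<gamma> * (LINT y|lborel. f y * ?p \<gamma> y))" by blast
      define P where "P = (\<lambda>x. \<Sum>\<gamma>\<in>?I. c \<gamma> * ?p \<gamma> x)"
      have Pm[measurable]: "P \<in> borel_measurable borel" unfolding P_def by measurable
      have Pf: "P y * f y = (\<Sum>\<gamma>\<in>?I. c \<gamma> * (f y * ?p \<gamma> y))" for y f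
        unfolding P_def sum_distrib_right by (intro sum.cong) (simp_all add: mult_ac)
      have Pi: "integrable lborel (\<lambda>y. P y * f y)" if "f \<in> bounded_L2" for f
        unfolding Pf using fp[OF that] by auto
      have PI: "(LINT y|lborel. P y * f y) = (LINT y|lborel. G \<nu> y * f y)" if "f \<in> bounded_L2" for f
        unfolding Pf c[OF that] using fp[OF that] by simp
      have "AE y in lborel. G \<nu> y - P y = 0"
      proof (rule AE_zero_if_annihilates_bounded_L2)
        fix f :: "real ^ 'n \<Rightarrow> 'a" assume f: "f \<in> bounded_L2"
        show "integrable lborel (\<lambda>y. (G \<nu> y - P y) * f y)"
          using id(1)[OF \<nu> f] Pi[OF f] by (simp add: left_diff_distrib)
        show "(LINT y|lborel. (G \<nu> y - P y) * f y) = 0"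
          using id(1)[OF \<nu> f] Pi[OF f] PI[OF f] by (simp add: left_diff_distrib)
      qed measurable
      then have "AE y in lebesgue. modified_cz s (transpose_kernel K) x\<^sub>0 r\<^sub>0 (?p \<nu>) y = P y"
        using G[OF \<nu>] unfolding AE_completion_iff by eventually_elim simp
      moreover have "P \<in> poly_fun s" unfolding poly_fun_def P_def by blast
      ultimately show "\<exists>P \<in> poly_fun s. AE x in lebesgue. modified_cz s (transpose_kernel K) x\<^sub>0 r\<^sub>0 (?p \<nu>) x = P x"
        by blast
    qed
  next
    assume poly: "\<forall>\<nu> :: nat ^ 'n. mi_order \<nu> \<le> s \<longrightarrow>
      (\<exists>P \<in> poly_fun s. AE x in lebesgue. modified_cz s (transpose_kernel K) x\<^sub>0 r\<^sub>0 (?p \<nu>) x = P x)"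
    show "adjoint_vanishes_on_polys s T"
      unfolding adjoint_vanishes_on_polys_def
    proof (intro ballI impI allI, elim conjE)
      fix a :: "real ^ 'n \<Rightarrow> 'a" and \<nu> :: "nat ^ 'n"
      assume a: "a \<in> L2" "compact (closure {x. a x \<noteq> 0})" and \<nu>: "mi_order \<nu> \<le> s"
        and mom: "\<forall>\<gamma>. mi_order \<gamma> \<le> s \<longrightarrow> (LINT x|lebesgue. a x * ?p \<gamma> x) = 0"
      obtain f where f: "f \<in> bounded_L2" and af: "AE x in lborel. a x = f x"
        using bounded_L2_representative[OF a] .
      note fL = bounded_L2_in_L2[OF f]
      have am: "a \<in> borel_measurable lebesgue" using a by (simp add: L2_def)
      have momf: "(LINT y|lborel. f y * ?p \<gamma> y) = 0" if "mi_order \<gamma> \<le> s" for \<gamma>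
        using pl[OF am bounded_L2_measurable[OF f] af] mom that by simp
      have "AE x in lborel. T a x = T f x"
        using bounded_linear_L2_cong_AE[OF T a(1) fL] af unfolding AE_completion_iff by blast
      then have "AE x in lborel. T a x = borel_version (T f) x"
        using borel_version(2)[OF Tb[OF fL]] by eventually_elim simp
      then have "(LINT x|lebesgue. T a x * ?p \<nu> x) = (LINT x|lborel. borel_version (T f) x * ?p \<nu> x)"
        by (intro pl Tb a borel_version fL)
      also have "\<dots> = (LINT y|lborel. G \<nu> y * f y)"
        by (rule id(2)[OF \<nu> f momf])
      also have "\<dots> = 0"
      proof -
        obtain P where "P \<in> poly_fun s" and P: "AE x in lborel. modified_cz s (transpose_kernel K) x\<^sub>0 r\<^sub>0 (?p \<nu>) x = P x"
          using poly \<nu> unfolding AE_completion_iff by blast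
        then obtain c where c: "P = (\<lambda>x. \<Sum>\<gamma> | mi_order \<gamma> \<le> s. c \<gamma> * ?p \<gamma> x)"
          unfolding poly_fun_def by blast
        have "AE y in lborel. G \<nu> y * f y = (\<Sum>\<gamma> | mi_order \<gamma> \<le> s. c \<gamma> * (f y * ?p \<gamma> y))"
          using G[OF \<nu>] P
        proof eventually_elim
          case (elim y)
          then have "G \<nu> y * f y = (\<Sum>\<gamma> | mi_order \<gamma> \<le> s. c \<gamma> * ?p \<gamma> y) * f y" by (simp add: c)
          also have "\<dots> = (\<Sum>\<gamma> | mi_order \<gamma> \<le> s. c \<gamma> * (f y * ?p \<gamma> y))"
            unfolding sum_distrib_right by (intro sum.cong) (simp_all add: mult_ac)
          finally show ?case .
        qed
        then have "(LINT y|lborel. G \<nu> y * f y) = (LINT y|lborel. (\<Sum>\<gamma> | mi_order \<gamma> \<le> s. c \<gamma> * (f y * ?p \<gamma> y)))"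
        proof (rule integral_cong_AE[rotated 2])
          note [measurable] = bounded_L2_measurable[OF f]
          show "(\<lambda>y. G \<nu> y * f y) \<in> borel_measurable lborel"
            "(\<lambda>y. \<Sum>\<gamma> | mi_order \<gamma> \<le> s. c \<gamma> * (f y * ?p \<gamma> y)) \<in> borel_measurable lborel"
            by measurable
        qed
        also have "\<dots> = (\<Sum>\<gamma> | mi_order \<gamma> \<le> s. LINT y|lborel. c \<gamma> * (f y * ?p \<gamma> y))"
          using bounded_L2_integrable_mi_power[OF f, of 0 0] by (intro Bochner_Integration.integral_sum) simp
        also have "\<dots> = 0" using momf by (intro sum.neutral) simp
        finally show ?thesis .
      qed
      finally show "(LINT x|lebesgue. T a x * ?p \<nu> x) = 0" .
    qed
  qed
qed

end
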